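(* Let $k\ge 1$, let $M$ be a $(4k-1)$-dimensional (smooth, Riemannian) manifold, let $\nabla_0^{TM},\nabla_1^{TM}$ be two connections on $TM$, and let $\xi$ be a two-dimensional oriented Euclidean real vector bundle over $M$ with a Euclidean connection $\nabla^{\xi}$. With the transgressed forms $CS\Phi_L, CS\Phi_W, CS\Phi_W'$ defined in the context: 1) $\{CS\Phi_L(\nabla_0^{TM},\nabla_1^{TM},\nabla^{\xi},\tau)\}^{(4k-1)}$ is a modular form of weight $2k$ over $\Gamma_0(2)$; $\{CS\Phi_W(\nabla_0^{TM},\nabla_1^{TM},\nabla^{\xi},\tau)\}^{(4k-1)}$ is a modular form of weight $2k$ over $\Gamma^0(2)$; $\{CS\Phi_W'(\nabla_0^{TM},\nabla_1^{TM},\nabla^{\xi},\tau)\}^{(4k-1)}$ is a modular form of weight $2k$ over $\Gamma_\theta$. 2) The following equalities hold: $$\Big\{CS\Phi_L\big(\nabla_0^{TM},\nabla_1^{TM},\nabla^{\xi},-\tfrac{1}{\tau}\big)\Big\}^{(4k-1)}=(2\tau)^{2k}\{CS\Phi_W(\nabla_0^{TM},\nabla_1^{TM},\nabla^{\xi},\tau)\}^{(4k-1)},$$ $$CS\Phi_W(\nabla_0^{TM},\nabla_1^{TM},\nabla^{\xi},\tau+1)=CS\Phi_W'(\nabla_0^{TM},\nabla_1^{TM},\nabla^{\xi},\tau).$$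
   Context: Theta functions. For $\tau\in\mathbf H$ (upper half plane), $q=e^{2\pi\sqrt{-1}\tau}$, $q^{a}=e^{2\pi\sqrt{-1}a\tau}$, $v\in\mathbf C$: $\theta(v,\tau)=2q^{1/8}\sin(\pi v)\prod_{j\ge1}(1-q^j)(1-e^{2\pi\sqrt{-1}v}q^j)(1-e^{-2\pi\sqrt{-1}v}q^j)$, $\theta_1(v,\tau)=2q^{1/8}\cos(\pi v)\prod_{j\ge1}(1-q^j)(1+e^{2\pi\sqrt{-1}v}q^j)(1+e^{-2\pi\sqrt{-1}v}q^j)$, $\theta_2(v,\tau)=\prod_{j\ge1}(1-q^j)(1-e^{2\pi\sqrt{-1}v}q^{j-1/2})(1-e^{-2\pi\sqrt{-1}v}q^{j-1/2})$, $\theta_3(v,\tau)=\prod_{j\ge1}(1-q^j)(1+e^{2\pi\sqrt{-1}v}q^{j-1/2})(1+e^{-2\pi\sqrt{-1}v}q^{j-1/2})$. A prime denotes $\partial/\partial v$. Modular forms. $\Gamma_0(2)$, resp. $\Gamma^0(2)$, is the subgroup of matrices $\begin{pmatrix}a&b\\c&d\end{pmatrix}\in SL_2(\mathbf Z)$ with $c$ even, resp. $b$ even; $\Gamma_\theta$ is the subgroup of those congruent mod 2 to $\begin{pmatrix}1&0\\0&1\end{pmatrix}$ or $\begin{pmatrix}0&1\\1&0\end{pmatrix}$. A modular form of weight $w$ over $\Gamma\subset SL_2(\mathbf Z)$ is a holomorphic function $f$ on $\mathbf H$ with $f\big(\frac{a\tau+b}{c\tau+d}\big)=\chi(g)(c\tau+d)^{w}f(\tau)$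 for all $g=\begin{pmatrix}a&b\\c&d\end{pmatrix}\in\Gamma$, where $\chi:\Gamma\to\mathbf C^*$ is a character. For functions of $\tau$ with values in differential forms the condition is understood coefficientwise (pointwise on $M$). $\{\cdot\}^{(p)}$ denotes the degree $p$ component of a form. Conventions. A power series (in $z$) is evaluated on a curvature by substitution (curvatures are nilpotent), and for a power series $f$ with nonzero constant term $\det^{1/2}(f(R))$ is the usual Chern–Weil square root $\exp(\frac12\mathrm{tr}\log f(R))$. Removable singularities at $z=0$ are understood as removed, so that e.g. $\frac1z-\frac{\theta'(z,\tau)}{\theta(z,\tau)}$ is a power series in $z$. Characteristic forms. $R^{\xi}=(\nabla^\xi)^2$. For a connection $\nabla^{TM}$ on $TM$ with curvature $R^{TM}$ put $\Phi_L(\nabla^{TM},\nabla^\xi,\tau)=\sqrt2^{\,4k-1}\det^{1/2}\Big(f_L(\tfrac{R^{TM}}{4\pi^2},\tau)\Big)\det^{1/2}\Big(h_L(\tfrac{R^\xi}{4\pi^2},\tau)\Big)$, $\Phi_W(\nabla^{TM},\nabla^\xi,\tau)=\det^{1/2}\Big(f_W(\tfrac{R^{TM}}{4\pi^2},\tau)\Big)\det^{1/2}\Big(h_W(\tfrac{R^\xi}{4\pi^2},\tau)\Big)$, $\Phi_W'(\nabla^{TM},\nabla^\xi,\tau)=\det^{1/2}\Big(f_{W'}(\tfrac{R^{TM}}{4\pi^2},\tau)\Big)\det^{1/2}\Big(h_{W'}(\tfrac{R^\xi}{4\pi^2},\tau)\Big)$, where $f_L(z,\tau)=z\frac{\theta'(0,\tau)}{\theta(z,\tau)}\frac{\theta_1(z,\tau)}{\theta_1(0,\tau)}$,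 $f_W(z,\tau)=z\frac{\theta'(0,\tau)}{\theta(z,\tau)}\frac{\theta_2(z,\tau)}{\theta_2(0,\tau)}$, $f_{W'}(z,\tau)=z\frac{\theta'(0,\tau)}{\theta(z,\tau)}\frac{\theta_3(z,\tau)}{\theta_3(0,\tau)}$, $h_L(z,\tau)=\frac{\theta_1^2(0,\tau)}{\theta_1^2(z,\tau)}\frac{\theta_3(z,\tau)}{\theta_3(0,\tau)}\frac{\theta_2(z,\tau)}{\theta_2(0,\tau)}$, $h_W(z,\tau)=\frac{\theta_2^2(0,\tau)}{\theta_2^2(z,\tau)}\frac{\theta_3(z,\tau)}{\theta_3(0,\tau)}\frac{\theta_1(z,\tau)}{\theta_1(0,\tau)}$, $h_{W'}(z,\tau)=\frac{\theta_3^2(0,\tau)}{\theta_3^2(z,\tau)}\frac{\theta_1(z,\tau)}{\theta_1(0,\tau)}\frac{\theta_2(z,\tau)}{\theta_2(0,\tau)}$. (For Euclidean $\nabla^{TM}$ these are the forms $\frac{\widehat L(TM)}{\cosh^2(c/2)}\mathrm{ch}(\Theta_1)$, $\widehat A(TM)\cosh(\frac c2)\mathrm{ch}(\Theta_2)$, $\widehat A(TM)\cosh(\frac c2)\mathrm{ch}(\Theta_3)$, where $c$ is the Euler form of $(\xi,\nabla^\xi)$, $\widehat A(TM)=\det^{1/2}\Big(\frac{\frac{\sqrt{-1}}{4\pi}R^{TM}}{\sinh(\frac{\sqrt{-1}}{4\pi}R^{TM})}\Big)$, $\widehat L(TM)=\det^{1/2}\Big(\frac{\frac{\sqrt{-1}}{2\pi}R^{TM}}{\tanh(\frac{\sqrt{-1}}{4\pi}R^{TM})}\Big)$,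 and, with $\widetilde E=E-\dim E$ and $S_t,\wedge_t$ the total symmetric and exterior powers, $\Theta_1=\bigotimes_{n\ge1}S_{q^n}(\widetilde{T_CM})\otimes\bigotimes_{m\ge1}\wedge_{q^m}(\widetilde{T_CM}-2\widetilde{\xi_C})\otimes\bigotimes_{r\ge1}\wedge_{q^{r-1/2}}(\widetilde{\xi_C})\otimes\bigotimes_{s\ge1}\wedge_{-q^{s-1/2}}(\widetilde{\xi_C})$, $\Theta_2=\bigotimes_{n\ge1}S_{q^n}(\widetilde{T_CM})\otimes\bigotimes_{m\ge1}\wedge_{-q^{m-1/2}}(\widetilde{T_CM}-2\widetilde{\xi_C})\otimes\bigotimes_{r\ge1}\wedge_{q^{r-1/2}}(\widetilde{\xi_C})\otimes\bigotimes_{s\ge1}\wedge_{q^{s}}(\widetilde{\xi_C})$, $\Theta_3=\bigotimes_{n\ge1}S_{q^n}(\widetilde{T_CM})\otimes\bigotimes_{m\ge1}\wedge_{q^{m-1/2}}(\widetilde{T_CM}-2\widetilde{\xi_C})\otimes\bigotimes_{r\ge1}\wedge_{q^{r}}(\widetilde{\xi_C})\otimes\bigotimes_{s\ge1}\wedge_{-q^{s-1/2}}(\widetilde{\xi_C})$.) Transgressed forms. Let $A=\nabla_1^{TM}-\nabla_0^{TM}\in\Omega^1(M,\mathrm{End}\,TM)$, $\nabla_t^{TM}=(1-t)\nabla_0^{TM}+t\nabla_1^{TM}$ with curvature $R_t^{TM}$, and $Z_t=R_t^{TM}/(4\pi^2)$. Define $CS\Phi_L(\nabla_0^{TM},\nabla_1^{TM},\nabla^\xi,\tau)=\frac{\sqrt2}{8\pi^2}\int_0^1\Phi_L(\nabla_t^{TM},\nabla^\xi,\tau)\,\mathrm{tr}\Big[A\Big(\frac1{Z_t}-\frac{\theta'(Z_t,\tau)}{\theta(Z_t,\tau)}+\frac{\theta_1'(Z_t,\tau)}{\theta_1(Z_t,\tau)}\Big)\Big]dt$,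 $CS\Phi_W(\nabla_0^{TM},\nabla_1^{TM},\nabla^\xi,\tau)=\frac{1}{8\pi^2}\int_0^1\Phi_W(\nabla_t^{TM},\nabla^\xi,\tau)\,\mathrm{tr}\Big[A\Big(\frac1{Z_t}-\frac{\theta'(Z_t,\tau)}{\theta(Z_t,\tau)}+\frac{\theta_2'(Z_t,\tau)}{\theta_2(Z_t,\tau)}\Big)\Big]dt$, $CS\Phi_W'(\nabla_0^{TM},\nabla_1^{TM},\nabla^\xi,\tau)=\frac{1}{8\pi^2}\int_0^1\Phi_W'(\nabla_t^{TM},\nabla^\xi,\tau)\,\mathrm{tr}\Big[A\Big(\frac1{Z_t}-\frac{\theta'(Z_t,\tau)}{\theta(Z_t,\tau)}+\frac{\theta_3'(Z_t,\tau)}{\theta_3(Z_t,\tau)}\Big)\Big]dt$. *)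

theory Defs
  imports "HOL-Complex_Analysis.Complex_Analysis" "HOL-Library.Function_Algebras"
begin

text \<open>Reserve \<open>$\<close> for vectors; with both meanings matrix entries parse ambiguously.\<close>
no_notation fps_nth (infixl \<open>$\<close> 75)

section \<open>Smooth manifolds and tangent spaces\<close>

primrec Ck_on :: "nat \<Rightarrow> (real^'n::finite) set \<Rightarrow> (real^'n \<Rightarrow> real) \<Rightarrow> bool" where
  "Ck_on 0 S f \<longleftrightarrow> continuous_on S f"
| "Ck_on (Suc k) S f \<longleftrightarrow> f differentiable_on S \<and>
     (\<forall>i. Ck_on k S (\<lambda>u. frechet_derivative f (at u) (axis i 1)))"

text \<open>Only used for open \<open>S\<close>.\<close>
definition Cinf_on :: "(real^'n::finite) set \<Rightarrow> (real^'n \<Rightarrow> real) \<Rightarrow> bool" where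
  "Cinf_on S f \<longleftrightarrow> (\<forall>k. Ck_on k S f)"

text \<open>A chart is an open set together with its coordinate map, which is relevant on that set only.
  The underlying space of the manifold is the whole type \<open>'m\<close>.\<close>
type_synonym ('m, 'n) chart = "'m set \<times> ('m \<Rightarrow> real^'n)"

definition smooth_atlas ::
    "('m::{t2_space, second_countable_topology}, 'n::finite) chart set \<Rightarrow> bool" where
  "smooth_atlas A \<longleftrightarrow>
     (\<Union>(fst ` A)) = UNIV \<and>
     (\<forall>(V, \<phi>)\<in>A. open V \<and> open (\<phi> ` V) \<and> homeomorphism V (\<phi> ` V) \<phi> (inv_into V \<phi>)) \<and>
     (\<forall>(V, \<phi>)\<in>A. \<forall>(V', \<phi>')\<in>A. \<forall>i.
        Cinf_on (\<phi> ` (V \<inter> V')) (\<lambda>u. \<phi>' (inv_into V \<phi> u) $ i))"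

text \<open>Functions, vector fields and sections are total functions on \<open>'m\<close>; smoothness is asserted on
  an open set \<open>U\<close>.\<close>
definition smooth_fun ::
    "('m::{t2_space, second_countable_topology}, 'n::finite) chart set \<Rightarrow> 'm set \<Rightarrow> ('m \<Rightarrow> real) \<Rightarrow> bool" where
  "smooth_fun A U f \<longleftrightarrow> (\<forall>(V, \<phi>)\<in>A. Cinf_on (\<phi> ` (U \<inter> V)) (f \<circ> inv_into V \<phi>))"

definition smooth_near ::
    "('m::{t2_space, second_countable_topology}, 'n::finite) chart set \<Rightarrow> 'm \<Rightarrow> ('m \<Rightarrow> real) \<Rightarrow> bool" where
  "smooth_near A x f \<longleftrightarrow> (\<exists>U. open U \<and> x \<in> U \<and> smooth_fun A U f)"

instantiation "fun" :: (type, real_vector) real_vector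
begin

definition scaleR_fun :: "real \<Rightarrow> ('a \<Rightarrow> 'b) \<Rightarrow> 'a \<Rightarrow> 'b" where
  "scaleR_fun c f = (\<lambda>x. c *\<^sub>R f x)"

instance
  by standard (simp_all add: scaleR_fun_def fun_eq_iff scaleR_add_right scaleR_add_left)

end

text \<open>Tangent vectors are derivations on germs of smooth functions. A derivation is made total by
  the value \<open>0\<close> on functions that are not smooth near the point.\<close>
type_synonym 'm tvec = "('m \<Rightarrow> real) \<Rightarrow> real"
type_synonym 'm vfield = "'m \<Rightarrow> 'm tvec"

definition tangent_space ::
    "('m::{t2_space, second_countable_topology}, 'n::finite) chart set \<Rightarrow> 'm \<Rightarrow> 'm tvec set" where
  "tangent_space A x = {D.
     (\<forall>f g. smooth_near A x f \<longrightarrow> smooth_near A x g \<longrightarrow>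
        D (\<lambda>y. f y + g y) = D f + D g \<and>
        D (\<lambda>y. f y * g y) = D f * g x + f x * D g) \<and>
     (\<forall>c f. smooth_near A x f \<longrightarrow> D (\<lambda>y. c * f y) = c * D f) \<and>
     (\<forall>f g. smooth_near A x f \<longrightarrow> eventually (\<lambda>y. f y = g y) (nhds x) \<longrightarrow> D f = D g) \<and>
     (\<forall>f. \<not> smooth_near A x f \<longrightarrow> D f = 0)}"

definition lie_bracket ::
    "('m::{t2_space, second_countable_topology}, 'n::finite) chart set
      \<Rightarrow> 'm vfield \<Rightarrow> 'm vfield \<Rightarrow> 'm vfield" where
  "lie_bracket A X Y = (\<lambda>x f. if smooth_near A x f
     then X x (\<lambda>y. Y y f) - Y x (\<lambda>y. X y f) else 0)"

section \<open>Vector bundles\<close>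

text \<open>A local frame \<open>fvec\<close> over the open set \<open>fdom\<close>, with its dual coframe \<open>fcov\<close>.\<close>
record ('m, 'v, 'r) frame =
  fdom :: "'m set"
  fvec :: "'r \<Rightarrow> 'm \<Rightarrow> 'v"
  fcov :: "'r \<Rightarrow> 'm \<Rightarrow> 'v \<Rightarrow> real"

text \<open>The fibres are linear subspaces of one real vector space \<open>'v\<close>, which is no loss of generality:
  any family of vector spaces embeds into its direct sum. The smooth structure is given by a
  covering family of local frames.\<close>
record ('m, 'v, 'r) vbundle =
  fibre :: "'m \<Rightarrow> 'v set"
  frames :: "('m, 'v, 'r) frame set"

definition vector_bundle ::
    "('m::{t2_space, second_countable_topology}, 'n::finite) chart set
      \<Rightarrow> ('m, 'v::real_vector, 'r::finite) vbundle \<Rightarrow> bool" where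
  "vector_bundle A E \<longleftrightarrow>
     (\<forall>x. subspace (fibre E x)) \<and>
     (\<Union>(fdom ` frames E)) = UNIV \<and>
     (\<forall>F\<in>frames E. open (fdom F) \<and> (\<forall>x\<in>fdom F.
        (\<forall>i. fvec F i x \<in> fibre E x) \<and>
        (\<forall>i. \<forall>v\<in>fibre E x. \<forall>w\<in>fibre E x. fcov F i x (v + w) = fcov F i x v + fcov F i x w) \<and>
        (\<forall>i c. \<forall>v\<in>fibre E x. fcov F i x (c *\<^sub>R v) = c * fcov F i x v) \<and>
        (\<forall>i j. fcov F i x (fvec F j x) = (if i = j then 1 else 0)) \<and>
        (\<forall>v\<in>fibre E x. v = (\<Sum>i\<in>UNIV. fcov F i x v *\<^sub>R fvec F i x)))) \<and>
     (\<forall>F\<in>frames E. \<forall>G\<in>frames E. \<forall>i j.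
        smooth_fun A (fdom F \<inter> fdom G) (\<lambda>x. fcov G i x (fvec F j x)))"

text \<open>An orientation is recorded by the choice of a covering family of positively oriented frames.\<close>
definition oriented_vector_bundle ::
    "('m::{t2_space, second_countable_topology}, 'n::finite) chart set
      \<Rightarrow> ('m, 'v::real_vector, 'r::finite) vbundle \<Rightarrow> bool" where
  "oriented_vector_bundle A E \<longleftrightarrow> vector_bundle A E \<and>
     (\<forall>F\<in>frames E. \<forall>G\<in>frames E. \<forall>x\<in>fdom F \<inter> fdom G.
        det (\<chi> i j. fcov G i x (fvec F j x)) > 0)"

definition smooth_section ::
    "('m::{t2_space, second_countable_topology}, 'n::finite) chart set
      \<Rightarrow> ('m, 'v::real_vector, 'r::finite) vbundle \<Rightarrow> 'm set \<Rightarrow> ('m \<Rightarrow> 'v) \<Rightarrow> bool" where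
  "smooth_section A E U s \<longleftrightarrow> (\<forall>x\<in>U. s x \<in> fibre E x) \<and>
     (\<forall>F\<in>frames E. \<forall>i. smooth_fun A (U \<inter> fdom F) (\<lambda>x. fcov F i x (s x)))"

definition coordinate_frame ::
    "('m::{t2_space, second_countable_topology}, 'n::finite) chart set
      \<Rightarrow> ('m, 'n) chart \<Rightarrow> ('m, 'm tvec, 'n) frame" where
  "coordinate_frame A = (\<lambda>(V, \<phi>). \<lparr> fdom = V,
     fvec = (\<lambda>i x f. if smooth_near A x f
       then frechet_derivative (f \<circ> inv_into V \<phi>) (at (\<phi> x)) (axis i 1) else 0),
     fcov = (\<lambda>i x D. D (\<lambda>y. \<phi> y $ i)) \<rparr>)"

definition tangent_bundle ::
    "('m::{t2_space, second_countable_topology}, 'n::finite) chart set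
      \<Rightarrow> ('m, 'm tvec, 'n) vbundle" where
  "tangent_bundle A = \<lparr> fibre = tangent_space A, frames = coordinate_frame A ` A \<rparr>"

abbreviation smooth_vfield ::
    "('m::{t2_space, second_countable_topology}, 'n::finite) chart set \<Rightarrow> 'm set \<Rightarrow> 'm vfield \<Rightarrow> bool" where
  "smooth_vfield A \<equiv> smooth_section A (tangent_bundle A)"

definition bundle_metric ::
    "('m::{t2_space, second_countable_topology}, 'n::finite) chart set
      \<Rightarrow> ('m, 'v::real_vector, 'r::finite) vbundle \<Rightarrow> ('m \<Rightarrow> 'v \<Rightarrow> 'v \<Rightarrow> real) \<Rightarrow> bool" where
  "bundle_metric A E g \<longleftrightarrow>
     (\<forall>x. \<forall>u\<in>fibre E x. \<forall>v\<in>fibre E x.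
        g x u v = g x v u \<and>
        (\<forall>w\<in>fibre E x. g x (u + v) w = g x u w + g x v w) \<and>
        (\<forall>c. g x (c *\<^sub>R u) v = c * g x u v) \<and>
        (u \<noteq> 0 \<longrightarrow> g x u u > 0)) \<and>
     (\<forall>U s s'. open U \<longrightarrow> smooth_section A E U s \<longrightarrow> smooth_section A E U s' \<longrightarrow>
        smooth_fun A U (\<lambda>x. g x (s x) (s' x)))"

section \<open>Connections\<close>

type_synonym ('m, 'v) connection_op = "'m vfield \<Rightarrow> ('m \<Rightarrow> 'v) \<Rightarrow> ('m \<Rightarrow> 'v)"

text \<open>A connection is a covariant derivative, regarded as acting on the vector fields and sections
  over every open set \<open>U\<close>, compatibly with restriction. (A covariant derivative acting on global
  sections only extends uniquely to such a family, as it is a local operator.) The first conjunct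
  also says that the value on \<open>U\<close> depends only on the restrictions to \<open>U\<close>.\<close>
definition connection ::
    "('m::{t2_space, second_countable_topology}, 'n::finite) chart set
      \<Rightarrow> ('m, 'v::real_vector, 'r::finite) vbundle \<Rightarrow> ('m, 'v) connection_op \<Rightarrow> bool" where
  "connection A E D \<longleftrightarrow> (\<forall>U X s. open U \<longrightarrow> smooth_vfield A U X \<longrightarrow> smooth_section A E U s \<longrightarrow>
     smooth_section A E U (D X s) \<and>
     (\<forall>X' s'. (\<forall>x\<in>U. X' x = X x \<and> s' x = s x) \<longrightarrow> (\<forall>x\<in>U. D X' s' x = D X s x)) \<and>
     (\<forall>Y. smooth_vfield A U Y \<longrightarrow>
        (\<forall>x\<in>U. D (\<lambda>y. X y + Y y) s x = D X s x + D Y s x)) \<and>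
     (\<forall>s'. smooth_section A E U s' \<longrightarrow>
        (\<forall>x\<in>U. D X (\<lambda>y. s y + s' y) x = D X s x + D X s' x)) \<and>
     (\<forall>f. smooth_fun A U f \<longrightarrow> (\<forall>x\<in>U.
        D (\<lambda>y. f y *\<^sub>R X y) s x = f x *\<^sub>R D X s x \<and>
        D X (\<lambda>y. f y *\<^sub>R s y) x = X x f *\<^sub>R s x + f x *\<^sub>R D X s x)))"

definition metric_connection ::
    "('m::{t2_space, second_countable_topology}, 'n::finite) chart set
      \<Rightarrow> ('m, 'v::real_vector, 'r::finite) vbundle \<Rightarrow> ('m \<Rightarrow> 'v \<Rightarrow> 'v \<Rightarrow> real)
      \<Rightarrow> ('m, 'v) connection_op \<Rightarrow> bool" where
  "metric_connection A E g D \<longleftrightarrow> connection A E D \<and>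
     (\<forall>U X s s'. open U \<longrightarrow> smooth_vfield A U X \<longrightarrow>
        smooth_section A E U s \<longrightarrow> smooth_section A E U s' \<longrightarrow>
        (\<forall>x\<in>U. X x (\<lambda>y. g y (s y) (s' y)) = g x (D X s x) (s' x) + g x (s x) (D X s' x)))"

definition connection_path ::
    "('m, 'v::real_vector) connection_op \<Rightarrow> ('m, 'v) connection_op \<Rightarrow> real \<Rightarrow> ('m, 'v) connection_op" where
  "connection_path D0 D1 t = (\<lambda>X s x. (1 - t) *\<^sub>R D0 X s x + t *\<^sub>R D1 X s x)"

definition curvature ::
    "('m::{t2_space, second_countable_topology}, 'n::finite) chart set
      \<Rightarrow> ('m, 'v::real_vector) connection_op \<Rightarrow> 'm vfield \<Rightarrow> 'm vfield \<Rightarrow> ('m \<Rightarrow> 'v) \<Rightarrow> ('m \<Rightarrow> 'v)" where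
  "curvature A D X Y s = (\<lambda>x. D X (D Y s) x - D Y (D X s) x - D (lie_bracket A X Y) s x)"

section \<open>Differential forms at a point\<close>

text \<open>An inhomogeneous complex form at a fixed point is represented by its values on lists of vector
  fields; its degree \<open>p\<close> component is the restriction to lists of length \<open>p\<close>. The wedge product is the
  sum over shuffles, \<open>(\<alpha> \<and> \<beta>)(X\<^sub>0,\<dots>) = \<Sum>\<^sub>I \<plusminus> \<alpha>(X\<^sub>I) \<beta>(X\<^sub>J)\<close>, \<open>J\<close> the complement
  of \<open>I\<close>, without factorials.\<close>
type_synonym 'x form = "'x list \<Rightarrow> complex"

definition wedge :: "'x form \<Rightarrow> 'x form \<Rightarrow> 'x form" where
  "wedge \<alpha> \<beta> = (\<lambda>Xs. \<Sum>I\<in>Pow {..<length Xs}.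
     (- 1) ^ card {(i, j). i \<in> I \<and> j \<in> {..<length Xs} - I \<and> j < i}
       * \<alpha> (nths Xs I) * \<beta> (nths Xs (- I)))"

definition degree_part :: "nat \<Rightarrow> 'x form \<Rightarrow> 'x form" where
  "degree_part p \<omega> = (\<lambda>Xs. if length Xs = p then \<omega> Xs else 0)"

definition form_one :: "'x form" where
  "form_one = (\<lambda>Xs. if Xs = [] then 1 else 0)"

primrec form_power :: "'x form \<Rightarrow> nat \<Rightarrow> 'x form" where
  "form_power \<omega> 0 = form_one"
| "form_power \<omega> (Suc n) = wedge \<omega> (form_power \<omega> n)"

text \<open>The degree zero part \<open>\<omega> []\<close> is split off. The rest \<open>\<nu>\<close> has positive degree, so that \<open>\<nu>\<^sup>n\<close>
  vanishes on lists of length less than \<open>n\<close> and the sum is the full exponential series.\<close>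
definition form_exp :: "'x form \<Rightarrow> 'x form" where
  "form_exp \<omega> = (\<lambda>Xs. exp (\<omega> []) *
     (\<Sum>n\<le>length Xs. form_power (\<lambda>Ys. if Ys = [] then 0 else \<omega> Ys) n Xs / fact n))"

type_synonym ('r, 'x) mat_form = "'r \<Rightarrow> 'r \<Rightarrow> 'x form"

definition mat_wedge :: "('r::finite, 'x) mat_form \<Rightarrow> ('r, 'x) mat_form \<Rightarrow> ('r, 'x) mat_form" where
  "mat_wedge P Q = (\<lambda>a c Xs. \<Sum>b\<in>UNIV. wedge (P a b) (Q b c) Xs)"

primrec mat_power :: "('r::finite, 'x) mat_form \<Rightarrow> nat \<Rightarrow> ('r, 'x) mat_form" where
  "mat_power P 0 = (\<lambda>a b. if a = b then form_one else (\<lambda>Xs. 0))"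
| "mat_power P (Suc n) = mat_wedge P (mat_power P n)"

definition mat_trace :: "('r::finite, 'x) mat_form \<Rightarrow> 'x form" where
  "mat_trace P = (\<lambda>Xs. \<Sum>a\<in>UNIV. P a a Xs)"

text \<open>Substitution of a matrix of forms of positive degree into a power series; as in
  \<open>form_exp\<close>, the omitted terms vanish on \<open>Xs\<close>.\<close>
definition mat_eval :: "complex fps \<Rightarrow> ('r::finite, 'x) mat_form \<Rightarrow> ('r, 'x) mat_form" where
  "mat_eval f P = (\<lambda>a b Xs. \<Sum>n\<le>length Xs. fps_nth f n * mat_power P n a b Xs)"

text \<open>For series with nonzero constant term; the principal branch is used for the latter. The series
  below all have constant term \<open>1\<close>.\<close>
definition fps_log :: "complex fps \<Rightarrow> complex fps" where
  "fps_log f = fps_const (Ln (fps_nth f 0)) +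
     fps_compose (fps_ln 1) (fps_const (inverse (fps_nth f 0)) * f - 1)"

definition sqrt_det :: "complex fps \<Rightarrow> ('r::finite, 'x) mat_form \<Rightarrow> 'x form" where
  "sqrt_det f P = form_exp (\<lambda>Xs. mat_trace (mat_eval (fps_log f) P) Xs / 2)"

text \<open>The matrices, with respect to a local frame \<open>F\<close> and at the point \<open>x\<close>, of \<open>R/(4\<pi>\<^sup>2)\<close> and of
  \<open>D1 - D0\<close>.\<close>
definition curv_form ::
    "('m::{t2_space, second_countable_topology}, 'n::finite) chart set
      \<Rightarrow> ('m, 'v::real_vector) connection_op \<Rightarrow> ('m, 'v, 'r::finite) frame \<Rightarrow> 'm
      \<Rightarrow> ('r, 'm vfield) mat_form" where
  "curv_form A D F x = (\<lambda>a b Xs. case Xs of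
      [X, Y] \<Rightarrow> complex_of_real (fcov F a x (curvature A D X Y (fvec F b) x)) / (4 * of_real pi ^ 2)
    | _ \<Rightarrow> 0)"

definition diff_form ::
    "('m, 'v::real_vector) connection_op \<Rightarrow> ('m, 'v) connection_op
      \<Rightarrow> ('m, 'v, 'r::finite) frame \<Rightarrow> 'm \<Rightarrow> ('r, 'm vfield) mat_form" where
  "diff_form D0 D1 F x = (\<lambda>a b Xs. case Xs of
      [X] \<Rightarrow> complex_of_real (fcov F a x (D1 X (fvec F b) x - D0 X (fvec F b) x))
    | _ \<Rightarrow> 0)"

section \<open>Theta functions\<close>

definition qpow :: "complex \<Rightarrow> real \<Rightarrow> complex" where
  "qpow \<tau> a = exp (2 * of_real pi * \<i> * of_real a * \<tau>)"

definition evar :: "complex \<Rightarrow> complex" where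
  "evar v = exp (2 * of_real pi * \<i> * v)"

text \<open>The index of the products starts at \<open>0\<close>, that is, \<open>j\<close> stands for \<open>j - 1\<close>.\<close>
definition theta :: "complex \<Rightarrow> complex \<Rightarrow> complex" where
  "theta v \<tau> = 2 * qpow \<tau> (1/8) * sin (of_real pi * v) *
     (\<Prod>j. (1 - qpow \<tau> (real j + 1)) * (1 - evar v * qpow \<tau> (real j + 1))
          * (1 - evar (- v) * qpow \<tau> (real j + 1)))"

definition theta1 :: "complex \<Rightarrow> complex \<Rightarrow> complex" where
  "theta1 v \<tau> = 2 * qpow \<tau> (1/8) * cos (of_real pi * v) *
     (\<Prod>j. (1 - qpow \<tau> (real j + 1)) * (1 + evar v * qpow \<tau> (real j + 1))
          * (1 + evar (- v) * qpow \<tau> (real j + 1)))"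

definition theta2 :: "complex \<Rightarrow> complex \<Rightarrow> complex" where
  "theta2 v \<tau> =
     (\<Prod>j. (1 - qpow \<tau> (real j + 1)) * (1 - evar v * qpow \<tau> (real j + 1/2))
          * (1 - evar (- v) * qpow \<tau> (real j + 1/2)))"

definition theta3 :: "complex \<Rightarrow> complex \<Rightarrow> complex" where
  "theta3 v \<tau> =
     (\<Prod>j. (1 - qpow \<tau> (real j + 1)) * (1 + evar v * qpow \<tau> (real j + 1/2))
          * (1 + evar (- v) * qpow \<tau> (real j + 1/2)))"

definition dtheta :: "(complex \<Rightarrow> complex \<Rightarrow> complex) \<Rightarrow> complex \<Rightarrow> complex \<Rightarrow> complex" where
  "dtheta th v \<tau> = deriv (\<lambda>w. th w \<tau>) v"

definition power_series :: "(complex \<Rightarrow> complex) \<Rightarrow> complex fps" where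
  "power_series f = fps_expansion (remove_sings f) 0"

definition f_L :: "complex \<Rightarrow> complex \<Rightarrow> complex" where
  "f_L z \<tau> = z * (dtheta theta 0 \<tau> / theta z \<tau>) * (theta1 z \<tau> / theta1 0 \<tau>)"

definition f_W :: "complex \<Rightarrow> complex \<Rightarrow> complex" where
  "f_W z \<tau> = z * (dtheta theta 0 \<tau> / theta z \<tau>) * (theta2 z \<tau> / theta2 0 \<tau>)"

definition f_W' :: "complex \<Rightarrow> complex \<Rightarrow> complex" where
  "f_W' z \<tau> = z * (dtheta theta 0 \<tau> / theta z \<tau>) * (theta3 z \<tau> / theta3 0 \<tau>)"

definition h_L :: "complex \<Rightarrow> complex \<Rightarrow> complex" where
  "h_L z \<tau> = ((theta1 0 \<tau>)\<^sup>2 / (theta1 z \<tau>)\<^sup>2) * (theta3 z \<tau> / theta3 0 \<tau>) * (theta2 z \<tau> / theta2 0 \<tau>)"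

definition h_W :: "complex \<Rightarrow> complex \<Rightarrow> complex" where
  "h_W z \<tau> = ((theta2 0 \<tau>)\<^sup>2 / (theta2 z \<tau>)\<^sup>2) * (theta3 z \<tau> / theta3 0 \<tau>) * (theta1 z \<tau> / theta1 0 \<tau>)"

definition h_W' :: "complex \<Rightarrow> complex \<Rightarrow> complex" where
  "h_W' z \<tau> = ((theta3 0 \<tau>)\<^sup>2 / (theta3 z \<tau>)\<^sup>2) * (theta1 z \<tau> / theta1 0 \<tau>) * (theta2 z \<tau> / theta2 0 \<tau>)"

definition log_deriv_term :: "(complex \<Rightarrow> complex \<Rightarrow> complex) \<Rightarrow> complex \<Rightarrow> complex \<Rightarrow> complex" where
  "log_deriv_term th z \<tau> = 1 / z - dtheta theta z \<tau> / theta z \<tau> + dtheta th z \<tau> / th z \<tau>"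

section \<open>Characteristic and transgressed forms\<close>

text \<open>All forms are evaluated at the point \<open>x\<close>, using a local frame \<open>F\<close> of the tangent bundle and
  a local frame \<open>G\<close> of \<open>\<xi>\<close> around \<open>x\<close>; \<open>D\<close> is the connection on the tangent bundle and
  \<open>D\<xi>\<close> the one on \<open>\<xi>\<close>.\<close>

context
  fixes A :: "('m::{t2_space, second_countable_topology}, 'n::finite) chart set"
    and F :: "('m, 'm tvec, 'n) frame"
    and G :: "('m, 'v::real_vector, 'r::finite) frame"
    and x :: 'm
begin

definition Phi_L :: "nat \<Rightarrow> ('m, 'm tvec) connection_op \<Rightarrow> ('m, 'v) connection_op
    \<Rightarrow> complex \<Rightarrow> 'm vfield form" where
  "Phi_L k D D\<xi> \<tau> = (\<lambda>Xs. of_real (sqrt 2) ^ (4 * k - 1) *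
     wedge (sqrt_det (power_series (\<lambda>z. f_L z \<tau>)) (curv_form A D F x))
           (sqrt_det (power_series (\<lambda>z. h_L z \<tau>)) (curv_form A D\<xi> G x)) Xs)"

definition Phi_W :: "('m, 'm tvec) connection_op \<Rightarrow> ('m, 'v) connection_op
    \<Rightarrow> complex \<Rightarrow> 'm vfield form" where
  "Phi_W D D\<xi> \<tau> =
     wedge (sqrt_det (power_series (\<lambda>z. f_W z \<tau>)) (curv_form A D F x))
           (sqrt_det (power_series (\<lambda>z. h_W z \<tau>)) (curv_form A D\<xi> G x))"

definition Phi_W' :: "('m, 'm tvec) connection_op \<Rightarrow> ('m, 'v) connection_op
    \<Rightarrow> complex \<Rightarrow> 'm vfield form" where
  "Phi_W' D D\<xi> \<tau> =
     wedge (sqrt_det (power_series (\<lambda>z. f_W' z \<tau>)) (curv_form A D F x))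
           (sqrt_det (power_series (\<lambda>z. h_W' z \<tau>)) (curv_form A D\<xi> G x))"

definition trace_term :: "(complex \<Rightarrow> complex \<Rightarrow> complex) \<Rightarrow> ('m, 'm tvec) connection_op
    \<Rightarrow> ('m, 'm tvec) connection_op \<Rightarrow> complex \<Rightarrow> real \<Rightarrow> 'm vfield form" where
  "trace_term th D0 D1 \<tau> t = mat_trace (mat_wedge (diff_form D0 D1 F x)
     (mat_eval (power_series (\<lambda>z. log_deriv_term th z \<tau>))
       (curv_form A (connection_path D0 D1 t) F x)))"

definition CS_Phi_L :: "nat \<Rightarrow> ('m, 'm tvec) connection_op \<Rightarrow> ('m, 'm tvec) connection_op
    \<Rightarrow> ('m, 'v) connection_op \<Rightarrow> complex \<Rightarrow> 'm vfield form" where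
  "CS_Phi_L k D0 D1 D\<xi> \<tau> = (\<lambda>Xs. of_real (sqrt 2) / (8 * of_real pi ^ 2) *
     integral {0..1} (\<lambda>t. wedge (Phi_L k (connection_path D0 D1 t) D\<xi> \<tau>)
       (trace_term theta1 D0 D1 \<tau> t) Xs))"

definition CS_Phi_W :: "('m, 'm tvec) connection_op \<Rightarrow> ('m, 'm tvec) connection_op
    \<Rightarrow> ('m, 'v) connection_op \<Rightarrow> complex \<Rightarrow> 'm vfield form" where
  "CS_Phi_W D0 D1 D\<xi> \<tau> = (\<lambda>Xs. 1 / (8 * of_real pi ^ 2) *
     integral {0..1} (\<lambda>t. wedge (Phi_W (connection_path D0 D1 t) D\<xi> \<tau>)
       (trace_term theta2 D0 D1 \<tau> t) Xs))"

definition CS_Phi_W' :: "('m, 'm tvec) connection_op \<Rightarrow> ('m, 'm tvec) connection_op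
    \<Rightarrow> ('m, 'v) connection_op \<Rightarrow> complex \<Rightarrow> 'm vfield form" where
  "CS_Phi_W' D0 D1 D\<xi> \<tau> = (\<lambda>Xs. 1 / (8 * of_real pi ^ 2) *
     integral {0..1} (\<lambda>t. wedge (Phi_W' (connection_path D0 D1 t) D\<xi> \<tau>)
       (trace_term theta3 D0 D1 \<tau> t) Xs))"

end

text \<open>The coefficients of a form on the manifold: its values at all points \<open>x\<close> on all lists of vector
  fields defined and smooth near \<open>x\<close>, computed in any of the given local frames.\<close>
definition form_coeffs ::
    "('m::{t2_space, second_countable_topology}, 'n::finite) chart set
      \<Rightarrow> ('m, 'v::real_vector, 'r::finite) vbundle
      \<Rightarrow> (('m, 'm tvec, 'n) frame \<times> ('m, 'v, 'r) frame \<times> 'm \<times> 'm vfield list) set" where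
  "form_coeffs A E = {(F, G, x, Xs).
     F \<in> frames (tangent_bundle A) \<and> G \<in> frames E \<and>
     (\<exists>W. open W \<and> x \<in> W \<and> W \<subseteq> fdom F \<inter> fdom G \<and> (\<forall>X\<in>set Xs. smooth_vfield A W X))}"

section \<open>Modular forms\<close>

definition SL2Z :: "(int^2^2) set" where
  "SL2Z = {g. det g = 1}"

definition Gamma_lower_2 :: "(int^2^2) set" where
  "Gamma_lower_2 = {g \<in> SL2Z. even (g $ 2 $ 1)}"

definition Gamma_upper_2 :: "(int^2^2) set" where
  "Gamma_upper_2 = {g \<in> SL2Z. even (g $ 1 $ 2)}"

definition Gamma_theta :: "(int^2^2) set" where
  "Gamma_theta = {g \<in> SL2Z.
     (odd (g $ 1 $ 1) \<and> even (g $ 1 $ 2) \<and> even (g $ 2 $ 1) \<and> odd (g $ 2 $ 2)) \<or>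
     (even (g $ 1 $ 1) \<and> odd (g $ 1 $ 2) \<and> odd (g $ 2 $ 1) \<and> even (g $ 2 $ 2))}"

definition character :: "(int^2^2) set \<Rightarrow> (int^2^2 \<Rightarrow> complex) \<Rightarrow> bool" where
  "character \<Gamma> ch \<longleftrightarrow> (\<forall>g\<in>\<Gamma>. ch g \<noteq> 0) \<and> (\<forall>g\<in>\<Gamma>. \<forall>h\<in>\<Gamma>. ch (g ** h) = ch g * ch h)"

definition aut_factor :: "int^2^2 \<Rightarrow> complex \<Rightarrow> complex" where
  "aut_factor g \<tau> = of_int (g $ 2 $ 1) * \<tau> + of_int (g $ 2 $ 2)"

definition moebius_act :: "int^2^2 \<Rightarrow> complex \<Rightarrow> complex" where
  "moebius_act g \<tau> = (of_int (g $ 1 $ 1) * \<tau> + of_int (g $ 1 $ 2)) / aut_factor g \<tau>"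

text \<open>Modular form with several coefficients, indexed by \<open>I\<close>. The character is the same for all
  coefficients.\<close>
definition modular_form ::
    "int \<Rightarrow> (int^2^2) set \<Rightarrow> 'i set \<Rightarrow> (complex \<Rightarrow> 'i \<Rightarrow> complex) \<Rightarrow> bool" where
  "modular_form w \<Gamma> I f \<longleftrightarrow>
     (\<forall>i\<in>I. (\<lambda>\<tau>. f \<tau> i) holomorphic_on {\<tau>. Im \<tau> > 0}) \<and>
     (\<exists>ch. character \<Gamma> ch \<and> (\<forall>g\<in>\<Gamma>. \<forall>\<tau>. Im \<tau> > 0 \<longrightarrow> (\<forall>i\<in>I.
        f (moebius_act g \<tau>) i = ch g * aut_factor g \<tau> powi w * f \<tau> i)))"

end

theory Submission
  imports Defs
begin

text \<open>
  Everything is determined by the power series of \<open>z \<phi>(z)\<close> for the three quotients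
  \<open>\<phi> = \<theta>'(0) \<theta>\<^sub>i(z) / (\<theta>(z) \<theta>\<^sub>i(0))\<close>: the \<open>h\<close>-factors are products of powers of these series, and
  the trace factors are their logarithmic derivatives. Up to a sign, \<open>\<phi>\<close> is doubly periodic for the
  lattice \<open>\<int> + \<int> \<tau>\<close>, with simple poles of residue 1 at the lattice points; the sign is the character
  \<open>m + n \<tau> \<mapsto> (-1)^(p m + r n)\<close> with \<open>(p, r)\<close> equal to \<open>(0, 1)\<close>, \<open>(1, 0)\<close>, \<open>(1, 1)\<close> for
  \<open>i = 1, 2, 3\<close>. By Liouville's theorem these properties determine \<open>\<phi>\<close>. Since the lattices of \<open>\<tau>\<close> and
  \<open>g \<tau>\<close> differ by the factor \<open>c \<tau> + d\<close> only, the modular group acts on the three series through its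
  action on \<open>(p, r)\<close> modulo 2 and the scaling \<open>z \<mapsto> (c \<tau> + d) z\<close>, without recourse to the
  transformation laws of the theta functions themselves. Each group of the theorem is the stabilizer
  of one \<open>(p, r)\<close>, and in degree \<open>4k - 1\<close> the scaling contributes \<open>(c \<tau> + d)^(2k)\<close>.
\<close>

section \<open>Graded algebra of forms\<close>

text \<open>Weight and constants: a curvature has degree 2 and the difference of the two connections
  degree 1, so a coefficient of degree 4k - 1 = 1 + 2 (2k - 1) carries 2k - 1 curvatures. Scaling z
  by \<mu> gives \<mu>^(2k - 1), and the derivative in the logarithmic derivative gives one more
  factor. No root of unity arises, so the characters are trivial. The 2^(2k) in the first equality
  is sqrt 2 times (sqrt 2)^(4k - 1).

  Holomorphy in \<tau> is a separate matter, as the coefficients are integrals over t built from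
  Taylor coefficients in z. The path of connections is affine in t, so the curvature is quadratic in
  t, and the integrand is a finite sum of products c(\<tau>) g(t) on which the integral acts through
  the g(t) only. The c(\<tau>) are holomorphic because the theta products form locally bounded
  families of entire functions of z.\<close>

lemma length_nths_add:
  assumes "I \<subseteq> {..<length Xs}"
  shows "length (nths Xs I) + length (nths Xs (- I)) = length Xs"
proof -
  have "card {i. i < length Xs \<and> i \<in> I} + card {i. i < length Xs \<and> i \<in> - I} = card {..<length Xs}"
    by (subst card_Un_disjoint [symmetric]) (auto intro!: arg_cong [where f = card] simp del: card_lessThan)
  then show ?thesis
    by (simp add: length_nths)
qed

definition even_form :: "'x form \<Rightarrow> bool" where
  "even_form \<omega> \<longleftrightarrow> (\<forall>Xs. odd (length Xs) \<longrightarrow> \<omega> Xs = 0)"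

text \<open>The effect of multiplying every curvature by \<open>c\<close>: degrees 2n and 2n + 1
  both receive c^n, because in odd degree one slot belongs to the difference of the
  connections.\<close>

definition scale_form :: "complex \<Rightarrow> 'x form \<Rightarrow> 'x form" where
  "scale_form c \<omega> = (\<lambda>Xs. c ^ (length Xs div 2) * \<omega> Xs)"

definition homogeneous :: "nat \<Rightarrow> 'x form \<Rightarrow> bool" where
  "homogeneous p \<omega> \<longleftrightarrow> (\<forall>Xs. length Xs \<noteq> p \<longrightarrow> \<omega> Xs = 0)"

text \<open>Half lengths rounded down add up as soon as one of the two lengths is even. For two odd
  factors a power of \<open>c\<close> would be missing on the left.\<close>

lemma wedge_scale_form:
  assumes "even_form \<alpha>"
  shows "wedge (scale_form c \<alpha>) (scale_form c \<beta>) = scale_form c (wedge \<alpha> \<beta>)"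
proof
  fix Xs :: "'a list"
  have "(- 1) ^ e * (c ^ (length (nths Xs I) div 2) * \<alpha> (nths Xs I)) * (c ^ (length (nths Xs (- I)) div 2) * \<beta> (nths Xs (- I)))
     = c ^ (length Xs div 2) * ((- 1) ^ e * \<alpha> (nths Xs I) * \<beta> (nths Xs (- I)))"
    if "I \<in> Pow {..<length Xs}" for I e
  proof (cases "even (length (nths Xs I))")
    case True
    then have "length Xs div 2 = length (nths Xs I) div 2 + length (nths Xs (- I)) div 2"
      using length_nths_add [of I Xs] that by (metis PowD div_plus_div_distrib_dvd_left)
    then show ?thesis by (simp add: power_add)
  next
    case False
    then show ?thesis using assms by (simp add: even_form_def)
  qed
  then show "wedge (scale_form c \<alpha>) (scale_form c \<beta>) Xs = scale_form c (wedge \<alpha> \<beta>) Xs"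
    unfolding wedge_def scale_form_def sum_distrib_left by (intro sum.cong) auto
qed

lemma even_form_wedge:
  assumes "even_form \<alpha>" "even_form \<beta>"
  shows "even_form (wedge \<alpha> \<beta>)"
  unfolding even_form_def
proof (intro allI impI)
  fix Xs :: "'a list"
  assume odd: "odd (length Xs)"
  have "\<alpha> (nths Xs I) * \<beta> (nths Xs (- I)) = 0" if "I \<in> Pow {..<length Xs}" for I
    using assms odd length_nths_add [of I Xs] that unfolding even_form_def
    by (metis PowD even_add mult_eq_0_iff)
  then show "wedge \<alpha> \<beta> Xs = 0"
    unfolding wedge_def by (intro sum.neutral) (auto simp: mult.assoc)
qed

lemma homogeneous_wedge:
  assumes "homogeneous p \<alpha>" "homogeneous q \<beta>"
  shows "homogeneous (p + q) (wedge \<alpha> \<beta>)"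
  unfolding homogeneous_def
proof (intro allI impI)
  fix Xs :: "'a list"
  assume len: "length Xs \<noteq> p + q"
  have "\<alpha> (nths Xs I) * \<beta> (nths Xs (- I)) = 0" if "I \<in> Pow {..<length Xs}" for I
    using assms len length_nths_add [of I Xs] that unfolding homogeneous_def
    by (metis PowD mult_eq_0_iff)
  then show "wedge \<alpha> \<beta> Xs = 0"
    unfolding wedge_def by (intro sum.neutral) (auto simp: mult.assoc)
qed

lemma homogeneous_mat_power:
  assumes "\<And>a b. homogeneous 2 (P a b)"
  shows "homogeneous (2 * n) (mat_power P n a b)"
proof (induction n arbitrary: a b)
  case 0
  then show ?case by (auto simp: homogeneous_def form_one_def)
next
  case (Suc n)
  have "homogeneous (2 + 2 * n) (wedge (P a c) (mat_power P n c b))" for c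
    by (intro homogeneous_wedge assms Suc)
  then show ?case
    by (auto simp: homogeneous_def mat_wedge_def)
qed

text \<open>The n-th power of a matrix of 2-forms lives in degree 2n alone, so each list sees at
  most one coefficient of the series.\<close>

lemma mat_eval_homogeneous:
  assumes "\<And>a b. homogeneous 2 (P a b)"
  shows "mat_eval f P a b Xs =
    (if even (length Xs) then fps_nth f (length Xs div 2) * mat_power P (length Xs div 2) a b Xs else 0)"
proof -
  have *: "mat_power P n a b Xs = 0" if "2 * n \<noteq> length Xs" for n
    using homogeneous_mat_power [of P n a b] assms that by (auto simp: homogeneous_def)
  have "mat_eval f P a b Xs = (\<Sum>n\<le>length Xs. if 2 * n = length Xs then fps_nth f n * mat_power P n a b Xs else 0)"
    unfolding mat_eval_def by (intro sum.cong) (auto simp: *)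
  also have "\<dots> = (if even (length Xs) then fps_nth f (length Xs div 2) * mat_power P (length Xs div 2) a b Xs else 0)"
  proof (cases "even (length Xs)")
    case True
    then have "2 * n = length Xs \<longleftrightarrow> n = length Xs div 2" for n by auto
    then show ?thesis using True by (simp add: sum.delta)
  next
    case False
    then have "2 * n \<noteq> length Xs" for n by (metis dvd_triv_left)
    then show ?thesis using False by simp
  qed
  finally show ?thesis .
qed

section \<open>Rescaling the variable of a power series\<close>

definition fps_scale :: "complex \<Rightarrow> complex fps \<Rightarrow> complex fps" where
  "fps_scale c F = fps_compose F (fps_const c * fps_X)"

lemma fps_scale_nth [simp]: "fps_nth (fps_scale c F) n = c ^ n * fps_nth F n"
  by (simp add: fps_scale_def fps_compose_linear)

lemma fps_scale_1 [simp]: "fps_scale 1 F = F"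
  by (simp add: fps_eq_iff)

lemma fps_scale_mult: "fps_scale c (F * G) = fps_scale c F * fps_scale c G"
  by (simp add: fps_scale_def fps_compose_mult_distrib)

lemma fps_scale_power: "fps_scale c (F ^ n) = fps_scale c F ^ n"
  by (induction n) (simp_all add: fps_scale_mult, simp add: fps_scale_def)

lemma fps_scale_inverse:
  assumes "fps_nth F 0 \<noteq> 0"
  shows "fps_scale c (inverse F) = inverse (fps_scale c F)"
  using assms by (simp add: fps_scale_def fps_inverse_compose)

lemma fps_scale_deriv: "fps_deriv (fps_scale c F) = fps_const c * fps_scale c (fps_deriv F)"
  by (simp add: fps_eq_iff algebra_simps)

lemma fps_log_eq:
  assumes "fps_nth F 0 = 1"
  shows "fps_log F = fps_compose (fps_ln 1) (F - 1)"
  using assms by (simp add: fps_log_def)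

text \<open>With constant term 1 the logarithm is a composition from the left and the rescaling one
  from the right, so they commute by associativity.\<close>

lemma fps_log_scale:
  assumes "fps_nth F 0 = 1"
  shows "fps_log (fps_scale c F) = fps_scale c (fps_log F)"
proof -
  have "fps_scale c F - 1 = fps_compose (F - 1) (fps_const c * fps_X)"
    by (simp add: fps_scale_def fps_compose_sub_distrib)
  then show ?thesis
    using assms by (simp add: fps_log_eq fps_scale_def fps_compose_assoc)
qed

lemma even_form_mat_eval:
  assumes "\<And>a b. homogeneous 2 (P a b)"
  shows "even_form (mat_eval f P a b)"
  by (simp add: even_form_def mat_eval_homogeneous [OF assms])

lemma mat_eval_scale:
  assumes "\<And>a b. homogeneous 2 (P a b)"
  shows "mat_eval (fps_scale c F) P a b = scale_form c (mat_eval F P a b)"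
  by (auto simp: scale_form_def mat_eval_homogeneous [OF assms])

lemma form_power_scale:
  assumes "even_form \<omega>"
  shows "form_power (scale_form c \<omega>) n = scale_form c (form_power \<omega> n)"
proof (induction n)
  case 0
  then show ?case by (auto simp: scale_form_def form_one_def)
next
  case (Suc n)
  then show ?case by (simp add: wedge_scale_form assms)
qed

lemma even_form_power:
  assumes "even_form \<omega>"
  shows "even_form (form_power \<omega> n)"
proof (induction n)
  case 0
  then show ?case by (auto simp: even_form_def form_one_def)
next
  case (Suc n)
  then show ?case by (simp add: even_form_wedge assms)
qed

text \<open>The empty list has weight c^0 = 1, so the numerical factor
  \<open>exp (\<omega> [])\<close> is unchanged and only the part of positive degree is
  scaled.\<close>

lemma form_exp_scale:
  assumes "even_form \<omega>"
  shows "form_exp (scale_form c \<omega>) = scale_form c (form_exp \<omega>)"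
proof
  fix Xs :: "'a list"
  let ?\<nu> = "\<lambda>Ys. if Ys = [] then 0 else \<omega> Ys"
  have "(\<lambda>Ys. if Ys = [] then 0 else scale_form c \<omega> Ys) = scale_form c ?\<nu>"
    by (auto simp: scale_form_def)
  moreover have "even_form ?\<nu>"
    using assms by (auto simp: even_form_def)
  ultimately show "form_exp (scale_form c \<omega>) Xs = scale_form c (form_exp \<omega>) Xs"
    by (simp add: form_exp_def form_power_scale)
      (simp add: scale_form_def sum_distrib_left mult.left_commute)
qed

lemma even_form_exp:
  assumes "even_form \<omega>"
  shows "even_form (form_exp \<omega>)"
proof -
  have "even_form (\<lambda>Ys. if Ys = [] then 0 else \<omega> Ys)"
    using assms by (auto simp: even_form_def)
  then have "even_form (form_power (\<lambda>Ys. if Ys = [] then 0 else \<omega> Ys) n)" for n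
    by (rule even_form_power)
  then show ?thesis
    by (simp add: even_form_def form_exp_def)
qed

lemma even_form_half_trace:
  assumes "\<And>a b. homogeneous 2 (P a b)"
  shows "even_form (\<lambda>Xs. mat_trace (mat_eval f P) Xs / 2)"
  using even_form_mat_eval [of P f, OF assms] by (simp add: even_form_def mat_trace_def)

lemma even_form_sqrt_det:
  assumes "\<And>a b. homogeneous 2 (P a b)"
  shows "even_form (sqrt_det f P)"
  unfolding sqrt_det_def by (intro even_form_exp even_form_half_trace assms)

text \<open>Substituting c z into the series amounts to multiplying the curvature by
  \<open>c\<close>, which is what \<open>scale_form\<close> records.\<close>

lemma sqrt_det_scale:
  assumes "\<And>a b. homogeneous 2 (P a b)" "fps_nth F 0 = 1"
  shows "sqrt_det (fps_scale c F) P = scale_form c (sqrt_det F P)"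
proof -
  have "(\<lambda>Xs. mat_trace (mat_eval (fps_scale c (fps_log F)) P) Xs / 2)
      = scale_form c (\<lambda>Xs. mat_trace (mat_eval (fps_log F) P) Xs / 2)"
    by (simp add: mat_trace_def mat_eval_scale [OF assms(1)])
      (simp add: scale_form_def sum_distrib_left)
  then show ?thesis
    by (simp add: sqrt_det_def fps_log_scale assms(2) form_exp_scale even_form_half_trace assms(1))
qed

text \<open>\<open>B\<close> has degree 1 and is not rescaled, so \<open>wedge_scale_form\<close>
  does not apply. The trace lives in odd degrees 2n + 1, where rounding down counts exactly the n
  curvatures.\<close>

lemma trace_wedge_scale:
  assumes "\<And>a b. homogeneous 2 (P a b)" "\<And>a b. homogeneous 1 (B a b)"
  shows "mat_trace (mat_wedge B (mat_eval (fps_scale c F) P))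
       = scale_form c (mat_trace (mat_wedge B (mat_eval F P)))"
proof
  fix Xs
  have "wedge (B a b) (mat_eval (fps_scale c F) P b a) Xs
      = scale_form c (wedge (B a b) (mat_eval F P b a)) Xs" for a b
  proof -
    have "B a b (nths Xs I) * c ^ (length (nths Xs (- I)) div 2) * mat_eval F P b a (nths Xs (- I))
       = c ^ (length Xs div 2) * (B a b (nths Xs I) * mat_eval F P b a (nths Xs (- I)))"
      if "I \<in> Pow {..<length Xs}" for I
    proof (cases "length (nths Xs I) = 1 \<and> even (length (nths Xs (- I)))")
      case True
      then have "length Xs div 2 = length (nths Xs (- I)) div 2"
        using length_nths_add [of I Xs] that by auto
      then show ?thesis by simp
    next
      case False
      then have "B a b (nths Xs I) = 0 \<or> mat_eval F P b a (nths Xs (- I)) = 0"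
        using assms(2) [of a b] even_form_mat_eval [of P F b a, OF assms(1)]
        by (auto simp: homogeneous_def even_form_def)
      then show ?thesis by auto
    qed
    then show ?thesis
      unfolding mat_eval_scale [OF assms(1)]
      unfolding scale_form_def wedge_def sum_distrib_left
      by (intro sum.cong) (auto simp: mult_ac)
  qed
  then show "mat_trace (mat_wedge B (mat_eval (fps_scale c F) P)) Xs
       = scale_form c (mat_trace (mat_wedge B (mat_eval F P))) Xs"
    by (simp add: mat_trace_def mat_wedge_def) (simp add: scale_form_def sum_distrib_left)
qed

section \<open>Separated variables\<close>

abbreviation upper_half :: "complex set" where
  "upper_half \<equiv> {\<tau>. Im \<tau> > 0}"

text \<open>Integration over t turns such a sum into a combination of the c(\<tau>) with constant
  coefficients, hence into a holomorphic function. Closure under products then covers wedge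
  products, matrix powers and traces.\<close>

inductive separated :: "(complex \<Rightarrow> real \<Rightarrow> complex) \<Rightarrow> bool" where
  base: "c holomorphic_on upper_half \<Longrightarrow> continuous_on UNIV g \<Longrightarrow> separated (\<lambda>\<tau> t. c \<tau> * g t)"
| add: "separated h \<Longrightarrow> separated h' \<Longrightarrow> separated (\<lambda>\<tau> t. h \<tau> t + h' \<tau> t)"

lemma separated_hol: "c holomorphic_on upper_half \<Longrightarrow> separated (\<lambda>\<tau> t. c \<tau>)"
  using separated.base [of c "\<lambda>_. 1"] by simp

lemma separated_cont: "continuous_on UNIV g \<Longrightarrow> separated (\<lambda>\<tau> t. g t)"
  using separated.base [of "\<lambda>_. 1" g] by simp

lemma separated_const: "separated (\<lambda>\<tau> t. a)"
  by (rule separated_cont) simp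

lemma separated_sum:
  assumes "\<And>i. i \<in> I \<Longrightarrow> separated (h i)"
  shows "separated (\<lambda>\<tau> t. \<Sum>i\<in>I. h i \<tau> t)"
  using assms
  by (induction I rule: infinite_finite_induct) (auto intro: separated_const separated.add)

lemma separated_mult_base:
  assumes "separated h" "c holomorphic_on upper_half" "continuous_on UNIV g"
  shows "separated (\<lambda>\<tau> t. c \<tau> * g t * h \<tau> t)"
  using assms(1)
proof induction
  case (base c' g')
  have "separated (\<lambda>\<tau> t. (c \<tau> * c' \<tau>) * (g t * g' t))"
    using base assms by (intro separated.base holomorphic_intros continuous_intros) auto
  then show ?case by (simp add: mult_ac)
next
  case (add h h')
  then show ?case using separated.add [OF add.IH] by (simp add: distrib_left)
qed

lemma separated_mult:
  assumes "separated h" "separated h'"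
  shows "separated (\<lambda>\<tau> t. h \<tau> t * h' \<tau> t)"
  using assms(1)
proof induction
  case (base c g)
  then show ?case using separated_mult_base assms(2) by blast
next
  case (add h1 h2)
  then show ?case using separated.add [OF add.IH] by (simp add: distrib_right)
qed

lemma separated_continuous:
  assumes "separated h"
  shows "continuous_on UNIV (h \<tau>)"
  using assms by induction (auto intro!: continuous_intros)

lemma separated_integral_holomorphic:
  assumes "separated h"
  shows "(\<lambda>\<tau>. integral {a..b} (h \<tau>)) holomorphic_on upper_half"
  using assms
proof induction
  case (base c g)
  then show ?case by (auto intro!: holomorphic_intros)
next
  case (add h h')
  have "h \<tau> integrable_on {a..b}" "h' \<tau> integrable_on {a..b}" for \<tau>
    using add.hyps by (auto intro!: integrable_continuous_real continuous_on_subset [OF separated_continuous])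
  then have "integral {a..b} (\<lambda>t. h \<tau> t + h' \<tau> t) = integral {a..b} (h \<tau>) + integral {a..b} (h' \<tau>)" for \<tau>
    by (rule integral_add)
  then show ?case using add.IH by (auto intro!: holomorphic_intros)
qed

definition separated_on :: "'x set \<Rightarrow> (complex \<Rightarrow> real \<Rightarrow> 'x form) \<Rightarrow> bool" where
  "separated_on S \<omega> \<longleftrightarrow> (\<forall>Xs. set Xs \<subseteq> S \<longrightarrow> separated (\<lambda>\<tau> t. \<omega> \<tau> t Xs))"

lemma separated_onD: "separated_on S \<omega> \<Longrightarrow> set Xs \<subseteq> S \<Longrightarrow> separated (\<lambda>\<tau> t. \<omega> \<tau> t Xs)"
  by (simp add: separated_on_def)

lemma separated_on_wedge:
  assumes "separated_on S \<alpha>" "separated_on S \<beta>"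
  shows "separated_on S (\<lambda>\<tau> t. wedge (\<alpha> \<tau> t) (\<beta> \<tau> t))"
proof -
  have "set (nths Xs I) \<subseteq> S" if "set Xs \<subseteq> S" for Xs I
    using that set_nths_subset by (rule order_trans [rotated])
  then show ?thesis
    unfolding separated_on_def wedge_def
    by (auto intro!: separated_sum separated_mult separated_const separated_onD [OF assms(1)] separated_onD [OF assms(2)])
qed

lemma separated_on_form_one: "separated_on S (\<lambda>\<tau> t. form_one)"
  by (simp add: separated_on_def separated_const)

lemma separated_on_form_power:
  assumes "separated_on S \<omega>"
  shows "separated_on S (\<lambda>\<tau> t. form_power (\<omega> \<tau> t) n)"
  by (induction n) (auto intro: separated_on_form_one separated_on_wedge assms)

lemma separated_on_mat_wedge:
  assumes "\<And>a b. separated_on S (\<lambda>\<tau> t. P \<tau> t a b)" "\<And>a b. separated_on S (\<lambda>\<tau> t. Q \<tau> t a b)"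
  shows "separated_on S (\<lambda>\<tau> t. mat_wedge (P \<tau> t) (Q \<tau> t) a b)"
proof -
  have "separated_on S (\<lambda>\<tau> t. wedge (P \<tau> t a c) (Q \<tau> t c b))" for c
    by (intro separated_on_wedge assms)
  then show ?thesis
    unfolding separated_on_def mat_wedge_def by (auto intro!: separated_sum)
qed

lemma separated_on_mat_power:
  assumes "\<And>a b. separated_on S (\<lambda>\<tau> t. P \<tau> t a b)"
  shows "separated_on S (\<lambda>\<tau> t. mat_power (P \<tau> t) n a b)"
proof (induction n arbitrary: a b)
  case 0
  then show ?case by (auto simp: separated_on_form_one) (simp add: separated_on_def separated_const)
next
  case (Suc n)
  then show ?case by (simp add: separated_on_mat_wedge assms)
qed

definition holomorphic_coeffs :: "(complex \<Rightarrow> complex fps) \<Rightarrow> bool" where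
  "holomorphic_coeffs F \<longleftrightarrow> (\<forall>n. (\<lambda>\<tau>. fps_nth (F \<tau>) n) holomorphic_on upper_half)"

lemma separated_on_mat_eval:
  assumes "holomorphic_coeffs F" "\<And>a b. separated_on S (\<lambda>\<tau> t. P \<tau> t a b)"
  shows "separated_on S (\<lambda>\<tau> t. mat_eval (F \<tau>) (P \<tau> t) a b)"
  unfolding separated_on_def mat_eval_def
  using assms(1) separated_on_mat_power [of S P, OF assms(2)]
  by (auto intro!: separated_sum separated_mult separated_hol simp: separated_on_def holomorphic_coeffs_def)

lemma separated_on_mat_trace:
  assumes "\<And>a b. separated_on S (\<lambda>\<tau> t. P \<tau> t a b)"
  shows "separated_on S (\<lambda>\<tau> t. mat_trace (P \<tau> t))"
  using assms unfolding separated_on_def mat_trace_def by (auto intro!: separated_sum)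

text \<open>The exponential of a separated function need not be separated. Hence the degree zero
  part, which is exponentiated as a number, has to be independent of t.\<close>

lemma separated_on_form_exp:
  assumes "separated_on S \<omega>" "\<And>\<tau> t. \<omega> \<tau> t [] = w \<tau>" "w holomorphic_on upper_half"
  shows "separated_on S (\<lambda>\<tau> t. form_exp (\<omega> \<tau> t))"
proof -
  have "separated_on S (\<lambda>\<tau> t Ys. if Ys = [] then 0 else \<omega> \<tau> t Ys)"
    unfolding separated_on_def
  proof (intro allI impI)
    fix Xs assume "set Xs \<subseteq> S"
    with assms(1) show "separated (\<lambda>\<tau> t. if Xs = [] then 0 else \<omega> \<tau> t Xs)"
      by (cases Xs) (auto simp: separated_const separated_on_def)
  qed
  from separated_on_form_power [OF this] show ?thesis
    unfolding separated_on_def form_exp_def divide_inverse assms(2)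
    using assms(3)
    by (auto intro!: separated_sum separated_mult separated_hol separated_const holomorphic_intros)
qed

section \<open>Power series with coefficients holomorphic in \<tau>\<close>

lemma holomorphic_coeffs_mult:
  assumes "holomorphic_coeffs F" "holomorphic_coeffs G"
  shows "holomorphic_coeffs (\<lambda>\<tau>. F \<tau> * G \<tau>)"
  using assms by (auto simp: holomorphic_coeffs_def fps_mult_nth intro!: holomorphic_intros)

lemma holomorphic_coeffs_const [simp]: "holomorphic_coeffs (\<lambda>\<tau>. F)"
  by (simp add: holomorphic_coeffs_def)

lemma holomorphic_coeffs_diff:
  assumes "holomorphic_coeffs F" "holomorphic_coeffs G"
  shows "holomorphic_coeffs (\<lambda>\<tau>. F \<tau> - G \<tau>)"
  using assms by (auto simp: holomorphic_coeffs_def intro!: holomorphic_intros)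

lemma holomorphic_coeffs_fps_const:
  assumes "f holomorphic_on upper_half"
  shows "holomorphic_coeffs (\<lambda>\<tau>. fps_const (f \<tau>))"
  unfolding holomorphic_coeffs_def
proof
  show "(\<lambda>\<tau>. fps_nth (fps_const (f \<tau>)) n) holomorphic_on upper_half" for n
    using assms by (cases n) auto
qed

lemma holomorphic_coeffs_power:
  assumes "holomorphic_coeffs F"
  shows "holomorphic_coeffs (\<lambda>\<tau>. F \<tau> ^ n)"
  by (induction n) (auto intro: holomorphic_coeffs_mult assms)

lemma holomorphic_coeffs_deriv:
  assumes "holomorphic_coeffs F"
  shows "holomorphic_coeffs (\<lambda>\<tau>. fps_deriv (F \<tau>))"
  using assms by (auto simp: holomorphic_coeffs_def intro!: holomorphic_intros)

lemma holomorphic_coeffs_compose: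
  assumes "holomorphic_coeffs F"
  shows "holomorphic_coeffs (\<lambda>\<tau>. fps_compose G (F \<tau>))"
  using holomorphic_coeffs_power [OF assms]
  by (auto simp: holomorphic_coeffs_def fps_compose_nth intro!: holomorphic_intros)

lemma holomorphic_coeffs_cong:
  assumes "\<And>\<tau>. Im \<tau> > 0 \<Longrightarrow> F \<tau> = G \<tau>" "holomorphic_coeffs G"
  shows "holomorphic_coeffs F"
  unfolding holomorphic_coeffs_def
proof
  fix n
  have "(\<lambda>\<tau>. fps_nth (F \<tau>) n) holomorphic_on upper_half \<longleftrightarrow> (\<lambda>\<tau>. fps_nth (G \<tau>) n) holomorphic_on upper_half"
    by (intro holomorphic_cong refl) (simp add: assms(1))
  with assms(2) show "(\<lambda>\<tau>. fps_nth (F \<tau>) n) holomorphic_on upper_half"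
    by (simp add: holomorphic_coeffs_def)
qed

text \<open>The coefficients of the inverse series obey a recursion that divides by the constant
  term only.\<close>

lemma holomorphic_coeffs_inverse:
  assumes "holomorphic_coeffs F" "\<And>\<tau>. Im \<tau> > 0 \<Longrightarrow> fps_nth (F \<tau>) 0 \<noteq> 0"
  shows "holomorphic_coeffs (\<lambda>\<tau>. inverse (F \<tau>))"
  unfolding holomorphic_coeffs_def
proof
  fix n
  show "(\<lambda>\<tau>. fps_nth (inverse (F \<tau>)) n) holomorphic_on upper_half"
  proof (induction n rule: less_induct)
    case (less n)
    have hol: "(\<lambda>\<tau>. fps_nth (F \<tau>) i) holomorphic_on upper_half" for i
      using assms(1) by (simp add: holomorphic_coeffs_def)
    show ?case
    proof (cases n)
      case 0
      then show ?thesis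
        using hol assms(2) by (auto intro!: holomorphic_intros)
    next
      case (Suc m)
      have "fps_nth (inverse (F \<tau>)) n
          = - inverse (fps_nth (F \<tau>) 0) * (\<Sum>i = 1..n. fps_nth (F \<tau>) i * fps_nth (inverse (F \<tau>)) (n - i))" for \<tau>
        by (subst fps_inverse_def) (simp add: Suc fps_inverse_def)
      then show ?thesis
        using hol assms(2) less Suc by (auto intro!: holomorphic_intros)
    qed
  qed
qed

text \<open>At constant term 1 the \<open>Ln\<close> in \<open>fps_log\<close> vanishes and the rest
  is composition with a fixed series, so no branch cut is met.\<close>

lemma holomorphic_coeffs_log:
  assumes "holomorphic_coeffs F" "\<And>\<tau>. Im \<tau> > 0 \<Longrightarrow> fps_nth (F \<tau>) 0 = 1"
  shows "holomorphic_coeffs (\<lambda>\<tau>. fps_log (F \<tau>))"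
proof (rule holomorphic_coeffs_cong)
  show "fps_log (F \<tau>) = fps_compose (fps_ln 1) (F \<tau> - 1)" if "Im \<tau> > 0" for \<tau>
    using that assms(2) by (simp add: fps_log_eq)
qed (intro holomorphic_coeffs_compose holomorphic_coeffs_diff assms holomorphic_coeffs_const)

lemma separated_on_sqrt_det:
  fixes P :: "complex \<Rightarrow> real \<Rightarrow> ('r::finite, 'x) mat_form"
  assumes "holomorphic_coeffs F" "\<And>\<tau>. Im \<tau> > 0 \<Longrightarrow> fps_nth (F \<tau>) 0 = 1"
    and "\<And>a b. separated_on S (\<lambda>\<tau> t. P \<tau> t a b)"
  shows "separated_on S (\<lambda>\<tau> t. sqrt_det (F \<tau>) (P \<tau> t))"
  unfolding sqrt_det_def
proof (rule separated_on_form_exp)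
  have log: "holomorphic_coeffs (\<lambda>\<tau>. fps_log (F \<tau>))"
    by (rule holomorphic_coeffs_log [OF assms(1,2)])
  have "separated_on S (\<lambda>\<tau> t. mat_trace (mat_eval (fps_log (F \<tau>)) (P \<tau> t)))"
    by (intro separated_on_mat_trace separated_on_mat_eval log assms(3))
  then have "separated (\<lambda>\<tau> t. mat_trace (mat_eval (fps_log (F \<tau>)) (P \<tau> t)) Xs * (1/2))" if "set Xs \<subseteq> S" for Xs
    by (rule separated_mult [OF separated_onD separated_const]) (rule that)
  then show "separated_on S (\<lambda>\<tau> t Xs. mat_trace (mat_eval (fps_log (F \<tau>)) (P \<tau> t)) Xs / 2)"
    by (simp add: separated_on_def)
  \<comment> \<open>On the empty list only the zeroth matrix power survives, so the curvature, and
    with it t, drops out; \<open>CARD('r)\<close> is the trace of the identity.\<close>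
  show "mat_trace (mat_eval (fps_log (F \<tau>)) (P \<tau> t)) [] / 2
      = of_nat CARD('r) * fps_nth (fps_log (F \<tau>)) 0 / 2" for \<tau> t
    by (simp add: mat_trace_def mat_eval_def form_one_def)
  show "(\<lambda>\<tau>. of_nat CARD('r) * fps_nth (fps_log (F \<tau>)) 0 / 2) holomorphic_on upper_half"
    using log by (auto simp: holomorphic_coeffs_def intro!: holomorphic_intros)
qed

section \<open>Families of entire functions\<close>

text \<open>The bound, uniform for \<tau> near a point and z in a disc, makes difference quotients
  in z converge locally uniformly in \<tau>. The z-derivatives, and so the Taylor coefficients at 0,
  are then holomorphic in \<tau>.\<close>

definition entire_family :: "complex set \<Rightarrow> (complex \<Rightarrow> complex \<Rightarrow> complex) \<Rightarrow> bool" where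
  "entire_family U F \<longleftrightarrow>
     (\<forall>\<tau>\<in>U. (\<lambda>z. F z \<tau>) holomorphic_on UNIV) \<and> (\<forall>z. F z holomorphic_on U) \<and>
     (\<forall>\<tau>\<^sub>0\<in>U. \<forall>R. \<exists>d>0. \<exists>B. \<forall>\<tau>\<in>cball \<tau>\<^sub>0 d \<inter> U. \<forall>z. norm z \<le> R \<longrightarrow> norm (F z \<tau>) \<le> B)"

lemma norm_higher_deriv_le:
  assumes "f holomorphic_on UNIV" "\<And>z. norm z \<le> R + 1 \<Longrightarrow> norm (f z) \<le> B" "norm w \<le> R"
  shows "norm ((deriv ^^ n) f w) \<le> fact n * B"
proof -
  have "norm ((deriv ^^ n) f w) \<le> fact n * B / 1 ^ n"
  proof (rule Cauchy_inequality)
    show "f holomorphic_on ball w 1" "continuous_on (cball w 1) f"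
      using assms(1) by (auto intro: holomorphic_on_subset holomorphic_on_imp_continuous_on)
    fix x assume "norm (w - x) = 1"
    then have "norm x \<le> R + 1"
      using assms(3) norm_triangle_ineq4 [of w "w - x"] by simp
    then show "norm (f x) \<le> B" by (rule assms(2))
  qed simp
  then show ?thesis by simp
qed

text \<open>Taylor's formula of order one with the Cauchy estimate for the second derivative; the 2
  is \<open>fact 2\<close>. Only \<open>B\<close> enters, so the estimate is uniform over a bounded
  family.\<close>

lemma norm_difference_quotient_le:
  fixes f :: "complex \<Rightarrow> complex"
  assumes "f holomorphic_on UNIV" "\<And>z. norm z \<le> R + 1 \<Longrightarrow> norm (f z) \<le> B" "norm w \<le> R" "norm (w + h) \<le> R"
    and "h \<noteq> 0"
  shows "norm ((f (w + h) - f w) / h - deriv f w) \<le> 2 * B * norm h"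
proof -
  have "norm (f (w + h) - (\<Sum>i\<le>1. (deriv ^^ i) f w * (w + h - w) ^ i / fact i)) \<le> (2 * B) * norm (w + h - w) ^ Suc 1 / fact 1"
  proof (rule complex_Taylor [where S = "cball 0 R" and f = "\<lambda>i. (deriv ^^ i) f", simplified funpow_0])
    show "((deriv ^^ i) f has_field_derivative (deriv ^^ Suc i) f x) (at x within cball 0 R)" for i x
    proof -
      have "(deriv ^^ i) f holomorphic_on UNIV"
        by (intro holomorphic_higher_deriv assms) auto
      then have "((deriv ^^ i) f has_field_derivative deriv ((deriv ^^ i) f) x) (at x)"
        by (rule holomorphic_derivI) auto
      then show ?thesis by (simp add: has_field_derivative_at_within)
    qed
    show "norm ((deriv ^^ Suc 1) f x) \<le> 2 * B" if "x \<in> cball 0 R" for x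
      using norm_higher_deriv_le [of f R B x "Suc 1"] assms(1,2) that by simp
  qed (use assms in auto)
  then have "norm (f (w + h) - f w - deriv f w * h) \<le> 2 * B * norm h ^ 2"
    by (simp add: power2_eq_square algebra_simps)
  moreover have "(f (w + h) - f w) / h - deriv f w = (f (w + h) - f w - deriv f w * h) / h"
    using assms(5) by (simp add: field_simps)
  ultimately show ?thesis
    using assms(5) by (simp add: norm_divide divide_le_eq power2_eq_square mult.assoc)
qed

lemma entire_family_deriv:
  assumes "open U" "entire_family U F"
  shows "entire_family U (\<lambda>z \<tau>. deriv (\<lambda>w. F w \<tau>) z)"
  unfolding entire_family_def
proof (intro conjI ballI allI)
  have hol: "(\<lambda>z. F z \<tau>) holomorphic_on UNIV" if "\<tau> \<in> U" for \<tau>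
    using assms(2) that by (simp add: entire_family_def)
  show "deriv (\<lambda>w. F w \<tau>) holomorphic_on UNIV" if "\<tau> \<in> U" for \<tau>
    using hol [OF that] by (rule holomorphic_deriv) auto
  show "\<exists>d>0. \<exists>B. \<forall>\<tau>\<in>cball \<tau>\<^sub>0 d \<inter> U. \<forall>z. norm z \<le> R \<longrightarrow> norm (deriv (\<lambda>w. F w \<tau>) z) \<le> B"
    if "\<tau>\<^sub>0 \<in> U" for \<tau>\<^sub>0 R
  proof -
    obtain d B where "d > 0" and B: "\<And>\<tau> z. \<tau> \<in> cball \<tau>\<^sub>0 d \<inter> U \<Longrightarrow> norm z \<le> R + 1 \<Longrightarrow> norm (F z \<tau>) \<le> B"
      using assms(2) \<open>\<tau>\<^sub>0 \<in> U\<close> unfolding entire_family_def by meson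
    have "norm (deriv (\<lambda>w. F w \<tau>) z) \<le> B" if "\<tau> \<in> cball \<tau>\<^sub>0 d \<inter> U" "norm z \<le> R" for \<tau> z
      using norm_higher_deriv_le [of "\<lambda>w. F w \<tau>" R B z 1] that hol B by auto
    with \<open>d > 0\<close> show ?thesis by blast
  qed
  show "(\<lambda>\<tau>. deriv (\<lambda>w. F w \<tau>) z) holomorphic_on U" for z
  proof (rule holomorphic_uniform_sequence [OF assms(1)])
    define h where "h n = complex_of_real (inverse (real (Suc n)))" for n
    have h_le: "norm (h n) \<le> 1" and h_nz: "h n \<noteq> 0" for n
      by (simp_all add: h_def norm_inverse inverse_le_1_iff del: of_nat_Suc)
    show "(\<lambda>\<tau>. (F (z + h n) \<tau> - F z \<tau>) / h n) holomorphic_on U" for n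
      using assms(2) h_nz by (auto simp: entire_family_def intro!: holomorphic_intros)
    fix \<tau>\<^sub>0 assume "\<tau>\<^sub>0 \<in> U"
    \<comment> \<open>In the radius below, one unit makes room for the increments \<open>h n\<close>
      and the other for the unit circles of the Cauchy estimate.\<close>
    obtain d B where "d > 0"
      and B: "\<And>\<tau> w. \<tau> \<in> cball \<tau>\<^sub>0 d \<inter> U \<Longrightarrow> norm w \<le> norm z + 1 + 1 \<Longrightarrow> norm (F w \<tau>) \<le> B"
      using assms(2) \<open>\<tau>\<^sub>0 \<in> U\<close> unfolding entire_family_def by meson
    obtain e where "e > 0" "cball \<tau>\<^sub>0 e \<subseteq> U"
      using assms(1) \<open>\<tau>\<^sub>0 \<in> U\<close> open_contains_cball by blast
    define d' where "d' = min d e"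
    have d': "d' > 0" "cball \<tau>\<^sub>0 d' \<subseteq> U" "cball \<tau>\<^sub>0 d' \<subseteq> cball \<tau>\<^sub>0 d \<inter> U"
      using \<open>d > 0\<close> \<open>e > 0\<close> \<open>cball \<tau>\<^sub>0 e \<subseteq> U\<close> by (auto simp: d'_def)
    have le: "norm ((F (z + h n) \<tau> - F z \<tau>) / h n - deriv (\<lambda>w. F w \<tau>) z) \<le> 2 * B * norm (h n)"
      if "\<tau> \<in> cball \<tau>\<^sub>0 d'" for \<tau> n
    proof (rule norm_difference_quotient_le)
      show "(\<lambda>w. F w \<tau>) holomorphic_on UNIV"
        using hol d' that by blast
      show "norm (F w \<tau>) \<le> B" if "norm w \<le> norm z + 1 + 1" for w
        using B d' \<open>\<tau> \<in> cball \<tau>\<^sub>0 d'\<close> that by blast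
      show "norm (z + h n) \<le> norm z + 1"
        using norm_triangle_ineq [of z "h n"] h_le [of n] by linarith
    qed (use h_nz in auto)
    have "uniform_limit (cball \<tau>\<^sub>0 d') (\<lambda>n \<tau>. (F (z + h n) \<tau> - F z \<tau>) / h n) (\<lambda>\<tau>. deriv (\<lambda>w. F w \<tau>) z) sequentially"
    proof (rule uniform_limitI)
      fix \<epsilon> :: real assume "\<epsilon> > 0"
      have "(\<lambda>n. 2 * B * norm (h n)) \<longlonglongrightarrow> 2 * B * 0"
        unfolding h_def norm_of_real by (intro tendsto_intros tendsto_rabs_zero LIMSEQ_inverse_real_of_nat)
      then have "\<forall>\<^sub>F n in sequentially. 2 * B * norm (h n) < \<epsilon>"
        using \<open>\<epsilon> > 0\<close> by (auto dest: order_tendstoD)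
      then show "\<forall>\<^sub>F n in sequentially. \<forall>\<tau>\<in>cball \<tau>\<^sub>0 d'.
          dist ((F (z + h n) \<tau> - F z \<tau>) / h n) (deriv (\<lambda>w. F w \<tau>) z) < \<epsilon>"
      proof eventually_elim
        case (elim n)
        show ?case
          using le [of _ n] elim unfolding dist_norm by (meson le_less_trans)
      qed
    qed
    then show "\<exists>d>0. cball \<tau>\<^sub>0 d \<subseteq> U \<and>
        uniform_limit (cball \<tau>\<^sub>0 d) (\<lambda>n \<tau>. (F (z + h n) \<tau> - F z \<tau>) / h n) (\<lambda>\<tau>. deriv (\<lambda>w. F w \<tau>) z) sequentially"
      using d' by blast
  qed
qed

lemma open_upper_half: "open upper_half"
  by (rule open_halfspace_Im_gt)

lemma holomorphic_coeffs_fps_expansion: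
  assumes "entire_family upper_half F"
  shows "holomorphic_coeffs (\<lambda>\<tau>. fps_expansion (\<lambda>z. F z \<tau>) 0)"
proof -
  have "entire_family upper_half (\<lambda>z \<tau>. (deriv ^^ n) (\<lambda>w. F w \<tau>) z)" for n
  proof (induction n)
    case (Suc n)
    then show ?case using entire_family_deriv [OF open_upper_half Suc] by simp
  qed (use assms in simp)
  then show ?thesis
    by (auto simp: holomorphic_coeffs_def fps_expansion_def entire_family_def intro!: holomorphic_intros)
qed

section \<open>The \<open>q\<close>-Pochhammer symbol\<close>

definition qpoch :: "complex \<Rightarrow> complex \<Rightarrow> complex" where
  "qpoch y q = (\<Prod>j. 1 - y * q ^ j)"

lemma convergent_prod_qpoch:
  fixes q :: complex
  assumes "norm q < 1"
  shows "convergent_prod (\<lambda>j. 1 - y * q ^ j)"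
proof -
  have "summable (\<lambda>j. norm y * norm q ^ j)"
    using assms by (intro summable_mult summable_geometric) auto
  then have "abs_convergent_prod (\<lambda>j. 1 - y * q ^ j)"
    by (intro summable_imp_abs_convergent_prod) (simp add: norm_mult norm_power)
  then show ?thesis by (rule abs_convergent_prod_imp_convergent_prod)
qed

lemma has_prod_qpoch:
  assumes "norm q < 1"
  shows "(\<lambda>j. 1 - y * q ^ j) has_prod qpoch y q"
  unfolding qpoch_def using convergent_prod_qpoch [OF assms] by (rule convergent_prod_has_prod)

lemma qpoch_rec:
  assumes "norm q < 1"
  shows "qpoch y q = (1 - y) * qpoch (y * q) q"
proof -
  have "(\<lambda>j. 1 - y * q ^ Suc j) has_prod qpoch (y * q) q"
    using has_prod_qpoch [OF assms, of "y * q"] by (simp add: mult_ac)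
  then have "(\<lambda>j. 1 - y * q ^ j) has_prod (qpoch (y * q) q * (1 - y * q ^ 0))"
    by (rule has_prod_Suc_imp)
  then show ?thesis
    using has_prod_qpoch [OF assms, of y] has_prod_unique2 by (fastforce simp: mult.commute)
qed

lemma qpoch_eq_0_iff:
  assumes "norm q < 1"
  shows "qpoch y q = 0 \<longleftrightarrow> (\<exists>j. y * q ^ j = 1)"
  using has_prod_eq_0_iff [OF has_prod_qpoch [OF assms, of y]] by (auto simp: image_iff)

lemma tendsto_qpoch:
  assumes "norm q < 1"
  shows "(\<lambda>n. \<Prod>j<n. 1 - y * q ^ j) \<longlonglongrightarrow> qpoch y q"
proof -
  have "(\<lambda>n. \<Prod>j\<le>n. 1 - y * q ^ j) \<longlonglongrightarrow> qpoch y q"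
    unfolding qpoch_def by (intro convergent_prod_LIMSEQ convergent_prod_qpoch assms)
  then show ?thesis
    by (simp add: LIMSEQ_lessThan_iff_atMost)
qed

text \<open>From 1 + x \<le> exp x and the geometric series. The bound is continuous in
  \<open>y\<close> and \<open>q\<close>, which yields the local bounds asked for by
  \<open>entire_family\<close>.\<close>

lemma norm_qpoch_le:
  assumes "norm q < 1"
  shows "norm (qpoch y q) \<le> exp (norm y / (1 - norm q))"
proof (rule LIMSEQ_le_const2 [OF tendsto_norm [OF tendsto_qpoch [OF assms]]], intro exI allI impI)
  fix n
  have "norm (\<Prod>j<n. 1 - y * q ^ j) \<le> (\<Prod>j<n. 1 + norm y * norm q ^ j)"
    unfolding prod_norm [symmetric]
    using norm_triangle_ineq4 [of 1 "y * q ^ _"] by (intro prod_mono) (simp add: norm_mult norm_power)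
  also have "\<dots> \<le> exp (\<Sum>j<n. norm y * norm q ^ j)"
    by (rule prod_le_exp_sum) auto
  also have "(\<Sum>j<n. norm y * norm q ^ j) \<le> (\<Sum>j. norm y * norm q ^ j)"
    using assms by (intro sum_le_suminf summable_mult summable_geometric) auto
  also have "\<dots> = norm y / (1 - norm q)"
    using assms by (simp add: suminf_mult suminf_geometric summable_geometric divide_inverse)
  finally show "norm (\<Prod>j<n. 1 - y * q ^ j) \<le> exp (norm y / (1 - norm q))" by simp
qed

lemma holomorphic_on_qpoch:
  assumes "open U" "f holomorphic_on U" "g holomorphic_on U" "\<And>x. x \<in> U \<Longrightarrow> norm (g x) < 1"
  shows "(\<lambda>x. qpoch (f x) (g x)) holomorphic_on U"
proof (rule holomorphic_uniform_sequence [OF assms(1)])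
  show "(\<lambda>x. \<Prod>j<n. 1 - f x * g x ^ j) holomorphic_on U" for n
    by (intro holomorphic_intros assms)
  fix x assume "x \<in> U"
  obtain e where e: "e > 0" "cball x e \<subseteq> U"
    using assms(1) \<open>x \<in> U\<close> open_contains_cball by blast
  have cont: "continuous_on (cball x e) f" "continuous_on (cball x e) g"
    using assms e by (auto intro!: holomorphic_on_imp_continuous_on intro: holomorphic_on_subset)
  obtain B where B: "\<And>y. y \<in> cball x e \<Longrightarrow> norm (f y) \<le> B"
    using compact_imp_bounded [OF compact_continuous_image [OF cont(1) compact_cball]] unfolding bounded_iff by blast
  \<comment> \<open>On the compact disc the norm of \<open>g\<close> attains its maximum r, which is
    therefore below 1; the terms B r^j then serve as majorants in the Weierstrass test.\<close>
  obtain y\<^sub>0 where y\<^sub>0: "y\<^sub>0 \<in> cball x e" "\<And>y. y \<in> cball x e \<Longrightarrow> norm (g y) \<le> norm (g y\<^sub>0)"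
    using continuous_attains_sup [OF _ _ continuous_on_norm [OF cont(2)]] e(1) by force
  define r where "r = norm (g y\<^sub>0)"
  have r: "r \<ge> 0" "r < 1" "\<And>y. y \<in> cball x e \<Longrightarrow> norm (g y) \<le> r"
    using y\<^sub>0 e assms(4) by (auto simp: r_def)
  have "B \<ge> 0" using order_trans [OF norm_ge_zero B [of x]] e(1) by simp
  have uc: "uniformly_convergent_on (cball x e) (\<lambda>n x. \<Prod>j<n. 1 - f x * g x ^ j)"
  proof (rule uniformly_convergent_on_prod')
    show "uniformly_convergent_on (cball x e) (\<lambda>N x. \<Sum>j<N. norm (1 - f x * g x ^ j - 1))"
    proof (rule Weierstrass_m_test')
      show "summable (\<lambda>j. B * r ^ j)"
        using r by (intro summable_mult summable_geometric) auto
      show "norm (norm (1 - f y * g y ^ j - 1)) \<le> B * r ^ j" if "y \<in> cball x e" for j y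
        using B [OF that] r(3) [OF that] \<open>B \<ge> 0\<close>
        by (auto simp: norm_mult norm_power intro!: mult_mono power_mono)
    qed
  qed (use cont in \<open>auto intro!: continuous_intros\<close>)
  then obtain l where l: "uniform_limit (cball x e) (\<lambda>n x. \<Prod>j<n. 1 - f x * g x ^ j) l sequentially"
    unfolding uniformly_convergent_on_def by blast
  have "l y = qpoch (f y) (g y)" if "y \<in> cball x e" for y
    using tendsto_uniform_limitI [OF l that] tendsto_qpoch [of "g y" "f y"] assms(4) e(2) that
    by (meson LIMSEQ_unique subsetD)
  then have "uniform_limit (cball x e) (\<lambda>n x. \<Prod>j<n. 1 - f x * g x ^ j) l sequentially =
      uniform_limit (cball x e) (\<lambda>n x. \<Prod>j<n. 1 - f x * g x ^ j) (\<lambda>x. qpoch (f x) (g x)) sequentially"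
    by (intro uniform_limit_cong') auto
  with l have "uniform_limit (cball x e) (\<lambda>n x. \<Prod>j<n. 1 - f x * g x ^ j) (\<lambda>x. qpoch (f x) (g x)) sequentially"
    by simp
  then show "\<exists>d>0. cball x d \<subseteq> U \<and> uniform_limit (cball x d) (\<lambda>n x. \<Prod>j<n. 1 - f x * g x ^ j) (\<lambda>x. qpoch (f x) (g x)) sequentially"
    using e by blast
qed

section \<open>The basic theta product\<close>

lemma evar_add: "evar (u + v) = evar u * evar v"
  by (simp add: evar_def exp_add algebra_simps)

lemma evar_0 [simp]: "evar 0 = 1"
  by (simp add: evar_def)

lemma evar_nonzero [simp]: "evar v \<noteq> 0"
  by (simp add: evar_def)

lemma evar_minus: "evar (- v) = inverse (evar v)"
  by (simp add: evar_def exp_minus)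

lemma evar_diff: "evar (u - v) = evar u / evar v"
  using evar_add [of u "- v"] by (simp add: evar_minus divide_inverse)

lemma evar_mult_of_nat: "evar (of_nat n * v) = evar v ^ n"
  by (induction n) (simp_all add: evar_add algebra_simps)

lemma norm_evar: "norm (evar v) = exp (- 2 * pi * Im v)"
  by (simp add: evar_def)

lemma norm_evar_less_1: "Im \<tau> > 0 \<Longrightarrow> norm (evar \<tau>) < 1"
  by (simp add: norm_evar)

lemma evar_eq_1_iff: "evar v = 1 \<longleftrightarrow> (\<exists>m::int. v = of_int m)"
proof
  assume "evar v = 1"
  then obtain n :: int where n: "Re (2 * of_real pi * \<i> * v) = 0" "Im (2 * of_real pi * \<i> * v) = of_int (2 * n) * pi"
    unfolding evar_def exp_eq_1 by blast
  then have "v = of_int n" by (auto simp: complex_eq_iff)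
  then show "\<exists>m::int. v = of_int m" ..
next
  assume "\<exists>m::int. v = of_int m"
  then show "evar v = 1" by (auto simp: evar_def exp_eq_1)
qed

lemma evar_of_int [simp]: "evar (of_int m) = 1"
  using evar_eq_1_iff by blast

lemma evar_1 [simp]: "evar 1 = 1"
  using evar_of_int [of 1] by simp

lemma evar_half [simp]: "evar (1/2) = - 1"
  by (simp add: evar_def)

lemma holomorphic_on_evar [holomorphic_intros]:
  "f holomorphic_on A \<Longrightarrow> (\<lambda>z. evar (f z)) holomorphic_on A"
  unfolding evar_def by (intro holomorphic_intros)

section \<open>A theta product vanishing on the lattice\<close>

definition Lattice :: "complex \<Rightarrow> complex set" where
  "Lattice \<tau> = {w. \<exists>m n::int. w = of_int m + of_int n * \<tau>}"

text \<open>With y = exp(2 pi i v) and q = exp(2 pi i \<tau>) this is (y; q) (q/y; q): a Jacobi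
  theta function up to an exponential in v and a factor independent of v.\<close>

definition Tprod :: "complex \<Rightarrow> complex \<Rightarrow> complex" where
  "Tprod v \<tau> = qpoch (evar v) (evar \<tau>) * qpoch (evar (\<tau> - v)) (evar \<tau>)"

text \<open>\<open>Tprod\<close> with the factor 1 - y divided out, the one that vanishes at v = 0.
  Its value at 0 thus determines the derivative of \<open>Tprod\<close> there.\<close>

definition Sprod :: "complex \<Rightarrow> complex \<Rightarrow> complex" where
  "Sprod v \<tau> = qpoch (evar (\<tau> + v)) (evar \<tau>) * qpoch (evar (\<tau> - v)) (evar \<tau>)"

lemma Tprod_eq_Sprod:
  assumes "Im \<tau> > 0"
  shows "Tprod v \<tau> = (1 - evar v) * Sprod v \<tau>"
  using qpoch_rec [OF norm_evar_less_1 [OF assms], of "evar v"]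
  by (simp add: Tprod_def Sprod_def evar_add mult_ac)

lemma Tprod_add_1: "Tprod (v + 1) \<tau> = Tprod v \<tau>"
  by (simp add: Tprod_def evar_add evar_diff)

text \<open>With y = \<open>evar v\<close>, the shift drops the factor 1 - y from the first product
  and adds 1 - 1/y to the second; (1 - 1/y) / (1 - y) = - 1/y.\<close>

lemma Tprod_add_tau:
  assumes "Im \<tau> > 0"
  shows "Tprod (v + \<tau>) \<tau> = - Tprod v \<tau> / evar v"
proof -
  note rec = qpoch_rec [OF norm_evar_less_1 [OF assms]]
  have *: "a * (- b / c * d) = - (b * a * d) / c" for a b c d :: complex
    by simp
  have "Tprod (v + \<tau>) \<tau> = qpoch (evar v * evar \<tau>) (evar \<tau>) * ((1 - evar (- v)) * qpoch (evar (- v) * evar \<tau>) (evar \<tau>))"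
    using rec [of "evar (- v)"] by (simp add: Tprod_def evar_add)
  also have "1 - evar (- v) = - (1 - evar v) / evar v"
    by (simp add: evar_minus field_simps)
  also have "qpoch (evar v * evar \<tau>) (evar \<tau>) * (- (1 - evar v) / evar v * qpoch (evar (- v) * evar \<tau>) (evar \<tau>))
      = - ((1 - evar v) * qpoch (evar v * evar \<tau>) (evar \<tau>) * qpoch (evar (- v) * evar \<tau>) (evar \<tau>)) / evar v"
    by (rule * )
  also have "\<dots> = - Tprod v \<tau> / evar v"
    unfolding rec [of "evar v", symmetric] Tprod_def by (simp add: evar_add [symmetric])
  finally show ?thesis .
qed

lemma evar_shift_eq_1_iff:
  "evar v * evar \<tau> ^ j = 1 \<longleftrightarrow> (\<exists>m::int. v = of_int m - of_nat j * \<tau>)"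
proof -
  have "evar v * evar \<tau> ^ j = evar (v + of_nat j * \<tau>)"
    by (simp add: evar_add evar_mult_of_nat)
  then show ?thesis by (simp add: evar_eq_1_iff eq_diff_eq)
qed

text \<open>The first product vanishes at the points m + n \<tau> with n \<le> 0, the second at
  those with n \<ge> 1.\<close>

lemma Tprod_eq_0_iff:
  assumes "Im \<tau> > 0"
  shows "Tprod v \<tau> = 0 \<longleftrightarrow> v \<in> Lattice \<tau>"
proof -
  have "Tprod v \<tau> = 0 \<longleftrightarrow> (\<exists>j. \<exists>m::int. v = of_int m - of_nat j * \<tau>) \<or> (\<exists>j. \<exists>m::int. \<tau> - v = of_int m - of_nat j * \<tau>)"
    by (simp add: Tprod_def qpoch_eq_0_iff [OF norm_evar_less_1 [OF assms]] evar_shift_eq_1_iff)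
  also have "\<dots> \<longleftrightarrow> v \<in> Lattice \<tau>"
  proof
    assume "(\<exists>j. \<exists>m::int. v = of_int m - of_nat j * \<tau>) \<or> (\<exists>j. \<exists>m::int. \<tau> - v = of_int m - of_nat j * \<tau>)"
    then consider j and m :: int where "v = of_int m - of_nat j * \<tau>"
      | j and m :: int where "\<tau> - v = of_int m - of_nat j * \<tau>" by blast
    then show "v \<in> Lattice \<tau>"
    proof cases
      case 1
      then have "v = of_int m + of_int (- int j) * \<tau>" by simp
      then show ?thesis unfolding Lattice_def by blast
    next
      case 2
      then have "v = of_int (- m) + of_int (int (Suc j)) * \<tau>" by (simp add: algebra_simps)
      then show ?thesis unfolding Lattice_def by blast
    qed
  next
    assume "v \<in> Lattice \<tau>"
    then obtain m n :: int where v: "v = of_int m + of_int n * \<tau>" by (auto simp: Lattice_def)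
    show "(\<exists>j. \<exists>m::int. v = of_int m - of_nat j * \<tau>) \<or> (\<exists>j. \<exists>m::int. \<tau> - v = of_int m - of_nat j * \<tau>)"
    proof (cases "n \<le> 0")
      case True
      then have "v = of_int m - of_nat (nat (- n)) * \<tau>" by (simp add: v)
      then show ?thesis by blast
    next
      case False
      then have "\<tau> - v = of_int (- m) - of_nat (nat (n - 1)) * \<tau>"
        by (simp add: v algebra_simps)
      then show ?thesis by blast
    qed
  qed
  finally show ?thesis .
qed

lemma real_combination_eq_0_iff:
  assumes "Im \<tau> > 0"
  shows "of_real x + of_real y * \<tau> = 0 \<longleftrightarrow> x = 0 \<and> y = 0"
  using assms by (auto simp: complex_eq_iff)

lemma Sprod_0_nonzero:
  assumes "Im \<tau> > 0"
  shows "Sprod 0 \<tau> \<noteq> 0"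
proof -
  have "\<tau> \<noteq> of_int m - of_nat j * \<tau>" for m :: int and j
  proof
    assume "\<tau> = of_int m - of_nat j * \<tau>"
    then have "Im \<tau> * (1 + real j) = 0"
      by (simp add: complex_eq_iff algebra_simps)
    with assms show False by (simp add: add_pos_nonneg order_less_imp_not_eq2)
  qed
  then show ?thesis
    by (simp add: Sprod_def qpoch_eq_0_iff [OF norm_evar_less_1 [OF assms]] evar_shift_eq_1_iff)
qed

text \<open>The characteristics \<open>(0, 1)\<close>, \<open>(1, 0)\<close> and \<open>(1, 1)\<close> belong to \<open>\<theta>\<^sub>1\<close>, \<open>\<theta>\<^sub>2\<close> and \<open>\<theta>\<^sub>3\<close>.\<close>

definition half_period :: "int \<Rightarrow> int \<Rightarrow> complex \<Rightarrow> complex" where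
  "half_period p r \<tau> = (of_int p * \<tau> + of_int r) / 2"

lemma half_period_notin_Lattice:
  assumes "Im \<tau> > 0" "odd p \<or> odd r"
  shows "half_period p r \<tau> \<notin> Lattice \<tau>"
proof
  assume "half_period p r \<tau> \<in> Lattice \<tau>"
  then obtain m n :: int where "half_period p r \<tau> = of_int m + of_int n * \<tau>" by (auto simp: Lattice_def)
  then have "of_real (of_int r - 2 * of_int m) + of_real (of_int p - 2 * of_int n) * \<tau> = 0"
    by (simp add: half_period_def field_simps)
  then have "real_of_int r - 2 * of_int m = 0" "real_of_int p - 2 * of_int n = 0"
    using real_combination_eq_0_iff [OF assms(1)] by blast+
  then have "r = 2 * m" "p = 2 * n" by linarith+
  with assms(2) show False by auto
qed

section \<open>The quotients and their signs under periods\<close>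

definition sgn2 :: "int \<Rightarrow> complex" where
  "sgn2 p = (if even p then 1 else - 1)"

lemma sgn2_add: "sgn2 (a + b) = sgn2 a * sgn2 b"
  by (auto simp: sgn2_def)

lemma evar_half_int: "evar (of_int p / 2) = sgn2 p"
proof (cases "even p")
  case True
  then obtain m where "p = 2 * m" by blast
  then show ?thesis by (simp add: sgn2_def)
next
  case False
  then obtain m where "p = 2 * m + 1" by (rule oddE)
  then have "of_int p / 2 = of_int m + (1/2 :: complex)" by (simp add: add_divide_distrib)
  then show ?thesis using False by (simp only: evar_add) (simp add: sgn2_def)
qed

text \<open>The quotient \<phi> of the overview for any characteristic; see
  \<open>theta_quotient_eq\<close>. The constant - 2 pi i \<open>Sprod 0 \<tau>\<close> is the
  derivative of \<open>Tprod\<close> at 0 and makes the residue 1. The exponential reduces the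
  multipliers under periods to signs.\<close>

definition phi :: "int \<Rightarrow> int \<Rightarrow> complex \<Rightarrow> complex \<Rightarrow> complex" where
  "phi p r z \<tau> = - (2 * of_real pi * \<i>) * Sprod 0 \<tau> * evar (of_int p * z / 2) *
     Tprod (z + half_period p r \<tau>) \<tau> / (Tprod z \<tau> * Tprod (half_period p r \<tau>) \<tau>)"

lemma phi_add_1: "phi p r (z + 1) \<tau> = sgn2 p * phi p r z \<tau>"
proof -
  have "Tprod (z + 1 + half_period p r \<tau>) \<tau> = Tprod (z + half_period p r \<tau>) \<tau>"
    using Tprod_add_1 [of "z + half_period p r \<tau>"] by (simp add: add_ac)
  moreover have "evar (of_int p * (z + 1) / 2) = sgn2 p * evar (of_int p * z / 2)"
    by (simp add: evar_half_int [symmetric] evar_add [symmetric] field_simps)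
  ultimately show ?thesis by (simp add: phi_def Tprod_add_1)
qed

text \<open>The quotient of products acquires the inverse of \<open>evar\<close> of the half period,
  that is exp(- pi i p \<tau>) (-1)^r; the exponential factor of \<open>phi\<close> cancels all but
  the sign.\<close>

lemma phi_add_tau:
  assumes "Im \<tau> > 0"
  shows "phi p r (z + \<tau>) \<tau> = sgn2 r * phi p r z \<tau>"
proof -
  let ?\<omega> = "half_period p r \<tau>"
  have T: "Tprod (z + \<tau> + ?\<omega>) \<tau> = - Tprod (z + ?\<omega>) \<tau> / (evar z * evar ?\<omega>)"
    using Tprod_add_tau [OF assms, of "z + ?\<omega>"] by (simp add: add_ac evar_add)
  have "evar (of_int p * (z + \<tau>) / 2) * sgn2 r = evar (of_int p * z / 2) * evar ?\<omega>"
    by (simp add: evar_half_int [symmetric] evar_add [symmetric] half_period_def field_simps)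
  moreover have "sgn2 r * sgn2 r = 1" by (simp add: sgn2_def)
  ultimately have e: "evar (of_int p * (z + \<tau>) / 2) = sgn2 r * (evar (of_int p * z / 2) * evar ?\<omega>)"
    by (metis mult.assoc mult.commute mult_1)
  show ?thesis
    unfolding phi_def T e Tprod_add_tau [OF assms] by (simp add: field_simps)
qed

lemma phi_add_Lattice:
  assumes "Im \<tau> > 0"
  shows "phi p r (z + of_int m + of_int n * \<tau>) \<tau> = sgn2 (p * m + r * n) * phi p r z \<tau>"
proof -
  have sq: "sgn2 x * sgn2 x = 1" for x by (simp add: sgn2_def)
  have 1: "phi p r (z + of_int m) \<tau> = sgn2 (p * m) * phi p r z \<tau>" for z m
  proof (induction m rule: int_induct [where k = 0])
    case base
    then show ?case by (simp add: sgn2_def)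
  next
    case (step1 i)
    then show ?case
      using phi_add_1 [of p r "z + of_int i" \<tau>] by (simp add: add_ac distrib_left sgn2_add)
  next
    case (step2 i)
    have "phi p r (z + of_int i) \<tau> = sgn2 p * phi p r (z + of_int (i - 1)) \<tau>"
      using phi_add_1 [of p r "z + of_int (i - 1)" \<tau>] by simp
    then have "phi p r (z + of_int (i - 1)) \<tau> = sgn2 p * (sgn2 (p * i) * phi p r z \<tau>)"
      using step2 sq by (metis mult.assoc mult_1)
    moreover have "sgn2 (p * (i - 1)) = sgn2 p * sgn2 (p * i)"
      by (auto simp: sgn2_def)
    ultimately show ?case by simp
  qed
  have 2: "phi p r (z + of_int n * \<tau>) \<tau> = sgn2 (r * n) * phi p r z \<tau>" for z n
  proof (induction n rule: int_induct [where k = 0])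
    case base
    then show ?case by (simp add: sgn2_def)
  next
    case (step1 i)
    then show ?case
      using phi_add_tau [OF assms, of p r "z + of_int i * \<tau>"] by (simp add: algebra_simps sgn2_add)
  next
    case (step2 i)
    have "phi p r (z + of_int i * \<tau>) \<tau> = sgn2 r * phi p r (z + of_int (i - 1) * \<tau>) \<tau>"
      using phi_add_tau [OF assms, of p r "z + of_int (i - 1) * \<tau>"] by (simp add: algebra_simps)
    then have "phi p r (z + of_int (i - 1) * \<tau>) \<tau> = sgn2 r * (sgn2 (r * i) * phi p r z \<tau>)"
      using step2 sq by (metis mult.assoc mult_1)
    moreover have "sgn2 (r * (i - 1)) = sgn2 r * sgn2 (r * i)"
      by (auto simp: sgn2_def)
    ultimately show ?case by simp
  qed
  show ?thesis using 1 2 by (simp add: sgn2_add mult_ac)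
qed

section \<open>Elliptic functions with half periods\<close>

lemma Lattice_0 [simp]: "0 \<in> Lattice \<tau>"
  by (auto simp: Lattice_def intro!: exI [of _ "0::int"])

lemma Lattice_diff: "v \<in> Lattice \<tau> \<Longrightarrow> w \<in> Lattice \<tau> \<Longrightarrow> v - w \<in> Lattice \<tau>"
  unfolding Lattice_def
proof clarify
  fix m n m' n' :: int
  show "\<exists>ma na::int. of_int m + of_int n * \<tau> - (of_int m' + of_int n' * \<tau>) = of_int ma + of_int na * \<tau>"
    by (rule exI [of _ "m - m'"], rule exI [of _ "n - n'"]) (simp add: algebra_simps)
qed

lemma Lattice_add_iff: "w \<in> Lattice \<tau> \<Longrightarrow> v + w \<in> Lattice \<tau> \<longleftrightarrow> v \<in> Lattice \<tau>"
  by (metis Lattice_0 Lattice_diff add_diff_cancel_right' diff_0 diff_minus_eq_add)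

text \<open>A uniform gap between lattice points: it makes the lattice closed and provides punctured
  discs free of lattice points.\<close>

lemma Lattice_norm_ge:
  assumes "Im \<tau> > 0" "w \<in> Lattice \<tau>" "w \<noteq> 0"
  shows "min 1 (Im \<tau>) \<le> norm w"
proof -
  obtain m n :: int where w: "w = of_int m + of_int n * \<tau>" using assms(2) by (auto simp: Lattice_def)
  show ?thesis
  proof (cases "n = 0")
    case True
    then have "m \<noteq> 0" using assms(3) w by auto
    then have "1 \<le> \<bar>m\<bar>" by linarith
    then have "1 \<le> real_of_int \<bar>m\<bar>" by linarith
    then show ?thesis using True w by simp
  next
    case False
    then have "1 \<le> \<bar>n\<bar>" by linarith
    then have "1 \<le> real_of_int \<bar>n\<bar>" by linarith
    then have "Im \<tau> \<le> \<bar>Im w\<bar>" using assms(1) by (simp add: w abs_mult)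
    also have "\<dots> \<le> norm w" by (rule abs_Im_le_cmod)
    finally show ?thesis by simp
  qed
qed

lemma closed_Lattice:
  assumes "Im \<tau> > 0"
  shows "closed (Lattice \<tau>)"
proof (rule discrete_imp_closed)
  show "0 < min 1 (Im \<tau>)" using assms by simp
  show "\<forall>x\<in>Lattice \<tau>. \<forall>y\<in>Lattice \<tau>. dist y x < min 1 (Im \<tau>) \<longrightarrow> y = x"
  proof (intro ballI impI)
    fix x y assume "x \<in> Lattice \<tau>" "y \<in> Lattice \<tau>" and d: "dist y x < min 1 (Im \<tau>)"
    then have "y - x \<in> Lattice \<tau>" by (simp add: Lattice_diff)
    then show "y = x" using Lattice_norm_ge [OF assms, of "y - x"] d unfolding dist_norm by auto
  qed
qed

lemma period_parallelogram:
  assumes "Im \<tau> > 0"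
  obtains m n :: int and x y :: real
  where "w = of_real x + of_real y * \<tau> + of_int m + of_int n * \<tau>" "x \<in> {0..1}" "y \<in> {0..1}"
proof -
  define y where "y = Im w / Im \<tau>"
  define x where "x = Re w - y * Re \<tau>"
  have w: "w = of_real x + of_real y * \<tau>"
    using assms by (simp add: complex_eq_iff x_def y_def)
  show thesis
  proof (rule that [of "frac x" "frac y" "\<lfloor>x\<rfloor>" "\<lfloor>y\<rfloor>"])
    show "w = of_real (frac x) + of_real (frac y) * \<tau> + of_int \<lfloor>x\<rfloor> + of_int \<lfloor>y\<rfloor> * \<tau>"
      by (simp add: w frac_def algebra_simps)
  qed (auto simp: frac_lt_1 less_imp_le)
qed

text \<open>Such a function is doubly periodic up to sign with removable singularities only, hence constant
  by Liouville's theorem, and a nontrivial sign makes the constant vanish.\<close>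

lemma quasi_elliptic_eq_0:
  fixes D :: "complex \<Rightarrow> complex"
  assumes \<tau>: "Im \<tau> > 0"
    and hol: "D holomorphic_on - Lattice \<tau>"
    and per: "\<And>w m n::int. w \<notin> Lattice \<tau> \<Longrightarrow> D (w + of_int m + of_int n * \<tau>) = sgn2 (p * m + r * n) * D w"
    and odd: "odd p \<or> odd r"
    and lim: "((\<lambda>w. w * D w) \<longlongrightarrow> 0) (at 0)"
    and w: "w \<notin> Lattice \<tau>"
  shows "D w = 0"
proof -
  have opn: "open (- Lattice \<tau>)" using closed_Lattice [OF \<tau>] by (simp add: open_Compl)
  define \<delta> where "\<delta> = min 1 (Im \<tau>)"
  have \<delta>: "\<delta> > 0" using \<tau> by (simp add: \<delta>_def)
  have punct: "ball l \<delta> - {l} \<subseteq> - Lattice \<tau>" if "l \<in> Lattice \<tau>" for l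
  proof
    fix v assume v: "v \<in> ball l \<delta> - {l}"
    have "v - l \<notin> Lattice \<tau>"
      using Lattice_norm_ge [OF \<tau>, of "v - l"] v by (auto simp: \<delta>_def dist_norm norm_minus_commute)
    then show "v \<in> - Lattice \<tau>" using Lattice_diff that by blast
  qed
  \<comment> \<open>The sign rule carries the behaviour at 0 to every lattice point.\<close>
  have lim_l: "((\<lambda>v. (v - l) * D v) \<longlongrightarrow> 0) (at l)" if "l \<in> Lattice \<tau>" for l
  proof -
    from that obtain m n :: int where l: "l = of_int m + of_int n * \<tau>" by (auto simp: Lattice_def)
    have "((\<lambda>v. sgn2 (p * m + r * n) * (v * D v)) \<longlongrightarrow> sgn2 (p * m + r * n) * 0) (at 0)"
      by (intro tendsto_intros lim)
    moreover have "\<forall>\<^sub>F v in at 0. v \<in> ball 0 \<delta> - {0}"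
      using \<delta> by (intro eventually_at_in_open) auto
    then have "\<forall>\<^sub>F v in at 0. sgn2 (p * m + r * n) * (v * D v) = v * D (v + l)"
    proof eventually_elim
      case (elim v)
      then have "v \<notin> Lattice \<tau>" using punct [of 0] by auto
      then show ?case using per [of v m n] by (simp add: l add_ac)
    qed
    ultimately have "((\<lambda>v. v * D (v + l)) \<longlongrightarrow> sgn2 (p * m + r * n) * 0) (at 0)"
      by (rule Lim_transform_eventually)
    then have "((\<lambda>v. v * D (v + l)) \<longlongrightarrow> 0) (at 0)"
      by simp
    then show ?thesis
      by (intro LIM_offset_zero_cancel [of _ l]) (simp add: add.commute)
  qed
  define g where "g = remove_sings D"
  have g_eq: "g v = D v" if "v \<notin> Lattice \<tau>" for v
    using that hol opn unfolding g_def
    by (intro remove_sings_at_analytic) (auto simp: analytic_on_open analytic_at)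
  have lim_g: "(D \<longlongrightarrow> g l) (at l)" and ana_g: "g analytic_on {l}" if "l \<in> Lattice \<tau>" for l
  proof -
    have holb: "D holomorphic_on ball l \<delta> - {l}"
      using hol punct [OF that] by (rule holomorphic_on_subset)
    moreover have "l \<in> interior (ball l \<delta>)" using \<delta> by (simp add: interior_open)
    \<comment> \<open>Riemann's theorem on removable singularities: the limit in
      \<open>lim_l\<close> excludes a pole.\<close>
    ultimately have "\<exists>e. e holomorphic_on ball l \<delta> \<and> (\<forall>z\<in>ball l \<delta> - {l}. e z = D z)"
      using lim_l [OF that] by (simp only: holomorphic_on_extend_lim)
    then obtain e where e: "e holomorphic_on ball l \<delta>" "\<And>z. z \<in> ball l \<delta> - {l} \<Longrightarrow> e z = D z"
      by blast
    have "(e \<longlongrightarrow> e l) (at l)"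
      using e(1) \<delta> by (metis centre_in_ball continuous_on_eq_continuous_at holomorphic_on_imp_continuous_on isCont_def open_ball)
    moreover have "\<forall>\<^sub>F z in at l. z \<in> ball l \<delta> - {l}"
      using \<delta> by (intro eventually_at_in_open) auto
    then have "\<forall>\<^sub>F z in at l. e z = D z"
      by eventually_elim (rule e(2))
    ultimately have lim_D: "(D \<longlongrightarrow> e l) (at l)" by (simp cong: tendsto_cong)
    then show "(D \<longlongrightarrow> g l) (at l)" unfolding g_def using remove_sings_eqI by force
    have "isolated_singularity_at D l"
      unfolding isolated_singularity_at_def using holb \<delta>
      by (auto simp: analytic_on_open open_Diff intro!: exI [of _ \<delta>])
    then show "g analytic_on {l}" unfolding g_def using lim_D by (rule remove_sings_analytic_at)
  qed
  have "g analytic_on {v}" for v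
  proof (cases "v \<in> Lattice \<tau>")
    case False
    then have "D analytic_on {v}" using hol opn by (auto simp: analytic_at)
    then show ?thesis unfolding g_def by (rule remove_sings_analytic_on)
  qed (rule ana_g)
  then have holg: "g holomorphic_on UNIV"
    using analytic_on_analytic_at analytic_imp_holomorphic by blast
  define K where "K = (\<lambda>(x, y). of_real x + of_real y * \<tau>) ` ({0..1::real} \<times> {0..1::real})"
  have "compact K"
    unfolding K_def
    by (intro compact_continuous_image compact_Times compact_Icc) (auto simp: case_prod_unfold intro!: continuous_intros)
  then have "bounded (g ` K)"
    using holg by (meson compact_continuous_image compact_imp_bounded holomorphic_on_imp_continuous_on holomorphic_on_subset top_greatest)
  then obtain B where B: "\<And>v. v \<in> K \<Longrightarrow> norm (g v) \<le> B"
    unfolding bounded_iff by blast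
  \<comment> \<open>The signs have modulus 1, so moving the argument into the compact period
    parallelogram \<open>K\<close> leaves the norm unchanged.\<close>
  have le: "norm (g v) \<le> B" if v: "v \<notin> Lattice \<tau>" for v
  proof -
    obtain m n :: int and x y :: real
      where *: "v = of_real x + of_real y * \<tau> + of_int m + of_int n * \<tau>" "x \<in> {0..1}" "y \<in> {0..1}"
      using period_parallelogram [OF \<tau>] .
    let ?u = "of_real x + of_real y * \<tau>"
    have "of_int m + of_int n * \<tau> \<in> Lattice \<tau>" by (auto simp: Lattice_def)
    then have u: "?u \<notin> Lattice \<tau>"
      using v Lattice_add_iff [of "of_int m + of_int n * \<tau>" \<tau> ?u] by (simp add: *(1) add.assoc)
    have "norm (D v) = norm (D ?u)"
      using per [OF u, of m n] by (auto simp: * norm_mult sgn2_def)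
    moreover have "?u \<in> K" unfolding K_def using * by force
    ultimately show ?thesis using B [of ?u] g_eq u v by simp
  qed
  have "norm (g v) \<le> B" for v
  proof (cases "v \<in> Lattice \<tau>")
    case True
    have "\<forall>\<^sub>F z in at v. z \<in> ball v \<delta> - {v}"
      using \<delta> by (intro eventually_at_in_open) auto
    then have "\<forall>\<^sub>F z in at v. norm (D z) \<le> B"
    proof eventually_elim
      case (elim z)
      then have "z \<notin> Lattice \<tau>" using punct [OF True] by auto
      then show ?case using le [of z] by (simp add: g_eq)
    qed
    then show ?thesis by (intro Lim_norm_ubound [OF _ lim_g [OF True]]) auto
  qed (rule le)
  then have "bounded (range g)" unfolding bounded_iff by blast
  then obtain c where c: "\<And>v. g v = c"
    using Liouville_theorem [OF holg] by (auto simp: constant_on_def)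
  \<comment> \<open>A period with sign -1: it is 1 if \<open>p\<close> is odd and \<tau> otherwise.
    It forces the constant to equal its negative.\<close>
  obtain m n :: int where "sgn2 (p * m + r * n) = - 1"
  proof (cases "odd p")
    case True
    then show ?thesis using that [of 1 0] by (simp add: sgn2_def)
  next
    case False
    then show ?thesis using that [of 0 1] odd by (simp add: sgn2_def)
  qed
  then have "D (w + of_int m + of_int n * \<tau>) = - D w" using per [OF w] by simp
  moreover have "w + of_int m + of_int n * \<tau> \<notin> Lattice \<tau>"
    using w Lattice_add_iff [of "of_int m + of_int n * \<tau>" \<tau> w] by (auto simp: Lattice_def add.assoc)
  ultimately have "c = - c" using g_eq c w by metis
  then have "c = 0" by (simp add: complex_eq_iff)
  then show ?thesis using c [of w] g_eq [OF w] by simp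
qed

section \<open>Power series at the origin\<close>

text \<open>\<open>power_series\<close> removes the singularity first, so only values off the origin
  count. This matters because the formulas involve quotients 0 / 0 at the origin, which HOL
  evaluates to 0.\<close>

lemma power_series_eqI:
  assumes "h has_fps_expansion F" "\<forall>\<^sub>F z in at 0. f z = h z"
  shows "power_series f = F"
proof -
  have ana: "h analytic_on {0}"
    using assms(1) by (rule has_fps_expansion_imp_analytic_0)
  obtain S where S: "open S" "0 \<in> S" "\<And>z. z \<in> S \<Longrightarrow> z \<noteq> 0 \<Longrightarrow> f z = h z"
    using assms(2) unfolding eventually_at_topological by auto
  have "\<forall>\<^sub>F z in nhds 0. z \<in> S"
    using S by (intro eventually_nhds_in_open)
  then have "\<forall>\<^sub>F z in nhds 0. remove_sings f z = h z"
    using eventually_remove_sings_eq_nhds [OF ana]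
  proof eventually_elim
    case (elim z)
    have "\<forall>\<^sub>F w in at z. f w = h w"
    proof (cases "z = 0")
      case False
      then have "\<forall>\<^sub>F w in at z. w \<in> (S - {0}) - {z}"
        using elim S(1) by (intro eventually_at_in_open) auto
      then show ?thesis by eventually_elim (use S(3) in auto)
    qed (use assms(2) in simp)
    then have "remove_sings f z = remove_sings h z"
      by (rule remove_sings_cong) simp
    then show ?case using elim by simp
  qed
  then have "fps_expansion (remove_sings f) 0 = fps_expansion h 0"
    by (rule fps_expansion_cong)
  then show ?thesis
    using assms(1) by (simp add: power_series_def fps_expansion_eqI)
qed

lemma has_fps_expansion_power_series:
  assumes "h has_fps_expansion F"
  shows "power_series h = F"
  using assms by (rule power_series_eqI) simp

text \<open>Taylor series of (exp(c z) - 1) / (c z). For c = 2 pi i it isolates the zero of 1 -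
  \<open>evar z\<close> at the origin.\<close>

definition expm1_series :: "complex \<Rightarrow> complex fps" where
  "expm1_series c = Abs_fps (\<lambda>n. c ^ n / fact (Suc n))"

lemma expm1_series_expansion:
  assumes "c \<noteq> 0"
  shows "(\<lambda>z. if z = 0 then 1 else (exp (c * z) - 1) / (c * z)) has_fps_expansion expm1_series c"
proof -
  have eq: "fps_const c * fps_X * expm1_series c = fps_exp c - 1"
  proof (rule fps_ext)
    fix n show "fps_nth (fps_const c * fps_X * expm1_series c) n = fps_nth (fps_exp c - 1) n"
      by (cases n) (simp_all add: expm1_series_def mult.assoc field_simps)
  qed
  have "(\<lambda>z. if z = 0 then fps_nth (fps_shift 1 (fps_const (inverse c) * (fps_exp c - 1))) 0 else inverse c * (exp (c * z) - 1) / z ^ 1)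
      has_fps_expansion fps_shift 1 (fps_const (inverse c) * (fps_exp c - 1))"
  proof (rule has_fps_expansion_shift [OF _ subdegree_geI])
    have "fps_nth (fps_const (inverse c) * (fps_exp c - 1)) 1 \<noteq> 0"
      using assms by simp
    then show "fps_const (inverse c) * (fps_exp c - 1) \<noteq> 0" by fastforce
  qed (auto intro!: fps_expansion_intros)
  also have "fps_shift 1 (fps_const (inverse c) * (fps_exp c - 1)) = expm1_series c"
    using assms by (intro fps_ext) (simp add: eq [symmetric] mult.assoc)
  finally show ?thesis
    using assms by (auto simp: expm1_series_def field_simps cong: if_cong)
qed

lemma expm1_series_0 [simp]: "fps_nth (expm1_series c) 0 = 1"
  by (simp add: expm1_series_def)

section \<open>Theta products as families of entire functions\<close>

lemma continuous_on_evar: "continuous_on A f \<Longrightarrow> continuous_on A (\<lambda>x. evar (f x))"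
  unfolding evar_def by (intro continuous_intros)

text \<open>The bound of \<open>norm_qpoch_le\<close> is continuous in z and \<tau>, hence bounded
  on a product of two closed discs.\<close>

lemma entire_family_qpoch:
  assumes a: "\<And>\<tau>. Im \<tau> > 0 \<Longrightarrow> (\<lambda>z. a z \<tau>) holomorphic_on UNIV" "\<And>z. a z holomorphic_on upper_half"
    and cont: "continuous_on (UNIV \<times> upper_half) (\<lambda>(z, \<tau>). a z \<tau>)"
  shows "entire_family upper_half (\<lambda>z \<tau>. qpoch (evar (a z \<tau>)) (evar \<tau>))"
  unfolding entire_family_def
proof (intro conjI ballI allI)
  show "(\<lambda>z. qpoch (evar (a z \<tau>)) (evar \<tau>)) holomorphic_on UNIV" if "\<tau> \<in> upper_half" for \<tau>
    using that by (intro holomorphic_on_qpoch holomorphic_intros a norm_evar_less_1) auto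
  show "(\<lambda>\<tau>. qpoch (evar (a z \<tau>)) (evar \<tau>)) holomorphic_on upper_half" for z
    by (intro holomorphic_on_qpoch holomorphic_intros a norm_evar_less_1 open_upper_half) auto
  fix \<tau>\<^sub>0 R assume "\<tau>\<^sub>0 \<in> upper_half"
  then obtain d where d: "d > 0" "cball \<tau>\<^sub>0 d \<subseteq> upper_half"
    using open_upper_half open_contains_cball by blast
  have "compact (cball 0 R \<times> cball \<tau>\<^sub>0 d :: (complex \<times> complex) set)"
    by (intro compact_Times compact_cball)
  moreover have "continuous_on (cball 0 R \<times> cball \<tau>\<^sub>0 d)
      (\<lambda>(z, \<tau>). exp (norm (evar (a z \<tau>)) / (1 - norm (evar \<tau>))))"
  proof -
    have "continuous_on (cball 0 R \<times> cball \<tau>\<^sub>0 d) (\<lambda>x. a (fst x) (snd x))"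
      using continuous_on_subset [OF cont, of "cball 0 R \<times> cball \<tau>\<^sub>0 d"] d by (simp add: case_prod_unfold subset_iff)
    moreover have "norm (evar (snd x)) \<noteq> 1" if "x \<in> cball 0 R \<times> cball \<tau>\<^sub>0 d" for x
    proof -
      have "Im (snd x) > 0" using d(2) that by auto
      then show ?thesis using norm_evar_less_1 [of "snd x"] by simp
    qed
    ultimately show ?thesis
      unfolding case_prod_unfold by (intro continuous_intros continuous_on_evar) fastforce+
  qed
  ultimately have "bounded ((\<lambda>(z, \<tau>). exp (norm (evar (a z \<tau>)) / (1 - norm (evar \<tau>)))) ` (cball 0 R \<times> cball \<tau>\<^sub>0 d))"
    by (intro compact_imp_bounded compact_continuous_image)
  then obtain B where B: "\<And>x. x \<in> cball 0 R \<times> cball \<tau>\<^sub>0 d \<Longrightarrow>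
      norm ((\<lambda>(z, \<tau>). exp (norm (evar (a z \<tau>)) / (1 - norm (evar \<tau>)))) x) \<le> B"
    unfolding bounded_iff by blast
  have "norm (qpoch (evar (a z \<tau>)) (evar \<tau>)) \<le> B" if "\<tau> \<in> cball \<tau>\<^sub>0 d \<inter> upper_half" "norm z \<le> R" for \<tau> z
    using norm_qpoch_le [of "evar \<tau>" "evar (a z \<tau>)"] norm_evar_less_1 [of \<tau>] B [of "(z, \<tau>)"] that by auto
  then show "\<exists>d>0. \<exists>B. \<forall>\<tau>\<in>cball \<tau>\<^sub>0 d \<inter> upper_half. \<forall>z. norm z \<le> R \<longrightarrow> norm (qpoch (evar (a z \<tau>)) (evar \<tau>)) \<le> B"
    using d(1) by blast
qed

lemma entire_family_mult:
  assumes "entire_family U F" "entire_family U G"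
  shows "entire_family U (\<lambda>z \<tau>. F z \<tau> * G z \<tau>)"
  unfolding entire_family_def
proof (intro conjI ballI allI)
  fix \<tau>\<^sub>0 R assume "\<tau>\<^sub>0 \<in> U"
  obtain d B where d: "d > 0" and B: "\<And>\<tau> z. \<tau> \<in> cball \<tau>\<^sub>0 d \<inter> U \<Longrightarrow> norm z \<le> R \<Longrightarrow> norm (F z \<tau>) \<le> B"
    using assms(1) \<open>\<tau>\<^sub>0 \<in> U\<close> unfolding entire_family_def by meson
  obtain d' B' where d': "d' > 0" and B': "\<And>\<tau> z. \<tau> \<in> cball \<tau>\<^sub>0 d' \<inter> U \<Longrightarrow> norm z \<le> R \<Longrightarrow> norm (G z \<tau>) \<le> B'"
    using assms(2) \<open>\<tau>\<^sub>0 \<in> U\<close> unfolding entire_family_def by meson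
  have "norm (F z \<tau> * G z \<tau>) \<le> B * B'" if "\<tau> \<in> cball \<tau>\<^sub>0 (min d d') \<inter> U" "norm z \<le> R" for \<tau> z
  proof -
    have "norm (F z \<tau>) \<le> B" "norm (G z \<tau>) \<le> B'" using that B [of \<tau> z] B' [of \<tau> z] by auto
    then show ?thesis
      unfolding norm_mult by (intro mult_mono) (auto intro: order_trans [OF norm_ge_zero])
  qed
  then show "\<exists>d>0. \<exists>B. \<forall>\<tau>\<in>cball \<tau>\<^sub>0 d \<inter> U. \<forall>z. norm z \<le> R \<longrightarrow> norm (F z \<tau> * G z \<tau>) \<le> B"
    using d d' by (intro exI [of _ "min d d'"] conjI exI [of _ "B * B'"]) auto
qed (use assms in \<open>auto simp: entire_family_def intro!: holomorphic_intros\<close>)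

lemma holomorphic_on_half_period: "half_period p r holomorphic_on A"
  unfolding half_period_def [abs_def] by (intro holomorphic_intros) auto

lemma continuous_on_half_period: "continuous_on A f \<Longrightarrow> continuous_on A (\<lambda>x. half_period p r (f x))"
  unfolding half_period_def by (intro continuous_intros) auto

lemma entire_family_Tprod: "entire_family upper_half (\<lambda>z \<tau>. Tprod (z + half_period p r \<tau>) \<tau>)"
  unfolding Tprod_def
  by (intro entire_family_mult entire_family_qpoch)
    (auto simp: case_prod_unfold intro!: holomorphic_intros holomorphic_on_half_period
      continuous_intros continuous_on_half_period)

lemma entire_family_Sprod: "entire_family upper_half Sprod"
  unfolding Sprod_def [abs_def]
  by (intro entire_family_mult entire_family_qpoch)
    (auto simp: case_prod_unfold intro!: holomorphic_intros continuous_intros)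

lemma holomorphic_on_Tprod:
  assumes "Im \<tau> > 0"
  shows "(\<lambda>z. Tprod z \<tau>) holomorphic_on UNIV"
  using entire_family_Tprod [of 0 0] assms by (simp add: entire_family_def half_period_def)

lemma holomorphic_on_Sprod:
  assumes "Im \<tau> > 0"
  shows "(\<lambda>z. Sprod z \<tau>) holomorphic_on UNIV"
  using entire_family_Sprod assms by (simp add: entire_family_def)

text \<open>The Taylor series of z \<phi>(z), written as a product so that the only series inverted
  have nonzero constant terms. Holomorphy of the coefficients in \<tau> can then be read off factor
  by factor.\<close>

definition theta_ser :: "int \<Rightarrow> int \<Rightarrow> complex \<Rightarrow> complex fps" where
  "theta_ser p r \<tau> = fps_exp (of_int p * of_real pi * \<i>) *
     (fps_const (inverse (Tprod (half_period p r \<tau>) \<tau>)) * fps_expansion (\<lambda>z. Tprod (z + half_period p r \<tau>) \<tau>) 0) *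
     inverse (expm1_series (2 * of_real pi * \<i>)) *
     (fps_const (Sprod 0 \<tau>) * inverse (fps_expansion (\<lambda>z. Sprod z \<tau>) 0))"

lemma Tprod_half_period_nonzero:
  assumes "Im \<tau> > 0" "odd p \<or> odd r"
  shows "Tprod (half_period p r \<tau>) \<tau> \<noteq> 0"
  using half_period_notin_Lattice [OF assms] by (simp add: Tprod_eq_0_iff assms(1))

lemma theta_ser_0:
  assumes "Im \<tau> > 0" "odd p \<or> odd r"
  shows "fps_nth (theta_ser p r \<tau>) 0 = 1"
  using Tprod_half_period_nonzero [OF assms] Sprod_0_nonzero [OF assms(1)]
  by (simp add: theta_ser_def fps_expansion_def)

lemma holomorphic_coeffs_theta_ser:
  assumes "odd p \<or> odd r"
  shows "holomorphic_coeffs (theta_ser p r)"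
  unfolding theta_ser_def [abs_def]
proof (intro holomorphic_coeffs_mult holomorphic_coeffs_const holomorphic_coeffs_fps_const
    holomorphic_coeffs_inverse holomorphic_coeffs_fps_expansion entire_family_Tprod entire_family_Sprod holomorphic_intros)
  show "(\<lambda>\<tau>. Tprod (half_period p r \<tau>) \<tau>) holomorphic_on upper_half"
    using entire_family_Tprod [of p r] unfolding entire_family_def by (metis (no_types, lifting) add_0 holomorphic_cong)
  show "Tprod (half_period p r \<tau>) \<tau> \<noteq> 0" if "\<tau> \<in> upper_half" for \<tau>
    using Tprod_half_period_nonzero that assms by simp
  show "Sprod 0 holomorphic_on upper_half"
    using entire_family_Sprod by (simp add: entire_family_def)
  show "fps_nth (fps_expansion (\<lambda>z. Sprod z \<tau>) 0) 0 \<noteq> 0" if "0 < Im \<tau>" for \<tau>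
    using Sprod_0_nonzero [OF that] by (simp add: fps_expansion_def)
qed

lemma eventually_at_0_not_Lattice:
  assumes "Im \<tau> > 0"
  shows "\<forall>\<^sub>F z in at 0. z \<notin> Lattice \<tau>"
proof -
  have "\<forall>\<^sub>F z in at (0::complex). z \<in> ball 0 (min 1 (Im \<tau>)) - {0}"
    using assms by (intro eventually_at_in_open) auto
  then show ?thesis
  proof eventually_elim
    case (elim z)
    then show ?case using Lattice_norm_ge [OF assms, of z] by auto
  qed
qed

text \<open>An auxiliary function \<open>h\<close> is called for because z \<phi>(z) takes the value
  0 at z = 0 in HOL, whereas its continuous extension takes the value 1.\<close>

lemma theta_ser_expansion:
  assumes \<tau>: "Im \<tau> > 0" and odd: "odd p \<or> odd r"
  obtains h where "h has_fps_expansion theta_ser p r \<tau>" "\<forall>\<^sub>F z in at 0. z * phi p r z \<tau> = h z"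
proof
  let ?c = "2 * of_real pi * \<i>" and ?\<omega> = "half_period p r \<tau>"
  let ?g = "\<lambda>z. if z = 0 then 1 else (exp (?c * z) - 1) / (?c * z)"
  let ?h = "\<lambda>z. exp (of_int p * of_real pi * \<i> * z) * (inverse (Tprod ?\<omega> \<tau>) * Tprod (z + ?\<omega>) \<tau>) *
     inverse (?g z) * (Sprod 0 \<tau> * inverse (Sprod z \<tau>))"
  have T: "(\<lambda>z. Tprod (z + ?\<omega>) \<tau>) has_fps_expansion fps_expansion (\<lambda>z. Tprod (z + ?\<omega>) \<tau>) 0"
    using entire_family_Tprod [of p r] \<tau>
    by (intro has_fps_expansion_fps_expansion [of UNIV]) (auto simp: entire_family_def)
  have S: "(\<lambda>z. Sprod z \<tau>) has_fps_expansion fps_expansion (\<lambda>z. Sprod z \<tau>) 0"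
    using holomorphic_on_Sprod [OF \<tau>] by (intro has_fps_expansion_fps_expansion [of UNIV]) auto
  have g: "?g has_fps_expansion expm1_series ?c"
    by (rule expm1_series_expansion) simp
  show "?h has_fps_expansion theta_ser p r \<tau>"
    unfolding theta_ser_def
    by (intro has_fps_expansion_mult has_fps_expansion_cmult_left has_fps_expansion_inverse T S g has_fps_expansion_exp)
      (use Sprod_0_nonzero [OF \<tau>] in \<open>simp_all add: fps_expansion_def\<close>)
  show "\<forall>\<^sub>F z in at 0. z * phi p r z \<tau> = ?h z"
    using eventually_at_0_not_Lattice [OF \<tau>]
  proof eventually_elim
    case (elim z)
    then have "Tprod z \<tau> \<noteq> 0" "z \<noteq> 0" by (auto simp: Tprod_eq_0_iff \<tau>)
    then have nz: "1 - evar z \<noteq> 0" "Sprod z \<tau> \<noteq> 0" "z \<noteq> 0" by (auto simp: Tprod_eq_Sprod \<tau>)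
    have e1: "exp (of_int p * of_real pi * \<i> * z) = evar (of_int p * z / 2)"
      by (simp add: evar_def mult_ac)
    have e2: "exp (?c * z) = evar z" by (simp add: evar_def)
    \<comment> \<open>The pole of \<open>phi\<close> at 0 comes from 1 - \<open>evar z\<close>; this
      factor absorbs it together with z and the constant - 2 pi i.\<close>
    have "inverse (?g z) = - ?c * z / (1 - evar z)"
      using nz by (simp only: e2 if_False) (simp add: field_simps)
    moreover have "z * (- c * s * e * t / (E * u * w)) = e * (inverse w * t) * (- c * z / E) * (s * inverse u)"
      for c s e t E u w :: complex
      by (simp add: divide_inverse mult_ac)
    ultimately show ?case
      unfolding phi_def Tprod_eq_Sprod [OF \<tau>, of z] e1 by simp
  qed
qed

lemma phi_limit:
  assumes "Im \<tau> > 0" "odd p \<or> odd r"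
  shows "((\<lambda>z. z * phi p r z \<tau>) \<longlongrightarrow> 1) (at 0)"
proof -
  obtain h where h: "h has_fps_expansion theta_ser p r \<tau>" "\<forall>\<^sub>F z in at 0. z * phi p r z \<tau> = h z"
    using theta_ser_expansion [OF assms] .
  have "(h \<longlongrightarrow> 1) (at 0)"
    using tendsto_mono [OF _ has_fps_expansion_imp_tendsto_0 [OF h(1)], of "at 0"] theta_ser_0 [OF assms]
    by (simp add: at_within_def)
  then show ?thesis using h(2) by (simp cong: tendsto_cong)
qed

lemma phi_holomorphic:
  assumes "Im \<tau> > 0" "odd p \<or> odd r"
  shows "(\<lambda>z. phi p r z \<tau>) holomorphic_on - Lattice \<tau>"
  unfolding phi_def
  using entire_family_Tprod [of p r] assms Tprod_half_period_nonzero [OF assms]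
  by (intro holomorphic_intros)
    (auto simp: Tprod_eq_0_iff entire_family_def intro: holomorphic_on_subset holomorphic_on_Tprod)

section \<open>The action of the modular group\<close>

lemma SL2Z_det: "g \<in> SL2Z \<Longrightarrow> g $ 1 $ 1 * g $ 2 $ 2 - g $ 1 $ 2 * g $ 2 $ 1 = 1"
  by (simp add: SL2Z_def det_2)

lemma aut_factor_nonzero:
  assumes "g \<in> SL2Z" "Im \<tau> > 0"
  shows "aut_factor g \<tau> \<noteq> 0"
proof
  assume "aut_factor g \<tau> = 0"
  then have "real_of_int (g $ 2 $ 2) = 0 \<and> real_of_int (g $ 2 $ 1) = 0"
    using real_combination_eq_0_iff [OF assms(2), of "of_int (g $ 2 $ 2)" "of_int (g $ 2 $ 1)"]
    by (simp add: aut_factor_def add.commute)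
  with SL2Z_det [OF assms(1)] show False by simp
qed

lemma Im_moebius_act:
  assumes "g \<in> SL2Z" "Im \<tau> > 0"
  shows "Im (moebius_act g \<tau>) > 0"
proof -
  let ?a = "real_of_int (g $ 1 $ 1)" and ?b = "real_of_int (g $ 1 $ 2)"
    and ?c = "real_of_int (g $ 2 $ 1)" and ?d = "real_of_int (g $ 2 $ 2)"
  have "real_of_int (g $ 1 $ 1 * g $ 2 $ 2 - g $ 1 $ 2 * g $ 2 $ 1) = 1"
    by (simp only: SL2Z_det [OF assms(1)] of_int_1)
  then have det: "?a * ?d - ?b * ?c = 1" by simp
  have "Im (moebius_act g \<tau>) = (?a * Im \<tau> * (?c * Re \<tau> + ?d) - (?a * Re \<tau> + ?b) * (?c * Im \<tau>)) / (norm (aut_factor g \<tau>))\<^sup>2"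
    by (simp add: moebius_act_def Im_divide aut_factor_def cmod_power2)
  also have "?a * Im \<tau> * (?c * Re \<tau> + ?d) - (?a * Re \<tau> + ?b) * (?c * Im \<tau>) = (?a * ?d - ?b * ?c) * Im \<tau>"
    by (simp add: algebra_simps)
  finally show ?thesis
    using assms(2) det aut_factor_nonzero [OF assms] by simp
qed

text \<open>As functions of w, both sides divided by the automorphy factor have the same signs under
  periods, those of (p, r) times the matrix g modulo 2, and the same residue 1. Their difference
  falls under \<open>quasi_elliptic_eq_0\<close>.\<close>

lemma phi_moebius:
  assumes g: "g \<in> SL2Z" and \<tau>: "Im \<tau> > 0"
    and p': "even (p' - (p * g $ 1 $ 1 + r * g $ 2 $ 1))" and r': "even (r' - (p * g $ 1 $ 2 + r * g $ 2 $ 2))"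
    and odd: "odd p \<or> odd r" "odd p' \<or> odd r'"
    and w: "w \<notin> Lattice \<tau>"
  shows "phi p r (w / aut_factor g \<tau>) (moebius_act g \<tau>) = aut_factor g \<tau> * phi p' r' w \<tau>"
proof -
  define a b c d where "a = g $ 1 $ 1" and "b = g $ 1 $ 2" and "c = g $ 2 $ 1" and "d = g $ 2 $ 2"
  note abcd = a_def b_def c_def d_def
  define \<mu> where "\<mu> = aut_factor g \<tau>"
  define \<sigma> where "\<sigma> = moebius_act g \<tau>"
  have \<mu>: "\<mu> \<noteq> 0" "\<mu> = of_int c * \<tau> + of_int d"
    using aut_factor_nonzero [OF g \<tau>] by (simp_all add: \<mu>_def aut_factor_def abcd)
  have \<sigma>: "Im \<sigma> > 0" "\<mu> * \<sigma> = of_int a * \<tau> + of_int b"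
    using Im_moebius_act [OF g \<tau>] \<mu>(1) by (simp_all add: \<sigma>_def moebius_act_def \<mu>_def abcd)
  have "a * d - b * c = 1" using SL2Z_det [OF g] by (simp add: abcd)
  then have det: "(of_int a :: complex) * of_int d = 1 + of_int b * of_int c"
    by (metis add.commute diff_add_cancel of_int_1 of_int_add of_int_mult)
  \<comment> \<open>The coefficients come from the inverse of g: 1 = a \<mu> - c \<mu> \<sigma> and
    \<tau> = - b \<mu> + d \<mu> \<sigma>, since the determinant is 1.\<close>
  have shift: "of_int m + of_int n * \<tau> = \<mu> * (of_int (a * m - b * n) + of_int (d * n - c * m) * \<sigma>)" for m n :: int
  proof -
    have "\<mu> * (of_int (a * m - b * n) + of_int (d * n - c * m) * \<sigma>)
        = \<mu> * of_int (a * m - b * n) + of_int (d * n - c * m) * (\<mu> * \<sigma>)"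
      by (simp add: algebra_simps)
    also have "\<dots> = (of_int a * of_int d - of_int b * of_int c) * (of_int m + of_int n * \<tau>)"
      unfolding \<sigma>(2) unfolding \<mu>(2) by (simp add: algebra_simps)
    finally show ?thesis using det by simp
  qed
  have notin: "v / \<mu> \<notin> Lattice \<sigma>" if "v \<notin> Lattice \<tau>" for v
  proof
    assume "v / \<mu> \<in> Lattice \<sigma>"
    then obtain m n :: int where "v / \<mu> = of_int m + of_int n * \<sigma>" by (auto simp: Lattice_def)
    then have "v = of_int m * \<mu> + of_int n * (\<mu> * \<sigma>)" using \<mu>(1) by (simp add: field_simps)
    also have "\<dots> = of_int (m * d + n * b) + of_int (m * c + n * a) * \<tau>"
      unfolding \<sigma>(2) unfolding \<mu>(2) by (simp add: algebra_simps)
    finally show False using that unfolding Lattice_def by blast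
  qed
  define D where "D = (\<lambda>v. phi p r (v / \<mu>) \<sigma> / \<mu> - phi p' r' v \<tau>)"
  have "D w = 0"
  proof (rule quasi_elliptic_eq_0 [OF \<tau> _ _ odd(2) _ w])
    have "(\<lambda>v. phi p r (v / \<mu>) \<sigma>) holomorphic_on - Lattice \<tau>"
    proof (rule holomorphic_on_compose_gen [of "\<lambda>v. v / \<mu>" "- Lattice \<tau>" "\<lambda>z. phi p r z \<sigma>" "- Lattice \<sigma>", unfolded o_def])
      show "(\<lambda>v. v / \<mu>) holomorphic_on - Lattice \<tau>"
        using \<mu>(1) by (intro holomorphic_intros) auto
      show "(\<lambda>z. phi p r z \<sigma>) holomorphic_on - Lattice \<sigma>"
        by (rule phi_holomorphic [OF \<sigma>(1) odd(1)])
    qed (use notin in auto)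
    then show "D holomorphic_on - Lattice \<tau>"
      unfolding D_def using \<mu>(1) by (intro holomorphic_intros phi_holomorphic \<tau> odd) auto
    fix v and m n :: int
    \<comment> \<open>Modulo 2 the minus signs of the inverse matrix disappear, which leaves (p a +
      r c) m + (p b + r d) n.\<close>
    have "even (p * (a * m - b * n) + r * (d * n - c * m) - (p' * m + r' * n))"
      using p' r' by (auto simp: abcd algebra_simps)
    then have "sgn2 (p * (a * m - b * n) + r * (d * n - c * m)) = sgn2 (p' * m + r' * n)"
      by (auto simp: sgn2_def)
    moreover have "(v + of_int m + of_int n * \<tau>) / \<mu> = v / \<mu> + of_int (a * m - b * n) + of_int (d * n - c * m) * \<sigma>"
      using shift [of m n] \<mu>(1) by (simp add: field_simps)
    ultimately show "D (v + of_int m + of_int n * \<tau>) = sgn2 (p' * m + r' * n) * D v"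
      by (simp add: D_def phi_add_Lattice \<tau> \<sigma>(1) right_diff_distrib del: of_int_diff of_int_mult)
  next
    \<comment> \<open>Both summands of v D(v) tend to 1, because the division by \<mu> in
      \<open>D\<close> is matched by the substitution v / \<mu>.\<close>
    have "filterlim (\<lambda>v. v / \<mu>) (at 0) (at 0)"
      using \<mu>(1) by (auto simp: filterlim_at eventually_at_filter intro!: tendsto_eq_intros)
    from filterlim_compose [OF phi_limit [OF \<sigma>(1) odd(1)] this]
    have "((\<lambda>v. (v / \<mu>) * phi p r (v / \<mu>) \<sigma> - v * phi p' r' v \<tau>) \<longlongrightarrow> 1 - 1) (at 0)"
      by (intro tendsto_diff phi_limit \<tau> odd)
    then show "((\<lambda>v. v * D v) \<longlongrightarrow> 0) (at 0)"
      by (simp add: D_def right_diff_distrib)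
  qed
  then show ?thesis
    using \<mu>(1) by (simp add: D_def \<mu>_def \<sigma>_def field_simps)
qed

text \<open>Put w = \<mu> z in \<open>phi_moebius\<close>: its prefactor \<mu> joins z to form w
  again, so g acts on the series of z \<phi>(z) by pure rescaling.\<close>

lemma theta_ser_moebius:
  assumes g: "g \<in> SL2Z" and \<tau>: "Im \<tau> > 0"
    and p': "even (p' - (p * g $ 1 $ 1 + r * g $ 2 $ 1))" and r': "even (r' - (p * g $ 1 $ 2 + r * g $ 2 $ 2))"
    and odd: "odd p \<or> odd r" "odd p' \<or> odd r'"
  shows "theta_ser p r (moebius_act g \<tau>) = fps_scale (aut_factor g \<tau>) (theta_ser p' r' \<tau>)"
proof -
  define \<mu> where "\<mu> = aut_factor g \<tau>"
  have \<mu>: "\<mu> \<noteq> 0" using aut_factor_nonzero [OF g \<tau>] by (simp add: \<mu>_def)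
  obtain h where h: "h has_fps_expansion theta_ser p r (moebius_act g \<tau>)"
      "\<forall>\<^sub>F z in at 0. z * phi p r z (moebius_act g \<tau>) = h z"
    using theta_ser_expansion [OF Im_moebius_act [OF g \<tau>] odd(1)] .
  obtain h' where h': "h' has_fps_expansion theta_ser p' r' \<tau>" "\<forall>\<^sub>F z in at 0. z * phi p' r' z \<tau> = h' z"
    using theta_ser_expansion [OF \<tau> odd(2)] .
  have "(h' \<circ> (\<lambda>z. \<mu> * z)) has_fps_expansion fps_compose (theta_ser p' r' \<tau>) (fps_const \<mu> * fps_X)"
    by (intro has_fps_expansion_compose h'(1) fps_expansion_intros) simp
  then have 1: "(\<lambda>z. h' (\<mu> * z)) has_fps_expansion fps_scale \<mu> (theta_ser p' r' \<tau>)"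
    by (simp add: fps_scale_def o_def)
  have "filterlim (\<lambda>z. \<mu> * z) (at 0) (at 0)"
    using \<mu> by (auto simp: filterlim_at eventually_at_filter intro!: tendsto_eq_intros)
  then have "\<forall>\<^sub>F z in at 0. (\<mu> * z) * phi p' r' (\<mu> * z) \<tau> = h' (\<mu> * z)"
    and "\<forall>\<^sub>F z in at 0. \<mu> * z \<notin> Lattice \<tau>"
    using h'(2) eventually_at_0_not_Lattice [OF \<tau>] by (auto simp: filterlim_iff)
  with h(2) have "\<forall>\<^sub>F z in at 0. h z = h' (\<mu> * z)"
  proof eventually_elim
    case (elim z)
    then show ?case
      using phi_moebius [OF g \<tau> p' r' odd, of "\<mu> * z"] \<mu> by (simp add: \<mu>_def mult_ac)
  qed
  from power_series_eqI [OF 1 this] has_fps_expansion_power_series [OF h(1)] show ?thesis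
    by (simp add: \<mu>_def)
qed

section \<open>Calculus of smooth functions\<close>

lemmas frechet_derivative_worksI = frechet_derivative_works [THEN iffD1]

lemma differentiable_on_openD:
  "f differentiable_on S \<Longrightarrow> open S \<Longrightarrow> u \<in> S \<Longrightarrow> f differentiable at u"
  by (simp add: differentiable_on_eq_differentiable_at)

text \<open>On an open set a derivative sees only the values on that set. This allows the
  differentiation rules, known on \<open>S\<close> alone, to be used inside
  \<open>Ck_on\<close>.\<close>

lemma Ck_on_cong:
  assumes "open S" "\<And>u. u \<in> S \<Longrightarrow> f u = g u" "Ck_on k S f"
  shows "Ck_on k S g"
  using assms(2,3)
proof (induction k arbitrary: f g)
  case 0
  then show ?case by (auto intro: continuous_on_eq)
next
  case (Suc k)
  have diff: "f differentiable at u" if "u \<in> S" for u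
    using Suc.prems assms(1) that differentiable_on_openD by auto
  have eq: "frechet_derivative f (at u) = frechet_derivative g (at u)" if "u \<in> S" for u
    using frechet_derivative_transform_within_open [OF diff [OF that] assms(1) that] Suc.prems(1) by blast
  have "g differentiable at u" if "u \<in> S" for u
    using has_derivative_transform_within_open [OF frechet_derivative_worksI [OF diff [OF that]] assms(1) that] Suc.prems(1)
    unfolding differentiable_def by blast
  then have "g differentiable_on S"
    by (simp add: differentiable_on_eq_differentiable_at assms(1))
  moreover have "Ck_on k S (\<lambda>u. frechet_derivative g (at u) (axis i 1))" for i
    by (rule Suc.IH [of "\<lambda>u. frechet_derivative f (at u) (axis i 1)", OF fun_cong [OF eq]]) (use Suc.prems(2) in simp_all)
  ultimately show ?case by simp
qed

lemma Ck_on_subset: "Ck_on k S f \<Longrightarrow> T \<subseteq> S \<Longrightarrow> Ck_on k T f"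
  by (induction k arbitrary: f) (auto intro: continuous_on_subset differentiable_on_subset)

lemma Ck_on_Suc_imp: "Ck_on (Suc k) S f \<Longrightarrow> Ck_on k S f"
  by (induction k arbitrary: f) (auto simp: differentiable_imp_continuous_on)

lemma Ck_on_const: "Ck_on k S (\<lambda>u. c)"
  by (induction k arbitrary: c) auto

lemma Ck_on_add:
  assumes "open S" "Ck_on k S f" "Ck_on k S g"
  shows "Ck_on k S (\<lambda>u. f u + g u)"
  using assms(2,3)
proof (induction k arbitrary: f g)
  case 0
  then show ?case by (auto intro: continuous_intros)
next
  case (Suc k)
  have d: "f differentiable at u" "g differentiable at u" if "u \<in> S" for u
    using Suc.prems assms(1) that differentiable_on_openD by auto
  have eq: "frechet_derivative f (at u) h + frechet_derivative g (at u) h = frechet_derivative (\<lambda>u. f u + g u) (at u) h"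
    if "u \<in> S" for u h
    using fun_cong [OF frechet_derivative_at [OF has_derivative_add
          [OF frechet_derivative_worksI [OF d(1) [OF that]] frechet_derivative_worksI [OF d(2) [OF that]]]], of h]
    by simp
  have "Ck_on k S (\<lambda>u. frechet_derivative (\<lambda>u. f u + g u) (at u) (axis i 1))" for i
    using Suc.prems by (intro Ck_on_cong [OF assms(1) eq] Suc.IH) auto
  then show ?case using Suc.prems by auto
qed

lemma Ck_on_mult:
  assumes "open S" "Ck_on k S f" "Ck_on k S g"
  shows "Ck_on k S (\<lambda>u. f u * g u)"
  using assms(2,3)
proof (induction k arbitrary: f g)
  case 0
  then show ?case by (auto intro: continuous_intros)
next
  case (Suc k)
  have d: "f differentiable at u" "g differentiable at u" if "u \<in> S" for u
    using Suc.prems assms(1) that differentiable_on_openD by auto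
  have eq: "f u * frechet_derivative g (at u) h + frechet_derivative f (at u) h * g u = frechet_derivative (\<lambda>u. f u * g u) (at u) h"
    if "u \<in> S" for u h
    using fun_cong [OF frechet_derivative_at [OF has_derivative_mult
          [OF frechet_derivative_worksI [OF d(1) [OF that]] frechet_derivative_worksI [OF d(2) [OF that]]]], of h]
    by simp
  have "Ck_on k S (\<lambda>u. frechet_derivative (\<lambda>u. f u * g u) (at u) (axis i 1))" for i
    using Suc.prems Ck_on_Suc_imp [OF Suc.prems(1)] Ck_on_Suc_imp [OF Suc.prems(2)]
    by (intro Ck_on_cong [OF assms(1) eq] Ck_on_add [OF assms(1)] Suc.IH) auto
  then show ?case using Suc.prems by auto
qed

lemma Ck_on_sum:
  assumes "open S" "\<And>i. i \<in> I \<Longrightarrow> Ck_on k S (f i)"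
  shows "Ck_on k S (\<lambda>u. \<Sum>i\<in>I. f i u)"
  using assms(2)
  by (induction I rule: infinite_finite_induct) (auto intro: Ck_on_const Ck_on_add [OF assms(1)])

lemma vec_eq_sum_axis: "(x :: real^'n) = (\<Sum>i\<in>UNIV. (x $ i) *\<^sub>R axis i 1)"
  using basis_expansion [of x] by (simp add: scalar_mult_eq_scaleR)

text \<open>By the chain rule in coordinates, the partial derivatives are sums of products of a
  partial derivative of f along \<psi> with one of \<psi>; the induction varies f and keeps \<psi>
  fixed.\<close>

lemma Ck_on_compose:
  fixes \<psi> :: "real^'n \<Rightarrow> real^'n"
  assumes "open S" "open T" "\<psi> ` S \<subseteq> T" "Ck_on k T f" "\<And>i. Ck_on k S (\<lambda>u. \<psi> u $ i)"
  shows "Ck_on k S (\<lambda>u. f (\<psi> u))"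
  using assms(4,5)
proof (induction k arbitrary: f)
  case 0
  have "continuous_on S (\<lambda>u. \<chi> i. \<psi> u $ i)"
    using 0 by (intro continuous_on_vec_lambda) auto
  then show ?case
    using 0 assms(3) by (auto intro: continuous_on_compose2)
next
  case (Suc k)
  have \<psi>_diff: "(\<lambda>u. \<psi> u $ i) differentiable at u" if "u \<in> S" for u i
    using Suc.prems(2) [of i] assms(1) that differentiable_on_openD by auto
  have f_diff: "f differentiable at (\<psi> u)" if "u \<in> S" for u
    using differentiable_on_openD [OF _ assms(2), of f "\<psi> u"] Suc.prems assms(3) that by auto
  let ?d = "\<lambda>u h i. frechet_derivative (\<lambda>u. \<psi> u $ i) (at u) h"
  have deriv: "((\<lambda>u. f (\<psi> u)) has_derivative (\<lambda>h. frechet_derivative f (at (\<psi> u)) (\<Sum>i\<in>UNIV. ?d u h i *\<^sub>R axis i 1))) (at u)"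
    if u: "u \<in> S" for u
  proof -
    have "((\<lambda>u. \<Sum>i\<in>UNIV. (\<psi> u $ i) *\<^sub>R (axis i 1 :: real^'n)) has_derivative (\<lambda>h. \<Sum>i\<in>UNIV. ?d u h i *\<^sub>R axis i 1)) (at u)"
      by (intro has_derivative_sum has_derivative_scaleR_left frechet_derivative_worksI \<psi>_diff u)
    then have "(\<psi> has_derivative (\<lambda>h. \<Sum>i\<in>UNIV. ?d u h i *\<^sub>R axis i 1)) (at u)"
      by (simp add: vec_eq_sum_axis [symmetric])
    from diff_chain_at [OF this frechet_derivative_worksI [OF f_diff [OF u]]] show ?thesis
      by (simp add: o_def)
  qed
  have eq: "(\<Sum>i\<in>UNIV. ?d u h i * frechet_derivative f (at (\<psi> u)) (axis i 1)) = frechet_derivative (\<lambda>u. f (\<psi> u)) (at u) h"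
    if u: "u \<in> S" for u h
  proof -
    have "linear (frechet_derivative f (at (\<psi> u)))"
      by (rule linear_frechet_derivative [OF f_diff [OF u]])
    then have "frechet_derivative f (at (\<psi> u)) (\<Sum>i\<in>UNIV. ?d u h i *\<^sub>R axis i 1)
        = (\<Sum>i\<in>UNIV. ?d u h i * frechet_derivative f (at (\<psi> u)) (axis i 1))"
      by (simp add: linear_sum linear_cmul)
    with fun_cong [OF frechet_derivative_at [OF deriv [OF u]], of h] show ?thesis by simp
  qed
  have "Ck_on k S (\<lambda>u. frechet_derivative f (at (\<psi> u)) (axis j 1))" for j
    using Suc.prems(1) Ck_on_Suc_imp [OF Suc.prems(2)]
    by (intro Suc.IH [of "\<lambda>v. frechet_derivative f (at v) (axis j 1)"]) auto
  then have "Ck_on k S (\<lambda>u. frechet_derivative (\<lambda>u. f (\<psi> u)) (at u) (axis i 1))" for i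
    using Suc.prems by (intro Ck_on_cong [OF assms(1) eq] Ck_on_sum [OF assms(1)] Ck_on_mult [OF assms(1)]) auto
  moreover have "(\<lambda>u. f (\<psi> u)) differentiable_on S"
    unfolding differentiable_on_eq_differentiable_at [OF assms(1)] differentiable_def using deriv by blast
  ultimately show ?case by simp
qed

lemma Cinf_on_cong:
  "open S \<Longrightarrow> (\<And>u. u \<in> S \<Longrightarrow> f u = g u) \<Longrightarrow> Cinf_on S f \<Longrightarrow> Cinf_on S g"
  unfolding Cinf_on_def using Ck_on_cong by blast

lemma Cinf_on_subset: "Cinf_on S f \<Longrightarrow> T \<subseteq> S \<Longrightarrow> Cinf_on T f"
  unfolding Cinf_on_def using Ck_on_subset by blast

lemma Cinf_on_differentiable: "Cinf_on S f \<Longrightarrow> open S \<Longrightarrow> u \<in> S \<Longrightarrow> f differentiable at u"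
  unfolding Cinf_on_def by (meson Ck_on.simps(2) differentiable_on_openD)

lemma Cinf_on_deriv: "Cinf_on S f \<Longrightarrow> Cinf_on S (\<lambda>u. frechet_derivative f (at u) (axis i 1))"
  unfolding Cinf_on_def
proof
  fix k assume "\<forall>k. Ck_on k S f"
  then have "Ck_on (Suc k) S f" ..
  then show "Ck_on k S (\<lambda>u. frechet_derivative f (at u) (axis i 1))" by simp
qed

section \<open>Smooth functions and tangent vectors on a manifold\<close>

context
  fixes A :: "('m::{t2_space, second_countable_topology}, 'n::finite) chart set"
  assumes atlas: "smooth_atlas A"
begin

lemma chart_open: "(V, \<phi>) \<in> A \<Longrightarrow> open V"
  using atlas by (auto simp: smooth_atlas_def)

lemma chart_homeomorphism: "(V, \<phi>) \<in> A \<Longrightarrow> homeomorphism V (\<phi> ` V) \<phi> (inv_into V \<phi>)"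
  using atlas by (auto simp: smooth_atlas_def)

lemma chart_image_open:
  assumes "(V, \<phi>) \<in> A" "open U"
  shows "open (\<phi> ` (U \<inter> V))"
proof -
  have "openin (top_of_set (\<phi> ` V)) (\<phi> ` (U \<inter> V))"
    using assms by (intro homeomorphism_imp_open_map [OF chart_homeomorphism] openin_open_Int [of U V, simplified Int_commute]) auto
  moreover have "open (\<phi> ` V)"
    using assms(1) atlas by (auto simp: smooth_atlas_def)
  ultimately show ?thesis by (simp add: openin_open_eq)
qed

lemma chart_inv: "(V, \<phi>) \<in> A \<Longrightarrow> x \<in> V \<Longrightarrow> inv_into V \<phi> (\<phi> x) = x"
  using homeomorphism_apply1 chart_homeomorphism by blast

lemma smooth_fun_const: "smooth_fun A U (\<lambda>y. c)"
  by (simp add: smooth_fun_def Cinf_on_def Ck_on_const o_def)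

lemma smooth_fun_add:
  "open U \<Longrightarrow> smooth_fun A U f \<Longrightarrow> smooth_fun A U g \<Longrightarrow> smooth_fun A U (\<lambda>y. f y + g y)"
  unfolding smooth_fun_def Cinf_on_def o_def using chart_image_open Ck_on_add by fast

lemma smooth_fun_mult:
  "open U \<Longrightarrow> smooth_fun A U f \<Longrightarrow> smooth_fun A U g \<Longrightarrow> smooth_fun A U (\<lambda>y. f y * g y)"
  unfolding smooth_fun_def Cinf_on_def o_def using chart_image_open Ck_on_mult by fast

lemma smooth_fun_cong:
  assumes "open U" "\<And>y. y \<in> U \<Longrightarrow> f y = g y" "smooth_fun A U f"
  shows "smooth_fun A U g"
  unfolding smooth_fun_def
proof (clarify)
  fix V \<phi> assume V: "(V, \<phi>) \<in> A"
  show "Cinf_on (\<phi> ` (U \<inter> V)) (g \<circ> inv_into V \<phi>)"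
  proof (rule Cinf_on_cong)
    show "Cinf_on (\<phi> ` (U \<inter> V)) (f \<circ> inv_into V \<phi>)"
      using assms(3) V by (auto simp: smooth_fun_def)
  qed (use assms V chart_image_open chart_inv in auto)
qed

lemma smooth_fun_subset: "smooth_fun A U f \<Longrightarrow> U' \<subseteq> U \<Longrightarrow> smooth_fun A U' f"
  unfolding smooth_fun_def using Cinf_on_subset by (fastforce intro: Cinf_on_subset)

lemma smooth_near_const: "smooth_near A x (\<lambda>y. c)"
  unfolding smooth_near_def using smooth_fun_const by blast

lemma smooth_near_binary:
  assumes "\<And>U. open U \<Longrightarrow> smooth_fun A U f \<Longrightarrow> smooth_fun A U g \<Longrightarrow> smooth_fun A U h"
    and "smooth_near A x f" "smooth_near A x g"
  shows "smooth_near A x h"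
proof -
  obtain U U' where U: "open U" "x \<in> U" "smooth_fun A U f" "open U'" "x \<in> U'" "smooth_fun A U' g"
    using assms by (auto simp: smooth_near_def)
  then have "smooth_fun A (U \<inter> U') h"
    by (intro assms(1)) (auto intro: smooth_fun_subset)
  then show ?thesis
    unfolding smooth_near_def using U by (intro exI [of _ "U \<inter> U'"]) auto
qed

lemma smooth_near_add: "smooth_near A x f \<Longrightarrow> smooth_near A x g \<Longrightarrow> smooth_near A x (\<lambda>y. f y + g y)"
  by (rule smooth_near_binary) (rule smooth_fun_add)

lemma smooth_near_mult: "smooth_near A x f \<Longrightarrow> smooth_near A x g \<Longrightarrow> smooth_near A x (\<lambda>y. f y * g y)"
  by (rule smooth_near_binary) (rule smooth_fun_mult)

lemma smooth_near_eventually: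
  assumes "smooth_near A x f" "\<forall>\<^sub>F y in nhds x. f y = g y"
  shows "smooth_near A x g"
proof -
  obtain U where U: "open U" "x \<in> U" "smooth_fun A U f"
    using assms(1) by (auto simp: smooth_near_def)
  obtain U' where U': "open U'" "x \<in> U'" "\<And>y. y \<in> U' \<Longrightarrow> f y = g y"
    using assms(2) by (auto simp: eventually_nhds)
  have "smooth_fun A (U \<inter> U') g"
    by (rule smooth_fun_cong [of _ f]) (use U U' in \<open>auto intro: smooth_fun_subset\<close>)
  then show ?thesis
    unfolding smooth_near_def using U U' by (intro exI [of _ "U \<inter> U'"]) auto
qed

lemma smooth_near_differentiable:
  assumes "smooth_near A x f" "(V, \<phi>) \<in> A" "x \<in> V"
  shows "(f \<circ> inv_into V \<phi>) differentiable at (\<phi> x)"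
proof -
  obtain U where U: "open U" "x \<in> U" "smooth_fun A U f"
    using assms(1) by (auto simp: smooth_near_def)
  then have "Cinf_on (\<phi> ` (U \<inter> V)) (f \<circ> inv_into V \<phi>)"
    using assms(2) by (auto simp: smooth_fun_def)
  then show ?thesis
    by (rule Cinf_on_differentiable) (use U assms chart_image_open in auto)
qed

lemma smooth_fun_chart:
  assumes "(V, \<phi>) \<in> A"
  shows "smooth_fun A V (\<lambda>y. \<phi> y $ i)"
  using atlas assms unfolding smooth_fun_def smooth_atlas_def o_def by (fastforce simp: Int_commute)

section \<open>Coordinate vector fields\<close>

lemma coordinate_vector_in_tangent_space:
  assumes V: "(V, \<phi>) \<in> A" and x: "x \<in> V"
  shows "fvec (coordinate_frame A (V, \<phi>)) b x \<in> tangent_space A x"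
proof -
  let ?D = "\<lambda>f. frechet_derivative (f \<circ> inv_into V \<phi>) (at (\<phi> x)) (axis b 1)"
  note diff = smooth_near_differentiable [OF _ V x, THEN frechet_derivative_worksI]
  have inv: "inv_into V \<phi> (\<phi> x) = x" using chart_inv [OF V x] .
  have add: "?D (\<lambda>y. f y + g y) = ?D f + ?D g" if "smooth_near A x f" "smooth_near A x g" for f g
    using fun_cong [OF frechet_derivative_at [OF has_derivative_add [OF diff [OF that(1)] diff [OF that(2)]]], of "axis b 1"]
    by (simp add: o_def)
  have mult: "?D (\<lambda>y. f y * g y) = ?D f * g x + f x * ?D g" if "smooth_near A x f" "smooth_near A x g" for f g
    using fun_cong [OF frechet_derivative_at [OF has_derivative_mult [OF diff [OF that(1)] diff [OF that(2)]]], of "axis b 1"]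
    by (simp add: o_def inv add.commute)
  \<comment> \<open>Homogeneity of the derivation is the product rule with a constant
    factor.\<close>
  have const: "?D (\<lambda>y. c) = 0" for c by (simp add: o_def)
  have ev: "?D f = ?D g" if f: "smooth_near A x f" and fg: "\<forall>\<^sub>F y in nhds x. f y = g y" for f g
  proof -
    obtain U where U: "open U" "x \<in> U" "\<And>y. y \<in> U \<Longrightarrow> f y = g y"
      using fg by (auto simp: eventually_nhds)
    have "frechet_derivative (f \<circ> inv_into V \<phi>) (at (\<phi> x)) = frechet_derivative (g \<circ> inv_into V \<phi>) (at (\<phi> x))"
      by (rule frechet_derivative_transform_within_open [OF smooth_near_differentiable [OF f V x] chart_image_open [OF V U(1)]])
        (use U x chart_inv [OF V] in auto)
    then show ?thesis by simp
  qed
  show ?thesis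
    unfolding tangent_space_def coordinate_frame_def
    using smooth_near_add smooth_near_mult smooth_near_const smooth_near_eventually
    by (auto simp: add mult const intro: ev)
qed

text \<open>In a second chart the components of a coordinate field are entries of the Jacobian of a
  transition map. Smoothness is tested in a third chart, hence the composition with another
  transition map.\<close>

lemma smooth_coordinate_vector:
  assumes V: "(V, \<phi>) \<in> A" and W: "open W" "W \<subseteq> V"
  shows "smooth_vfield A W (fvec (coordinate_frame A (V, \<phi>)) b)"
  unfolding smooth_section_def
proof (intro conjI ballI allI)
  show "fvec (coordinate_frame A (V, \<phi>)) b x \<in> fibre (tangent_bundle A) x" if "x \<in> W" for x
    using coordinate_vector_in_tangent_space [OF V] that W by (auto simp: tangent_bundle_def)
  fix F' i assume "F' \<in> frames (tangent_bundle A)"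
  then obtain V' \<phi>' where V': "(V', \<phi>') \<in> A" "F' = coordinate_frame A (V', \<phi>')"
    by (auto simp: tangent_bundle_def)
  let ?h = "(\<lambda>y. \<phi>' y $ i) \<circ> inv_into V \<phi>"
  let ?g = "\<lambda>x. frechet_derivative ?h (at (\<phi> x)) (axis b 1)"
  have "smooth_fun A (W \<inter> V') ?g"
    unfolding smooth_fun_def
  proof clarify
    fix V'' \<phi>'' assume V'': "(V'', \<phi>'') \<in> A"
    let ?S = "\<phi>'' ` ((W \<inter> V') \<inter> V'')" and ?T = "\<phi> ` (V' \<inter> V)" and ?\<psi> = "\<lambda>u. \<phi> (inv_into V'' \<phi>'' u)"
    have opn: "open ?S" "open ?T"
      using chart_image_open [OF V''] chart_image_open [OF V] chart_open [OF V'(1)] W(1) by auto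
    have sub: "?\<psi> ` ?S \<subseteq> ?T"
      using chart_inv [OF V''] W(2) by auto
    have "Cinf_on ?T (\<lambda>v. frechet_derivative ?h (at v) (axis b 1))"
      using smooth_fun_chart [OF V'(1), of i] V by (intro Cinf_on_deriv) (auto simp: smooth_fun_def)
    moreover have "Cinf_on ?S (\<lambda>u. ?\<psi> u $ j)" for j
    proof -
      have "Cinf_on (\<phi>'' ` (V \<inter> V'')) (\<lambda>u. ?\<psi> u $ j)"
        using smooth_fun_chart [OF V, of j] V'' by (auto simp: smooth_fun_def o_def)
      then show ?thesis by (rule Cinf_on_subset) (use W(2) in auto)
    qed
    ultimately show "Cinf_on ?S (?g \<circ> inv_into V'' \<phi>'')"
      using Ck_on_compose [OF opn sub, of _ "\<lambda>v. frechet_derivative ?h (at v) (axis b 1)"]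
      by (simp add: Cinf_on_def o_def)
  qed
  then have "smooth_fun A (W \<inter> V') (\<lambda>x. fcov F' i x (fvec (coordinate_frame A (V, \<phi>)) b x))"
  proof (rule smooth_fun_cong [rotated 2])
    show "open (W \<inter> V')" using W(1) chart_open [OF V'(1)] by auto
    fix x assume "x \<in> W \<inter> V'"
    then have "smooth_near A x (\<lambda>y. \<phi>' y $ i)"
      unfolding smooth_near_def using smooth_fun_chart [OF V'(1)] chart_open [OF V'(1)] by blast
    then show "?g x = fcov F' i x (fvec (coordinate_frame A (V, \<phi>)) b x)"
      by (simp add: V'(2) coordinate_frame_def)
  qed
  then show "smooth_fun A (W \<inter> fdom F') (\<lambda>x. fcov F' i x (fvec (coordinate_frame A (V, \<phi>)) b x))"
    by (simp add: V'(2) coordinate_frame_def)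
qed

section \<open>Curvature along the affine path of connections\<close>

lemma tangent_vector_const:
  assumes "D \<in> tangent_space A x"
  shows "D (\<lambda>y. c) = 0"
proof -
  note D = assms [unfolded tangent_space_def mem_Collect_eq, THEN conjunct1, rule_format]
    assms [unfolded tangent_space_def mem_Collect_eq, THEN conjunct2, THEN conjunct1, rule_format]
  \<comment> \<open>The Leibniz rule for 1 * 1 gives D(1) = 2 D(1).\<close>
  have "D (\<lambda>y. 1 * 1) = D (\<lambda>y. 1) * 1 + 1 * D (\<lambda>y. 1)"
    using D(1) [of "\<lambda>y. 1" "\<lambda>y. 1"] smooth_near_const by blast
  then have "D (\<lambda>y. 1) = 0" by simp
  with D(2) [of "\<lambda>y. 1" c] smooth_near_const show ?thesis by simp
qed

lemma smooth_vfield_scaleR: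
  assumes "open W" "smooth_vfield A W s"
  shows "smooth_vfield A W (\<lambda>y. c *\<^sub>R s y)"
  unfolding smooth_section_def
proof (intro conjI ballI allI)
  have in_fibre: "s x \<in> tangent_space A x" if "x \<in> W" for x
    using assms(2) that by (auto simp: smooth_section_def tangent_bundle_def)
  show "c *\<^sub>R s x \<in> fibre (tangent_bundle A) x" if "x \<in> W" for x
    using in_fibre [OF that] unfolding tangent_bundle_def tangent_space_def
    by (auto simp: scaleR_fun_def algebra_simps)
  fix F i assume F: "F \<in> frames (tangent_bundle A)"
  then obtain V \<phi> where V: "(V, \<phi>) \<in> A" "F = coordinate_frame A (V, \<phi>)"
    by (auto simp: tangent_bundle_def)
  have "smooth_fun A (W \<inter> fdom F) (\<lambda>x. fcov F i x (s x))"
    using assms(2) F by (auto simp: smooth_section_def)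
  moreover have "open (W \<inter> fdom F)"
    using assms(1) chart_open [OF V(1)] by (auto simp: V(2) coordinate_frame_def)
  ultimately have "smooth_fun A (W \<inter> fdom F) (\<lambda>x. c * fcov F i x (s x))"
    by (intro smooth_fun_mult smooth_fun_const)
  then show "smooth_fun A (W \<inter> fdom F) (\<lambda>x. fcov F i x (c *\<^sub>R s x))"
    by (simp add: V(2) coordinate_frame_def scaleR_fun_def)
qed

text \<open>Real linearity is the Leibniz rule with constant coefficient functions, which tangent
  vectors annihilate.\<close>

lemma connection_linear_combination:
  assumes D: "connection A (tangent_bundle A) D" and W: "open W" "x \<in> W"
    and X: "smooth_vfield A W X" and s: "smooth_vfield A W s" "smooth_vfield A W s'"
  shows "D X (\<lambda>y. c *\<^sub>R s y + c' *\<^sub>R s' y) x = c *\<^sub>R D X s x + c' *\<^sub>R D X s' x"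
proof -
  have "X x \<in> tangent_space A x"
    using X W by (auto simp: smooth_section_def tangent_bundle_def)
  then have const: "X x (\<lambda>y. a) = 0" for a by (rule tangent_vector_const)
  have scale: "D X (\<lambda>y. a *\<^sub>R v y) x = a *\<^sub>R D X v x" if "smooth_vfield A W v" for a v
  proof -
    have "D X (\<lambda>y. (\<lambda>y. a) y *\<^sub>R v y) x = X x (\<lambda>y. a) *\<^sub>R v x + (\<lambda>y. a) x *\<^sub>R D X v x"
      using D W X that smooth_fun_const [of W a] unfolding connection_def by blast
    then show ?thesis by (simp add: const)
  qed
  have "D X (\<lambda>y. (\<lambda>y. c *\<^sub>R s y) y + (\<lambda>y. c' *\<^sub>R s' y) y) x = D X (\<lambda>y. c *\<^sub>R s y) x + D X (\<lambda>y. c' *\<^sub>R s' y) x"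
    using D W X smooth_vfield_scaleR [OF W(1) s(1), of c] smooth_vfield_scaleR [OF W(1) s(2), of c']
    unfolding connection_def by blast
  then show ?thesis by (simp add: scale s)
qed

text \<open>The curvature of the path is a polynomial of degree at most 2 in t with coefficients
  independent of t. Expanding it requires the frame vectors and their covariant derivatives to be
  smooth sections.\<close>

lemma continuous_curvature_path:
  assumes D: "connection A (tangent_bundle A) D0" "connection A (tangent_bundle A) D1"
    and F: "F \<in> frames (tangent_bundle A)" and W: "open W" "x \<in> W" "W \<subseteq> fdom F"
    and X: "smooth_vfield A W X" and Y: "smooth_vfield A W Y"
  shows "continuous_on UNIV (\<lambda>t. fcov F a x (curvature A (connection_path D0 D1 t) X Y (fvec F b) x))"
proof -
  obtain V \<phi> where V: "(V, \<phi>) \<in> A" "F = coordinate_frame A (V, \<phi>)"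
    using F by (auto simp: tangent_bundle_def)
  let ?s = "fvec F b"
  have s: "smooth_vfield A W ?s"
    unfolding V(2) using W by (intro smooth_coordinate_vector V(1)) (auto simp: V(2) coordinate_frame_def)
  have Ds: "smooth_vfield A W (D Z ?s)" if "connection A (tangent_bundle A) D" "smooth_vfield A W Z" for D Z
    using that s W(1) unfolding connection_def by blast
  \<comment> \<open>The outer connection acts on a section that itself depends on t; linearity
    brings the t-dependence outside.\<close>
  have comb: "D Z (connection_path D0 D1 t Z' ?s) x = (1 - t) *\<^sub>R D Z (D0 Z' ?s) x + t *\<^sub>R D Z (D1 Z' ?s) x"
    if "connection A (tangent_bundle A) D" "smooth_vfield A W Z" "smooth_vfield A W Z'" for D Z Z' t
    unfolding connection_path_def
    by (rule connection_linear_combination [OF that(1) W(1,2) that(2) Ds [OF D(1) that(3)] Ds [OF D(2) that(3)]])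
  have path: "connection_path D0 D1 t Z \<sigma> x = (1 - t) *\<^sub>R D0 Z \<sigma> x + t *\<^sub>R D1 Z \<sigma> x" for t Z \<sigma>
    by (simp add: connection_path_def)
  have "curvature A (connection_path D0 D1 t) X Y ?s x =
      (1 - t) *\<^sub>R ((1 - t) *\<^sub>R D0 X (D0 Y ?s) x + t *\<^sub>R D0 X (D1 Y ?s) x)
        + t *\<^sub>R ((1 - t) *\<^sub>R D1 X (D0 Y ?s) x + t *\<^sub>R D1 X (D1 Y ?s) x)
      - ((1 - t) *\<^sub>R ((1 - t) *\<^sub>R D0 Y (D0 X ?s) x + t *\<^sub>R D0 Y (D1 X ?s) x)
        + t *\<^sub>R ((1 - t) *\<^sub>R D1 Y (D0 X ?s) x + t *\<^sub>R D1 Y (D1 X ?s) x))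
      - ((1 - t) *\<^sub>R D0 (lie_bracket A X Y) ?s x + t *\<^sub>R D1 (lie_bracket A X Y) ?s x)" for t
    by (simp only: curvature_def path comb [OF D(1) X Y] comb [OF D(2) X Y] comb [OF D(1) Y X] comb [OF D(2) Y X])
  then show ?thesis
    by (simp add: V(2) coordinate_frame_def scaleR_fun_def) (intro continuous_intros)
qed

end

section \<open>The theta functions\<close>

lemma qpoch_nome_nonzero:
  assumes "Im \<tau> > 0"
  shows "qpoch (evar \<tau>) (evar \<tau>) \<noteq> 0"
proof -
  have "evar \<tau> * evar \<tau> ^ j \<noteq> 1" for j
  proof -
    have "norm (evar \<tau> ^ Suc j) < 1"
      using norm_evar_less_1 [OF assms] by (simp add: norm_power power_less_one_iff del: power_Suc)
    then show ?thesis by (metis less_irrefl norm_one power_Suc)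
  qed
  then show ?thesis by (simp add: qpoch_eq_0_iff [OF norm_evar_less_1 [OF assms]])
qed

lemma qpow_eq: "qpow \<tau> a = evar (of_real a * \<tau>)"
  by (simp add: qpow_def evar_def mult_ac)

lemma qpow_Suc: "qpow \<tau> (real j + 1) = evar \<tau> * evar \<tau> ^ j"
proof -
  have "qpow \<tau> (real j + 1) = evar (of_nat (Suc j) * \<tau>)" by (simp add: qpow_eq add.commute)
  then show ?thesis by (simp only: evar_mult_of_nat power_Suc)
qed

lemma prodinf_triple:
  fixes q :: complex
  assumes "norm q < 1"
  shows "(\<Prod>j. (1 - q * q ^ j) * (1 - a * q ^ j) * (1 - b * q ^ j)) = qpoch q q * qpoch a q * qpoch b q"
  unfolding qpoch_def
  by (simp add: prodinf_mult convergent_prod_mult convergent_prod_qpoch [OF assms])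

text \<open>2 sin(pi v) = i exp(- pi i v) (1 - exp(2 pi i v)) supplies the factor of index 0 by
  which \<open>Tprod\<close> exceeds the product in \<open>theta\<close>.\<close>

lemma theta_eq:
  assumes "Im \<tau> > 0"
  shows "theta v \<tau> = \<i> * evar (\<tau> / 8) * qpoch (evar \<tau>) (evar \<tau>) * evar (- v / 2) * Tprod v \<tau>"
proof -
  let ?q = "evar \<tau>"
  have P: "(\<Prod>j. (1 - qpow \<tau> (real j + 1)) * (1 - evar v * qpow \<tau> (real j + 1)) * (1 - evar (- v) * qpow \<tau> (real j + 1)))
      = qpoch ?q ?q * qpoch (evar v * ?q) ?q * qpoch (evar (- v) * ?q) ?q"
    unfolding qpow_Suc mult.assoc [symmetric] by (rule prodinf_triple [OF norm_evar_less_1 [OF assms]])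
  have S: "2 * sin (of_real pi * v) = \<i> * evar (- v / 2) * (1 - evar v)"
  proof -
    have "\<i> * evar (- v / 2) * (1 - evar v) = \<i> * (evar (- v / 2) - evar (v / 2))"
      by (simp add: right_diff_distrib evar_add [symmetric])
    also have "\<dots> = 2 * ((evar (v / 2) - evar (- v / 2)) / (2 * \<i>))"
      by (simp add: field_simps)
    also have "\<dots> = 2 * sin (of_real pi * v)"
      by (simp add: sin_exp_eq evar_def mult_ac)
    finally show ?thesis ..
  qed
  have "theta v \<tau> = evar (\<tau> / 8) * (2 * sin (of_real pi * v)) * (qpoch ?q ?q * qpoch (evar v * ?q) ?q * qpoch (evar (- v) * ?q) ?q)"
    unfolding theta_def P by (simp add: qpow_eq)
  moreover have "Tprod v \<tau> = (1 - evar v) * (qpoch (evar v * ?q) ?q * qpoch (evar (- v) * ?q) ?q)"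
    unfolding Tprod_eq_Sprod [OF assms] Sprod_def
    by (metis add.commute evar_add uminus_add_conv_diff)
  ultimately show ?thesis
    unfolding S by (simp only: mult_ac)
qed

lemma evar_add_half: "evar (v + 1/2) = - evar v"
  by (simp add: evar_add)

lemma evar_minus_half: "evar (- v - 1/2) = - evar (- v)"
  by (simp add: evar_diff)

lemma theta1_shift: "theta1 v \<tau> = theta (v + 1/2) \<tau>"
proof -
  have "sin (of_real pi * (v + 1/2)) = cos (of_real pi * v)"
    by (simp add: distrib_left sin_add cos_of_real_pi_half sin_of_real_pi_half)
  then show ?thesis
    by (simp add: theta1_def theta_def evar_add_half evar_minus_half)
qed

lemma theta3_shift: "theta3 v \<tau> = theta2 (v + 1/2) \<tau>"
  by (simp add: theta3_def theta2_def evar_add_half evar_minus_half)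

text \<open>Shifting v by \<tau> / 2 produces the half-integral powers of q, symmetrically in v and
  - v.\<close>

lemma theta2_eq:
  assumes "Im \<tau> > 0"
  shows "theta2 v \<tau> = qpoch (evar \<tau>) (evar \<tau>) * Tprod (v + \<tau> / 2) \<tau>"
proof -
  let ?q = "evar \<tau>"
  have q': "qpow \<tau> (real j + 1/2) = evar (\<tau> / 2) * ?q ^ j" for j
    by (simp add: qpow_eq evar_add [symmetric] evar_mult_of_nat [symmetric] algebra_simps)
  have "theta2 v \<tau> = qpoch ?q ?q * qpoch (evar v * evar (\<tau> / 2)) ?q * qpoch (evar (- v) * evar (\<tau> / 2)) ?q"
    unfolding theta2_def qpow_Suc q' mult.assoc [symmetric] by (rule prodinf_triple [OF norm_evar_less_1 [OF assms]])
  moreover have "evar (- v) * evar (\<tau> / 2) = evar (\<tau> - (v + \<tau> / 2))"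
    by (simp add: evar_add [symmetric] field_simps)
  ultimately show ?thesis
    by (simp add: Tprod_def evar_add)
qed

text \<open>\<open>theta_class th p r\<close>: the quotient of \<open>th\<close> and \<open>theta\<close> has characteristic \<open>(p, r)\<close>.\<close>
definition theta_class :: "(complex \<Rightarrow> complex \<Rightarrow> complex) \<Rightarrow> int \<Rightarrow> int \<Rightarrow> bool" where
  "theta_class th p r \<longleftrightarrow> (odd p \<or> odd r) \<and> (\<forall>\<tau>. Im \<tau> > 0 \<longrightarrow>
     (\<exists>K. K \<noteq> 0 \<and> (\<forall>v. th v \<tau> = K * evar (of_int (p - 1) * v / 2) * Tprod (v + half_period p r \<tau>) \<tau>)))"

lemma theta_class_theta1: "theta_class theta1 0 1"
  unfolding theta_class_def
proof (intro conjI allI impI)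
  fix \<tau> assume \<tau>: "Im \<tau> > 0"
  \<comment> \<open>The last factor is what the shift by 1/2 splits off from the exponential in
    \<open>theta_eq\<close>.\<close>
  let ?K = "\<i> * evar (\<tau> / 8) * qpoch (evar \<tau>) (evar \<tau>) * evar (- 1 / 4)"
  have "- (v + 1/2) / 2 = - 1 / 4 + - v / 2" for v :: complex
    by (simp add: field_simps)
  then have "evar (- (v + 1/2) / 2) = evar (- 1 / 4) * evar (- v / 2)" for v
    by (simp only: evar_add)
  then have "theta1 v \<tau> = ?K * evar (of_int (0 - 1) * v / 2) * Tprod (v + half_period 0 1 \<tau>) \<tau>" for v
    by (simp add: theta1_shift theta_eq [OF \<tau>] half_period_def mult_ac)
  moreover have "?K \<noteq> 0" using qpoch_nome_nonzero [OF \<tau>] by simp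
  ultimately show "\<exists>K. K \<noteq> 0 \<and> (\<forall>v. theta1 v \<tau> = K * evar (of_int (0 - 1) * v / 2) * Tprod (v + half_period 0 1 \<tau>) \<tau>)"
    by blast
qed simp

lemma theta_class_theta2: "theta_class theta2 1 0"
  unfolding theta_class_def
proof (intro conjI allI impI)
  fix \<tau> assume \<tau>: "Im \<tau> > 0"
  show "\<exists>K. K \<noteq> 0 \<and> (\<forall>v. theta2 v \<tau> = K * evar (of_int (1 - 1) * v / 2) * Tprod (v + half_period 1 0 \<tau>) \<tau>)"
    using qpoch_nome_nonzero [OF \<tau>] by (auto simp: theta2_eq [OF \<tau>] half_period_def)
qed simp

lemma theta_class_theta3: "theta_class theta3 1 1"
  unfolding theta_class_def
proof (intro conjI allI impI)
  fix \<tau> assume \<tau>: "Im \<tau> > 0"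
  have "v + half_period 1 1 \<tau> = v + 1/2 + \<tau> / 2" for v
    by (simp add: half_period_def field_simps)
  then show "\<exists>K. K \<noteq> 0 \<and> (\<forall>v. theta3 v \<tau> = K * evar (of_int (1 - 1) * v / 2) * Tprod (v + half_period 1 1 \<tau>) \<tau>)"
    using qpoch_nome_nonzero [OF \<tau>] by (auto simp: theta3_shift theta2_eq [OF \<tau>] add.assoc)
qed simp

text \<open>In \<open>theta\<close> = (1 - \<open>evar v\<close>) G(v) the first factor vanishes at
  0, so only its own derivative - 2 pi i contributes.\<close>

lemma dtheta_theta_0:
  assumes \<tau>: "Im \<tau> > 0"
  shows "dtheta theta 0 \<tau> = - (2 * of_real pi * \<i>) * (\<i> * evar (\<tau> / 8) * qpoch (evar \<tau>) (evar \<tau>)) * Sprod 0 \<tau>"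
proof -
  let ?C = "\<i> * evar (\<tau> / 8) * qpoch (evar \<tau>) (evar \<tau>)"
  let ?G = "\<lambda>v. ?C * evar (- v / 2) * Sprod v \<tau>"
  have "?G holomorphic_on UNIV"
    by (intro holomorphic_intros holomorphic_on_Sprod \<tau>) auto
  then have "(?G has_field_derivative deriv ?G 0) (at 0)"
    by (rule holomorphic_derivI) auto
  moreover have "((\<lambda>v. 1 - evar v) has_field_derivative - (2 * of_real pi * \<i>)) (at 0)"
    unfolding evar_def by (auto intro!: derivative_eq_intros)
  ultimately have "((\<lambda>v. (1 - evar v) * ?G v) has_field_derivative
      (1 - evar 0) * deriv ?G 0 + - (2 * of_real pi * \<i>) * ?G 0) (at 0)"
    by (rule DERIV_mult [rotated, THEN DERIV_cong]) simp
  then have "((\<lambda>v. theta v \<tau>) has_field_derivative - (2 * of_real pi * \<i>) * ?C * Sprod 0 \<tau>) (at 0)"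
    by (simp add: theta_eq [OF \<tau>] Tprod_eq_Sprod [OF \<tau>] mult_ac)
  then show ?thesis
    by (simp add: dtheta_def DERIV_imp_deriv)
qed

lemma dtheta_theta_0_nonzero: "Im \<tau> > 0 \<Longrightarrow> dtheta theta 0 \<tau> \<noteq> 0"
  using qpoch_nome_nonzero [of \<tau>] Sprod_0_nonzero [of \<tau>] by (simp add: dtheta_theta_0)

lemma theta_class_0_nonzero:
  assumes "theta_class th p r" "Im \<tau> > 0"
  shows "th 0 \<tau> \<noteq> 0"
  using assms Tprod_half_period_nonzero [OF assms(2), of p r] by (fastforce simp: theta_class_def)

lemma theta_class_holomorphic:
  assumes "theta_class th p r" "Im \<tau> > 0"
  shows "(\<lambda>v. th v \<tau>) holomorphic_on UNIV"
proof -
  obtain K where "\<And>v. th v \<tau> = K * evar (of_int (p - 1) * v / 2) * Tprod (v + half_period p r \<tau>) \<tau>"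
    using assms by (auto simp: theta_class_def)
  then show ?thesis
    using entire_family_Tprod [of p r] assms(2) by (auto simp: entire_family_def intro!: holomorphic_intros)
qed

section \<open>The common shape of the f functions and their logarithmic derivatives\<close>

definition theta_quotient :: "(complex \<Rightarrow> complex \<Rightarrow> complex) \<Rightarrow> complex \<Rightarrow> complex \<Rightarrow> complex" where
  "theta_quotient th z \<tau> = z * (dtheta theta 0 \<tau> / theta z \<tau>) * (th z \<tau> / th 0 \<tau>)"

lemma theta_quotient_eq:
  assumes th: "theta_class th p r" and \<tau>: "Im \<tau> > 0"
  shows "theta_quotient th z \<tau> = z * phi p r z \<tau>"
proof -
  obtain K where K: "K \<noteq> 0" "\<And>v. th v \<tau> = K * evar (of_int (p - 1) * v / 2) * Tprod (v + half_period p r \<tau>) \<tau>"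
    using assms by (auto simp: theta_class_def)
  \<comment> \<open>The second factor cancels the exponential of \<open>theta\<close>; this is the
    origin of p - 1 in \<open>theta_class\<close>.\<close>
  have e: "evar (of_int (p - 1) * z / 2) = evar (of_int p * z / 2) * evar (- z / 2)"
    by (simp add: evar_add [symmetric] field_simps)
  have alg: "z * (- c * C * s / (C * e * t)) * (K * (E * e) * u / (K * w)) = z * (- c * s * E * u / (t * w))"
    if "C \<noteq> 0" "e \<noteq> 0" "K \<noteq> 0" for c C s e t K E u w :: complex
    using that by (simp add: field_simps)
  show ?thesis
    unfolding theta_quotient_def dtheta_theta_0 [OF \<tau>] theta_eq [OF \<tau>] K(2) e phi_def
    using alg [of "\<i> * evar (\<tau> / 8) * qpoch (evar \<tau>) (evar \<tau>)" "evar (- z / 2)" K] K(1) qpoch_nome_nonzero [OF \<tau>]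
    by simp
qed

lemma theta_quotient_expansion:
  assumes "theta_class th p r" "Im \<tau> > 0"
  obtains h where "h has_fps_expansion theta_ser p r \<tau>" "\<forall>\<^sub>F z in at 0. theta_quotient th z \<tau> = h z"
  using theta_ser_expansion [OF assms(2), of p r] assms by (auto simp: theta_quotient_eq theta_class_def)

lemma power_series_theta_quotient:
  assumes "theta_class th p r" "Im \<tau> > 0"
  shows "power_series (\<lambda>z. theta_quotient th z \<tau>) = theta_ser p r \<tau>"
  using theta_quotient_expansion [OF assms] power_series_eqI by metis

lemma eventually_theta_nonzero:
  assumes "Im \<tau> > 0"
  shows "\<forall>\<^sub>F z in at 0. theta z \<tau> \<noteq> 0"
  using eventually_at_0_not_Lattice [OF assms]
  by eventually_elim
    (use qpoch_nome_nonzero [OF assms] in \<open>simp add: theta_eq [OF assms] Tprod_eq_0_iff [OF assms]\<close>)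

lemma eventually_theta_class_nonzero:
  assumes "theta_class th p r" "Im \<tau> > 0"
  shows "\<forall>\<^sub>F z in at 0. th z \<tau> \<noteq> 0"
proof -
  have "isCont (\<lambda>v. th v \<tau>) 0"
    using theta_class_holomorphic [OF assms]
    by (metis UNIV_I continuous_on_eq_continuous_at holomorphic_on_imp_continuous_on open_UNIV)
  then show ?thesis
    using theta_class_0_nonzero [OF assms] by (intro tendsto_imp_eventually_ne) (auto simp: isCont_def)
qed

text \<open>\<open>log_deriv_term\<close> is the logarithmic derivative of the theta quotient.\<close>
lemma power_series_log_deriv_term:
  assumes th: "theta_class th p r" and \<tau>: "Im \<tau> > 0"
  shows "power_series (\<lambda>z. log_deriv_term th z \<tau>) = fps_deriv (theta_ser p r \<tau>) * inverse (theta_ser p r \<tau>)"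
proof -
  obtain h where h: "h has_fps_expansion theta_ser p r \<tau>" "\<forall>\<^sub>F z in at 0. theta_quotient th z \<tau> = h z"
    using theta_quotient_expansion [OF assms] .
  have odd: "odd p \<or> odd r" using th by (simp add: theta_class_def)
  have exp: "(\<lambda>z. deriv h z * inverse (h z)) has_fps_expansion fps_deriv (theta_ser p r \<tau>) * inverse (theta_ser p r \<tau>)"
    using h(1) theta_ser_0 [OF \<tau> odd] by (intro fps_expansion_intros) auto
  obtain S where S: "open S" "0 \<in> S" "\<And>z. z \<in> S \<Longrightarrow> z \<noteq> 0 \<Longrightarrow> theta_quotient th z \<tau> = h z"
    using h(2) unfolding eventually_at_topological by auto
  have "\<forall>\<^sub>F z in at 0. z \<in> S - {0}"
    using S by (intro eventually_at_in_open)
  then have "\<forall>\<^sub>F z in at 0. log_deriv_term th z \<tau> = deriv h z * inverse (h z)"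
    using eventually_theta_nonzero [OF \<tau>] eventually_theta_class_nonzero [OF assms]
  proof eventually_elim
    case (elim z)
    \<comment> \<open>All factors independent of z, which cancel in the logarithmic
      derivative.\<close>
    define k where "k = dtheta theta 0 \<tau> / th 0 \<tau>"
    have k: "k \<noteq> 0"
      using dtheta_theta_0_nonzero [OF \<tau>] theta_class_0_nonzero [OF assms] by (simp add: k_def)
    have eq: "(\<lambda>z. theta_quotient th z \<tau>) = (\<lambda>z. k * (z * th z \<tau> / theta z \<tau>))"
      by (simp add: theta_quotient_def k_def fun_eq_iff mult_ac)
    have "(\<lambda>v. theta v \<tau>) holomorphic_on UNIV"
      unfolding theta_eq [OF \<tau>] by (intro holomorphic_intros holomorphic_on_Tprod \<tau>) auto
    then have D: "((\<lambda>v. theta v \<tau>) has_field_derivative dtheta theta z \<tau>) (at z)"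
      unfolding dtheta_def by (rule holomorphic_derivI) auto
    have D': "((\<lambda>v. th v \<tau>) has_field_derivative dtheta th z \<tau>) (at z)"
      unfolding dtheta_def by (rule holomorphic_derivI [OF theta_class_holomorphic [OF assms]]) auto
    have "((\<lambda>z. theta_quotient th z \<tau>) has_field_derivative
        k * (((1 * th z \<tau> + dtheta th z \<tau> * z) * theta z \<tau> - (z * th z \<tau>) * dtheta theta z \<tau>) / (theta z \<tau> * theta z \<tau>))) (at z)"
      unfolding eq by (intro DERIV_cmult DERIV_divide DERIV_mult D D' DERIV_ident) (use elim in auto)
    moreover have "deriv (\<lambda>z. theta_quotient th z \<tau>) z = deriv h z"
    proof (rule deriv_cong_ev)
      have "\<forall>\<^sub>F w in nhds z. w \<in> S - {0}"
        using elim S(1) by (intro eventually_nhds_in_open) auto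
      then show "\<forall>\<^sub>F w in nhds z. theta_quotient th w \<tau> = h w"
        by eventually_elim (use S(3) in auto)
    qed simp
    ultimately have "deriv h z =
        k * (((1 * th z \<tau> + dtheta th z \<tau> * z) * theta z \<tau> - (z * th z \<tau>) * dtheta theta z \<tau>) / (theta z \<tau> * theta z \<tau>))"
      using DERIV_imp_deriv by metis
    moreover have "h z = k * (z * th z \<tau> / theta z \<tau>)"
      using S(3) [of z] elim eq by (metis Diff_iff singletonI)
    moreover have "1 / z - T' / T + u' / u = k * (((1 * u + u' * z) * T - (z * u) * T') / (T * T)) * inverse (k * (z * u / T))"
      if "z \<noteq> 0" "T \<noteq> 0" "u \<noteq> 0" for T T' u u' :: complex
      using that k by (simp add: field_simps)
    ultimately show ?case
      using elim by (simp add: log_deriv_term_def)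
  qed
  with exp show ?thesis by (rule power_series_eqI)
qed

text \<open>Replacing each ratio \<open>th z / th 0\<close> by a theta quotient introduces a factor
  z \<theta>'(0) / \<theta>(z), twice in the numerator and twice in the denominator, so these
  factors cancel.\<close>

lemma power_series_h:
  assumes th: "theta_class th p r" "theta_class th' p' r'" "theta_class th'' p'' r''" and \<tau>: "Im \<tau> > 0"
  shows "power_series (\<lambda>z. ((th 0 \<tau>)\<^sup>2 / (th z \<tau>)\<^sup>2) * (th' z \<tau> / th' 0 \<tau>) * (th'' z \<tau> / th'' 0 \<tau>))
    = theta_ser p' r' \<tau> * theta_ser p'' r'' \<tau> * inverse ((theta_ser p r \<tau>)\<^sup>2)"
proof -
  obtain h where h: "h has_fps_expansion theta_ser p r \<tau>" "\<forall>\<^sub>F z in at 0. theta_quotient th z \<tau> = h z"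
    using theta_quotient_expansion [OF th(1) \<tau>] .
  obtain h' where h': "h' has_fps_expansion theta_ser p' r' \<tau>" "\<forall>\<^sub>F z in at 0. theta_quotient th' z \<tau> = h' z"
    using theta_quotient_expansion [OF th(2) \<tau>] .
  obtain h'' where h'': "h'' has_fps_expansion theta_ser p'' r'' \<tau>" "\<forall>\<^sub>F z in at 0. theta_quotient th'' z \<tau> = h'' z"
    using theta_quotient_expansion [OF th(3) \<tau>] .
  have odd: "odd p \<or> odd r" using th(1) by (simp add: theta_class_def)
  have exp: "(\<lambda>z. h' z * h'' z * inverse ((h z)\<^sup>2)) has_fps_expansion theta_ser p' r' \<tau> * theta_ser p'' r'' \<tau> * inverse ((theta_ser p r \<tau>)\<^sup>2)"
    using h(1) h'(1) h''(1) theta_ser_0 [OF \<tau> odd]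
    by (intro has_fps_expansion_mult has_fps_expansion_inverse has_fps_expansion_power) auto
  have "\<forall>\<^sub>F z in at (0::complex). z \<noteq> 0"
    by (simp add: eventually_at_filter)
  then have "\<forall>\<^sub>F z in at 0. ((th 0 \<tau>)\<^sup>2 / (th z \<tau>)\<^sup>2) * (th' z \<tau> / th' 0 \<tau>) * (th'' z \<tau> / th'' 0 \<tau>) = h' z * h'' z * inverse ((h z)\<^sup>2)"
    using h(2) h'(2) h''(2) eventually_theta_nonzero [OF \<tau>] eventually_theta_class_nonzero [OF th(1) \<tau>]
  proof eventually_elim
    case (elim z)
    have "(a\<^sup>2 / b\<^sup>2) * B * C = (z * (d / T) * B) * (z * (d / T) * C) * inverse ((z * (d / T) * (b / a))\<^sup>2)"
      if "a \<noteq> 0" "b \<noteq> 0" "d \<noteq> 0" "T \<noteq> 0" for a b d T B C :: complex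
      using that elim by (simp add: field_simps power2_eq_square)
    then show ?case
      using elim dtheta_theta_0_nonzero [OF \<tau>] theta_class_0_nonzero [OF th(1) \<tau>]
      unfolding elim(2-4) [symmetric] theta_quotient_def by blast
  qed
  with exp show ?thesis by (rule power_series_eqI)
qed

section \<open>Transgressed forms\<close>

lemma homogeneous_curv_form: "homogeneous 2 (curv_form A D F x a b)"
  by (auto simp: homogeneous_def curv_form_def split: list.splits)

lemma homogeneous_diff_form: "homogeneous 1 (diff_form D0 D1 F x a b)"
  by (auto simp: homogeneous_def diff_form_def split: list.splits)

lemma wedge_const_mult_left: "wedge (\<lambda>Xs. c * \<alpha> Xs) \<beta> Xs = c * wedge \<alpha> \<beta> Xs"
  by (simp add: wedge_def sum_distrib_left mult_ac)

lemma wedge_const_mult_right: "wedge \<alpha> (\<lambda>Xs. c * \<beta> Xs) Xs = c * wedge \<alpha> \<beta> Xs"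
  by (simp add: wedge_def sum_distrib_left mult_ac)

text \<open>The integral common to the three forms, without scalar constants. One series
  \<open>F\<close> governs both the determinant and, through its logarithmic derivative, the
  trace.\<close>

definition transgression ::
    "(real \<Rightarrow> ('n::finite, 'x) mat_form) \<Rightarrow> ('r::finite, 'x) mat_form \<Rightarrow> ('n, 'x) mat_form
      \<Rightarrow> complex fps \<Rightarrow> complex fps \<Rightarrow> 'x form" where
  "transgression P Q B F H = (\<lambda>Xs. integral {0..1} (\<lambda>t.
     wedge (wedge (sqrt_det F (P t)) (sqrt_det H Q))
       (mat_trace (mat_wedge B (mat_eval (fps_deriv F * inverse F) (P t)))) Xs))"

lemma mat_trace_mat_wedge_const_mult:
  "mat_trace (mat_wedge B (mat_eval (fps_const c * L) P)) = (\<lambda>Xs. c * mat_trace (mat_wedge B (mat_eval L P)) Xs)"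
proof -
  have "mat_eval (fps_const c * L) P = (\<lambda>a b Xs. c * mat_eval L P a b Xs)"
    by (simp add: mat_eval_def sum_distrib_left mult_ac)
  then show ?thesis
    by (simp add: mat_trace_def mat_wedge_def wedge_const_mult_right sum_distrib_left)
qed

text \<open>The forms contribute \<open>c\<close> to the half degree; the derivative of
  \<open>F\<close> contributes one further factor by the chain rule.\<close>

lemma transgression_scale:
  fixes P :: "real \<Rightarrow> ('n::finite, 'x) mat_form" and Q :: "('r::finite, 'x) mat_form"
  assumes P: "\<And>t a b. homogeneous 2 (P t a b)" and Q: "\<And>a b. homogeneous 2 (Q a b)"
    and B: "\<And>a b. homogeneous 1 (B a b)" and F: "fps_nth F 0 = 1" and H: "fps_nth H 0 = 1"
  shows "transgression P Q B (fps_scale c F) (fps_scale c H) Xs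
    = c ^ Suc (length Xs div 2) * transgression P Q B F H Xs"
proof -
  let ?L = "fps_deriv F * inverse F"
  have L: "fps_deriv (fps_scale c F) * inverse (fps_scale c F) = fps_const c * fps_scale c ?L"
    using F by (simp add: fps_scale_deriv fps_scale_mult fps_scale_inverse mult.assoc)
  have "wedge (wedge (sqrt_det (fps_scale c F) (P t)) (sqrt_det (fps_scale c H) Q))
       (mat_trace (mat_wedge B (mat_eval (fps_const c * fps_scale c ?L) (P t)))) Xs
     = c ^ Suc (length Xs div 2) * wedge (wedge (sqrt_det F (P t)) (sqrt_det H Q))
       (mat_trace (mat_wedge B (mat_eval ?L (P t)))) Xs" for t
  proof -
    let ?\<alpha> = "wedge (sqrt_det F (P t)) (sqrt_det H Q)" and ?\<beta> = "mat_trace (mat_wedge B (mat_eval ?L (P t)))"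
    have ev: "even_form (sqrt_det F (P t))" "even_form (sqrt_det H Q)"
      by (intro even_form_sqrt_det P Q)+
    have "wedge (wedge (sqrt_det (fps_scale c F) (P t)) (sqrt_det (fps_scale c H) Q))
       (mat_trace (mat_wedge B (mat_eval (fps_const c * fps_scale c ?L) (P t)))) Xs
     = wedge (scale_form c ?\<alpha>) (\<lambda>Xs. c * scale_form c ?\<beta> Xs) Xs"
      by (simp only: sqrt_det_scale [OF P F] sqrt_det_scale [OF Q H] wedge_scale_form [OF ev(1)]
          mat_trace_mat_wedge_const_mult trace_wedge_scale [OF P B])
    also have "\<dots> = c * wedge (scale_form c ?\<alpha>) (scale_form c ?\<beta>) Xs"
      by (rule wedge_const_mult_right)
    also have "\<dots> = c * scale_form c (wedge ?\<alpha> ?\<beta>) Xs"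
      by (simp only: wedge_scale_form [OF even_form_wedge [OF ev]])
    finally show ?thesis by (simp add: scale_form_def mult.assoc)
  qed
  then show ?thesis by (simp add: transgression_def L)
qed

lemma transgression_holomorphic:
  assumes F: "holomorphic_coeffs F" "\<And>\<tau>. Im \<tau> > 0 \<Longrightarrow> fps_nth (F \<tau>) 0 = 1"
    and H: "holomorphic_coeffs H" "\<And>\<tau>. Im \<tau> > 0 \<Longrightarrow> fps_nth (H \<tau>) 0 = 1"
    and P: "\<And>a b. separated_on S (\<lambda>\<tau> t. P t a b)" and Q: "\<And>a b. separated_on S (\<lambda>\<tau> t. Q a b)"
    and B: "\<And>a b. separated_on S (\<lambda>\<tau> t. B a b)" and Xs: "set Xs \<subseteq> S"
  shows "(\<lambda>\<tau>. transgression P Q B (F \<tau>) (H \<tau>) Xs) holomorphic_on upper_half"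
proof -
  have "holomorphic_coeffs (\<lambda>\<tau>. fps_deriv (F \<tau>) * inverse (F \<tau>))"
    using F by (intro holomorphic_coeffs_mult holomorphic_coeffs_deriv holomorphic_coeffs_inverse) auto
  then have "separated_on S (\<lambda>\<tau> t. wedge (wedge (sqrt_det (F \<tau>) (P t)) (sqrt_det (H \<tau>) Q))
       (mat_trace (mat_wedge B (mat_eval (fps_deriv (F \<tau>) * inverse (F \<tau>)) (P t)))))"
    by (intro separated_on_wedge separated_on_sqrt_det separated_on_mat_trace separated_on_mat_wedge
        separated_on_mat_eval F H P Q B)
  from separated_integral_holomorphic [OF separated_onD [OF this Xs], of 0 1] show ?thesis
    by (simp add: transgression_def)
qed

section \<open>Modularity\<close>

lemma mat_1_SL2Z: "(mat 1 :: int^2^2) \<in> SL2Z"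
  by (simp add: SL2Z_def)

text \<open>\<open>theta_ser_moebius\<close> for the identity matrix: it constrains the new
  characteristic modulo 2 only.\<close>

lemma theta_ser_parity:
  assumes "Im \<tau> > 0" "odd p \<or> odd r" "even (p' - p)" "even (r' - r)"
  shows "theta_ser p r \<tau> = theta_ser p' r' \<tau>"
proof -
  have "odd p' \<or> odd r'" using assms by auto
  then have "theta_ser p r (moebius_act (mat 1) \<tau>) = fps_scale (aut_factor (mat 1) \<tau>) (theta_ser p' r' \<tau>)"
    using assms by (intro theta_ser_moebius mat_1_SL2Z) (auto simp: mat_def)
  then show ?thesis by (simp add: moebius_act_def aut_factor_def mat_def)
qed

lemma theta_ser_mod_2:
  assumes "Im \<tau> > 0" "odd p \<or> odd r"
  shows "theta_ser p r \<tau> = theta_ser (if even p then 0 else 1) (if even r then 0 else 1) \<tau>"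
  using assms by (intro theta_ser_parity) auto

definition theta_ser_total :: "complex \<Rightarrow> complex fps" where
  "theta_ser_total \<tau> = theta_ser 0 1 \<tau> * theta_ser 1 0 \<tau> * theta_ser 1 1 \<tau>"

text \<open>The modular group permutes the three characteristics.\<close>
lemma theta_ser_total_moebius:
  assumes g: "g \<in> SL2Z" and \<tau>: "Im \<tau> > 0"
  shows "theta_ser_total (moebius_act g \<tau>) = fps_scale (aut_factor g \<tau>) (theta_ser_total \<tau>)"
proof -
  define a b c d where "a = g $ 1 $ 1" and "b = g $ 1 $ 2" and "c = g $ 2 $ 1" and "d = g $ 2 $ 2"
  note abcd = a_def b_def c_def d_def
  have "a * d - b * c = 1" using SL2Z_det [OF g] by (simp add: abcd)
  then have "odd (a * d - b * c)" by simp
  \<comment> \<open>Invertibility of g modulo 2: the two rows and their sum are the three nonzero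
    vectors modulo 2 in some order.\<close>
  then have par: "odd (a * d) \<and> even (b * c) \<or> even (a * d) \<and> odd (b * c)" by auto
  have "theta_ser 0 1 (moebius_act g \<tau>) = fps_scale (aut_factor g \<tau>) (theta_ser c d \<tau>)"
    "theta_ser 1 0 (moebius_act g \<tau>) = fps_scale (aut_factor g \<tau>) (theta_ser a b \<tau>)"
    "theta_ser 1 1 (moebius_act g \<tau>) = fps_scale (aut_factor g \<tau>) (theta_ser (a + c) (b + d) \<tau>)"
    using par by (auto intro!: theta_ser_moebius [OF g \<tau>] simp: abcd)
  then have "theta_ser_total (moebius_act g \<tau>)
      = fps_scale (aut_factor g \<tau>) (theta_ser c d \<tau> * theta_ser a b \<tau> * theta_ser (a + c) (b + d) \<tau>)"
    by (simp add: theta_ser_total_def fps_scale_mult)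
  also have "theta_ser c d \<tau> * theta_ser a b \<tau> * theta_ser (a + c) (b + d) \<tau> = theta_ser_total \<tau>"
    using par theta_ser_mod_2 [OF \<tau>, of c d] theta_ser_mod_2 [OF \<tau>, of a b] theta_ser_mod_2 [OF \<tau>, of "a + c" "b + d"]
    by (auto simp: theta_ser_total_def mult_ac)
  finally show ?thesis .
qed

lemma theta_ser_total_0: "Im \<tau> > 0 \<Longrightarrow> fps_nth (theta_ser_total \<tau>) 0 = 1"
  by (simp add: theta_ser_total_def theta_ser_0)

lemma holomorphic_coeffs_theta_ser_total: "holomorphic_coeffs theta_ser_total"
  unfolding theta_ser_total_def [abs_def] by (intro holomorphic_coeffs_mult holomorphic_coeffs_theta_ser) auto

text \<open>In an h function one theta ratio occurs with exponent -2 and the other two with exponent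
  1. Writing this as the total product over a cube isolates a factor on which the whole modular
  group acts by rescaling.\<close>

definition theta_ser_h :: "int \<Rightarrow> int \<Rightarrow> complex \<Rightarrow> complex fps" where
  "theta_ser_h p r \<tau> = theta_ser_total \<tau> * inverse (theta_ser p r \<tau>) ^ 3"

lemma theta_ser_h_0: "Im \<tau> > 0 \<Longrightarrow> odd p \<or> odd r \<Longrightarrow> fps_nth (theta_ser_h p r \<tau>) 0 = 1"
  by (simp add: theta_ser_h_def theta_ser_total_0 theta_ser_0 fps_power_zeroth)

lemma holomorphic_coeffs_theta_ser_h:
  "odd p \<or> odd r \<Longrightarrow> holomorphic_coeffs (theta_ser_h p r)"
  unfolding theta_ser_h_def [abs_def]
  by (intro holomorphic_coeffs_mult holomorphic_coeffs_theta_ser_total holomorphic_coeffs_power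
      holomorphic_coeffs_inverse holomorphic_coeffs_theta_ser) (simp_all add: theta_ser_0)

lemma theta_ser_h_moebius:
  assumes g: "g \<in> SL2Z" and \<tau>: "Im \<tau> > 0"
    and p': "even (p' - (p * g $ 1 $ 1 + r * g $ 2 $ 1))" and r': "even (r' - (p * g $ 1 $ 2 + r * g $ 2 $ 2))"
    and odd: "odd p \<or> odd r" "odd p' \<or> odd r'"
  shows "theta_ser_h p r (moebius_act g \<tau>) = fps_scale (aut_factor g \<tau>) (theta_ser_h p' r' \<tau>)"
  using theta_ser_0 [OF \<tau> odd(2)]
  by (simp add: theta_ser_h_def theta_ser_total_moebius [OF g \<tau>] theta_ser_moebius [OF assms] fps_scale_mult fps_scale_power fps_scale_inverse)

lemma theta_ser_h_eq:
  assumes "Im \<tau> > 0" "odd p \<or> odd r" "theta_ser_total \<tau> = theta_ser p r \<tau> * (E * E')"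
  shows "E * E' * inverse ((theta_ser p r \<tau>)\<^sup>2) = theta_ser_h p r \<tau>"
proof -
  have "inverse (theta_ser p r \<tau>) * theta_ser p r \<tau> = 1"
    using theta_ser_0 [OF assms(1,2)] by (intro inverse_mult_eq_1) simp
  then have "theta_ser p r \<tau> * (E * E') * inverse (theta_ser p r \<tau>) ^ 3 = E * E' * inverse (theta_ser p r \<tau>) ^ 2"
    by (simp add: power3_eq_cube power2_eq_square algebra_simps)
  then show ?thesis
    by (simp only: theta_ser_h_def assms(3) fps_inverse_power)
qed

section \<open>Series of the six characteristic functions\<close>

lemma power_series_f_L: "Im \<tau> > 0 \<Longrightarrow> power_series (\<lambda>z. f_L z \<tau>) = theta_ser 0 1 \<tau>"
  using power_series_theta_quotient [OF theta_class_theta1] by (simp add: f_L_def theta_quotient_def)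

lemma power_series_f_W: "Im \<tau> > 0 \<Longrightarrow> power_series (\<lambda>z. f_W z \<tau>) = theta_ser 1 0 \<tau>"
  using power_series_theta_quotient [OF theta_class_theta2] by (simp add: f_W_def theta_quotient_def)

lemma power_series_f_W': "Im \<tau> > 0 \<Longrightarrow> power_series (\<lambda>z. f_W' z \<tau>) = theta_ser 1 1 \<tau>"
  using power_series_theta_quotient [OF theta_class_theta3] by (simp add: f_W'_def theta_quotient_def)

lemma power_series_h_L: "Im \<tau> > 0 \<Longrightarrow> power_series (\<lambda>z. h_L z \<tau>) = theta_ser_h 0 1 \<tau>"
  unfolding h_L_def power_series_h [OF theta_class_theta1 theta_class_theta3 theta_class_theta2]
  by (intro theta_ser_h_eq) (simp_all add: theta_ser_total_def mult_ac)

lemma power_series_h_W: "Im \<tau> > 0 \<Longrightarrow> power_series (\<lambda>z. h_W z \<tau>) = theta_ser_h 1 0 \<tau>"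
  unfolding h_W_def power_series_h [OF theta_class_theta2 theta_class_theta3 theta_class_theta1]
  by (intro theta_ser_h_eq) (simp_all add: theta_ser_total_def mult_ac)

lemma power_series_h_W': "Im \<tau> > 0 \<Longrightarrow> power_series (\<lambda>z. h_W' z \<tau>) = theta_ser_h 1 1 \<tau>"
  unfolding h_W'_def power_series_h [OF theta_class_theta3 theta_class_theta1 theta_class_theta2]
  by (intro theta_ser_h_eq) (simp_all add: theta_ser_total_def mult_ac)

text \<open>The three transgressed forms are constant multiples of the cases (0, 1), (1, 0) and (1,
  1).\<close>

definition CS_char ::
    "('m::{t2_space, second_countable_topology}, 'n::finite) chart set
      \<Rightarrow> ('m, 'm tvec, 'n) frame \<Rightarrow> ('m, 'v::real_vector, 'r::finite) frame \<Rightarrow> 'm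
      \<Rightarrow> ('m, 'm tvec) connection_op \<Rightarrow> ('m, 'm tvec) connection_op \<Rightarrow> ('m, 'v) connection_op
      \<Rightarrow> int \<Rightarrow> int \<Rightarrow> complex \<Rightarrow> 'm vfield form" where
  "CS_char A F G x D0 D1 D\<xi> p r \<tau> = transgression (\<lambda>t. curv_form A (connection_path D0 D1 t) F x)
     (curv_form A D\<xi> G x) (diff_form D0 D1 F x) (theta_ser p r \<tau>) (theta_ser_h p r \<tau>)"

text \<open>The outer sqrt 2 completes (sqrt 2)^(4k - 1) to (sqrt 2)^(4k) = 2^(2k); k \<ge> 1 keeps
  the natural subtraction honest.\<close>

lemma CS_Phi_L_eq:
  assumes "Im \<tau> > 0" "k \<ge> 1"
  shows "CS_Phi_L A F G x k D0 D1 D\<xi> \<tau> Xs = 2 ^ (2 * k) / (8 * of_real pi ^ 2) * CS_char A F G x D0 D1 D\<xi> 0 1 \<tau> Xs"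
proof -
  have "complex_of_real (sqrt 2) * of_real (sqrt 2) ^ (4 * k - 1) = of_real (sqrt 2) ^ (4 * k)"
    using assms(2) by (metis One_nat_def mult_eq_if not_one_le_zero power_eq_if zero_neq_numeral mult_is_0)
  also have "\<dots> = (of_real (sqrt 2) ^ 2) ^ (2 * k)"
    by (simp add: power_mult [symmetric])
  also have "\<dots> = 2 ^ (2 * k)"
    by (simp flip: of_real_power)
  finally have "complex_of_real (sqrt 2) * (of_real (sqrt 2) ^ (4 * k - 1) * u) = 2 ^ (2 * k) * u" for u
    by (metis mult.assoc)
  then show ?thesis
    using assms(1)
    by (simp add: CS_Phi_L_def Phi_L_def trace_term_def CS_char_def transgression_def wedge_const_mult_left
        power_series_f_L power_series_h_L power_series_log_deriv_term [OF theta_class_theta1])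
qed

lemma CS_Phi_W_eq:
  assumes "Im \<tau> > 0"
  shows "CS_Phi_W A F G x D0 D1 D\<xi> \<tau> Xs = 1 / (8 * of_real pi ^ 2) * CS_char A F G x D0 D1 D\<xi> 1 0 \<tau> Xs"
  using assms
  by (simp add: CS_Phi_W_def Phi_W_def trace_term_def CS_char_def transgression_def
      power_series_f_W power_series_h_W power_series_log_deriv_term [OF theta_class_theta2])

lemma CS_Phi_W'_eq:
  assumes "Im \<tau> > 0"
  shows "CS_Phi_W' A F G x D0 D1 D\<xi> \<tau> Xs = 1 / (8 * of_real pi ^ 2) * CS_char A F G x D0 D1 D\<xi> 1 1 \<tau> Xs"
  using assms
  by (simp add: CS_Phi_W'_def Phi_W'_def trace_term_def CS_char_def transgression_def
      power_series_f_W' power_series_h_W' power_series_log_deriv_term [OF theta_class_theta3])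

section \<open>Modularity and holomorphy of the coefficients\<close>

lemma CS_char_moebius:
  assumes "g \<in> SL2Z" "Im \<tau> > 0"
    and "even (p' - (p * g $ 1 $ 1 + r * g $ 2 $ 1))" "even (r' - (p * g $ 1 $ 2 + r * g $ 2 $ 2))"
    and "odd p \<or> odd r" "odd p' \<or> odd r'"
  shows "CS_char A F G x D0 D1 D\<xi> p r (moebius_act g \<tau>) Xs
    = aut_factor g \<tau> ^ Suc (length Xs div 2) * CS_char A F G x D0 D1 D\<xi> p' r' \<tau> Xs"
  unfolding CS_char_def theta_ser_moebius [OF assms] theta_ser_h_moebius [OF assms]
  by (intro transgression_scale homogeneous_curv_form homogeneous_diff_form theta_ser_0 theta_ser_h_0 assms)

lemma CS_char_holomorphic:
  assumes atlas: "smooth_atlas A" and D: "connection A (tangent_bundle A) D0" "connection A (tangent_bundle A) D1"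
    and mem: "(F, G, x, Xs) \<in> form_coeffs A E" and odd: "odd p \<or> odd r"
  shows "(\<lambda>\<tau>. CS_char A F G x D0 D1 D\<xi> p r \<tau> Xs) holomorphic_on upper_half"
proof -
  obtain W where F: "F \<in> frames (tangent_bundle A)" and W: "open W" "x \<in> W" "W \<subseteq> fdom F"
    and Xs: "set Xs \<subseteq> {X. smooth_vfield A W X}"
    using mem by (auto simp: form_coeffs_def)
  let ?S = "{X. smooth_vfield A W X}"
  \<comment> \<open>For the curvature of \<xi> and the difference of the connections, which depend
    neither on \<tau> nor on t.\<close>
  have const: "separated_on ?S (\<lambda>\<tau> t. \<omega>)" for \<omega>
    by (simp add: separated_on_def separated_const)
  have "separated_on ?S (\<lambda>\<tau> t. curv_form A (connection_path D0 D1 t) F x a b)" for a b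
    unfolding separated_on_def
  proof (intro allI impI separated_cont)
    fix Ys assume Ys: "set Ys \<subseteq> ?S"
    show "continuous_on UNIV (\<lambda>t. curv_form A (connection_path D0 D1 t) F x a b Ys)"
    proof (cases "length Ys = 2")
      case True
      then obtain X Y where "Ys = [X, Y]" by (auto simp: length_Suc_conv numeral_2_eq_2)
      moreover have "smooth_vfield A W X" "smooth_vfield A W Y" using Ys calculation by auto
      ultimately show ?thesis
        using continuous_curvature_path [OF atlas D F W, of X Y a b]
        by (simp add: curv_form_def) (intro continuous_intros, auto)
    next
      case False
      then have "curv_form A (connection_path D0 D1 t) F x a b Ys = 0" for t
        using homogeneous_curv_form by (fastforce simp: homogeneous_def)
      then show ?thesis by simp
    qed
  qed
  then show ?thesis
    unfolding CS_char_def
    by (intro transgression_holomorphic [OF _ _ _ _ _ const const Xs] holomorphic_coeffs_theta_ser holomorphic_coeffs_theta_ser_h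
        theta_ser_0 theta_ser_h_0 odd)
qed

text \<open>4k - 1 = 2 (2k - 1) + 1, so the half degree is 2k - 1 and the successor gives the
  weight.\<close>

lemma Suc_half_degree: "k \<ge> 1 \<Longrightarrow> n = 4 * k - 1 \<Longrightarrow> Suc (n div 2) = 2 * k"
  by linarith

text \<open>The parity conditions say that \<Gamma> stabilizes (p, r) modulo 2, so each coefficient
  is carried to itself with trivial character. The formula for \<open>f\<close> is asked on the
  upper half plane only, where the theta products converge.\<close>

lemma modular_form_CS_char:
  assumes "smooth_atlas A" "connection A (tangent_bundle A) D0" "connection A (tangent_bundle A) D1" and k: "k \<ge> 1"
    and odd: "odd p \<or> odd r"
    and f: "\<And>\<tau> F G x Xs. Im \<tau> > 0 \<Longrightarrow> f \<tau> (F, G, x, Xs) =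
      (if length Xs = 4 * k - 1 then K * CS_char A F G x D0 D1 D\<xi> p r \<tau> Xs else 0)"
    and \<Gamma>: "\<Gamma> \<subseteq> SL2Z" "\<And>g. g \<in> \<Gamma> \<Longrightarrow> even (p - (p * g $ 1 $ 1 + r * g $ 2 $ 1))"
      "\<And>g. g \<in> \<Gamma> \<Longrightarrow> even (r - (p * g $ 1 $ 2 + r * g $ 2 $ 2))"
  shows "modular_form (2 * int k) \<Gamma> (form_coeffs A E) f"
  unfolding modular_form_def
proof (intro conjI ballI exI [of _ "\<lambda>_. 1"] allI impI)
  show "character \<Gamma> (\<lambda>_. 1)" by (simp add: character_def)
  fix i assume i: "i \<in> form_coeffs A E"
  obtain F G x Xs where i_eq: "i = (F, G, x, Xs)" by (cases i)
  have "(\<lambda>\<tau>. f \<tau> i) holomorphic_on upper_half \<longleftrightarrow>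
      (\<lambda>\<tau>. if length Xs = 4 * k - 1 then K * CS_char A F G x D0 D1 D\<xi> p r \<tau> Xs else 0) holomorphic_on upper_half"
    by (intro holomorphic_cong) (simp_all add: i_eq f)
  then show "(\<lambda>\<tau>. f \<tau> i) holomorphic_on upper_half"
    using CS_char_holomorphic [OF assms(1-3) i [unfolded i_eq] odd, of D\<xi>]
    by (cases "length Xs = 4 * k - 1") (auto intro!: holomorphic_intros)
  fix g \<tau> assume g: "g \<in> \<Gamma>" and \<tau>: "Im \<tau> > 0"
  have "g \<in> SL2Z" using g \<Gamma>(1) by blast
  then have "CS_char A F G x D0 D1 D\<xi> p r (moebius_act g \<tau>) Xs = aut_factor g \<tau> ^ (2 * k) * CS_char A F G x D0 D1 D\<xi> p r \<tau> Xs"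
    if "length Xs = 4 * k - 1"
    using CS_char_moebius [OF _ \<tau> \<Gamma>(2,3) [OF g] odd odd, of A F G x D0 D1 D\<xi> Xs] Suc_half_degree [OF k that] by (simp del: power_Suc)
  moreover have "aut_factor g \<tau> powi (2 * int k) = aut_factor g \<tau> ^ (2 * k)"
    by (metis of_nat_mult of_nat_numeral power_int_of_nat)
  ultimately show "f (moebius_act g \<tau>) i = 1 * aut_factor g \<tau> powi (2 * int k) * f \<tau> i"
    using \<tau> Im_moebius_act [OF \<open>g \<in> SL2Z\<close> \<tau>] by (simp add: i_eq f)
qed

section \<open>The inversion and the translation\<close>

definition S_mat :: "int^2^2" where
  "S_mat = vector [vector [0, - 1], vector [1, 0]]"

definition T_mat :: "int^2^2" where
  "T_mat = vector [vector [1, 1], vector [0, 1]]"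

lemma S_mat_simps [simp]: "S_mat $ 1 $ 1 = 0" "S_mat $ 1 $ 2 = - 1" "S_mat $ 2 $ 1 = 1" "S_mat $ 2 $ 2 = 0"
  by (simp_all add: S_mat_def vector_2)

lemma T_mat_simps [simp]: "T_mat $ 1 $ 1 = 1" "T_mat $ 1 $ 2 = 1" "T_mat $ 2 $ 1 = 0" "T_mat $ 2 $ 2 = 1"
  by (simp_all add: T_mat_def vector_2)

lemma S_mat_SL2Z: "S_mat \<in> SL2Z" and T_mat_SL2Z: "T_mat \<in> SL2Z"
  by (simp_all add: SL2Z_def det_2)

theorem theorem3p2:
  fixes A :: "('m::{t2_space, second_countable_topology}, 'n::finite) chart set"
    and \<xi> :: "('m, 'v::real_vector, 2) vbundle"
    and k :: nat
    and gTM :: "'m \<Rightarrow> 'm tvec \<Rightarrow> 'm tvec \<Rightarrow> real"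
    and g\<xi> :: "'m \<Rightarrow> 'v \<Rightarrow> 'v \<Rightarrow> real"
    and D0 D1 :: "('m, 'm tvec) connection_op"
    and D\<xi> :: "('m, 'v) connection_op"
  assumes "k \<ge> 1"
    and "smooth_atlas A"
    and "CARD('n) = 4 * k - 1"
    and "bundle_metric A (tangent_bundle A) gTM"
    and "connection A (tangent_bundle A) D0"
    and "connection A (tangent_bundle A) D1"
    and "oriented_vector_bundle A \<xi>"
    and "bundle_metric A \<xi> g\<xi>"
    and "metric_connection A \<xi> g\<xi> D\<xi>"
  shows
    "modular_form (2 * int k) Gamma_lower_2 (form_coeffs A \<xi>)
       (\<lambda>\<tau> (F, G, x, Xs). degree_part (4 * k - 1) (CS_Phi_L A F G x k D0 D1 D\<xi> \<tau>) Xs)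
     \<and> modular_form (2 * int k) Gamma_upper_2 (form_coeffs A \<xi>)
       (\<lambda>\<tau> (F, G, x, Xs). degree_part (4 * k - 1) (CS_Phi_W A F G x D0 D1 D\<xi> \<tau>) Xs)
     \<and> modular_form (2 * int k) Gamma_theta (form_coeffs A \<xi>)
       (\<lambda>\<tau> (F, G, x, Xs). degree_part (4 * k - 1) (CS_Phi_W' A F G x D0 D1 D\<xi> \<tau>) Xs)
     \<and> (\<forall>\<tau>. Im \<tau> > 0 \<longrightarrow> (\<forall>(F, G, x, Xs) \<in> form_coeffs A \<xi>.
          degree_part (4 * k - 1) (CS_Phi_L A F G x k D0 D1 D\<xi> (- 1 / \<tau>)) Xs
            = (2 * \<tau>) ^ (2 * k) * degree_part (4 * k - 1) (CS_Phi_W A F G x D0 D1 D\<xi> \<tau>) Xs))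
     \<and> (\<forall>\<tau>. Im \<tau> > 0 \<longrightarrow> (\<forall>(F, G, x, Xs) \<in> form_coeffs A \<xi>.
          CS_Phi_W A F G x D0 D1 D\<xi> (\<tau> + 1) Xs = CS_Phi_W' A F G x D0 D1 D\<xi> \<tau> Xs))"
proof (intro conjI allI impI ballI)
  note mf = modular_form_CS_char [OF assms(2,5,6,1)]
  have odd_det: "odd (g $ 1 $ 1 * g $ 2 $ 2 - g $ 1 $ 2 * g $ 2 $ 1)" if "g \<in> SL2Z" for g
    using SL2Z_det [OF that] by simp
  show "modular_form (2 * int k) Gamma_lower_2 (form_coeffs A \<xi>)
       (\<lambda>\<tau> (F, G, x, Xs). degree_part (4 * k - 1) (CS_Phi_L A F G x k D0 D1 D\<xi> \<tau>) Xs)"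
    \<comment> \<open>(0, 1) times g is the lower row (c, d): c is even, so the odd determinant
      makes d odd.\<close>
    by (rule mf [where p = 0 and r = 1 and K = "2 ^ (2 * k) / (8 * of_real pi ^ 2)"])
      (use odd_det in \<open>auto simp: degree_part_def CS_Phi_L_eq [OF _ assms(1)] Gamma_lower_2_def\<close>)
  show "modular_form (2 * int k) Gamma_upper_2 (form_coeffs A \<xi>)
       (\<lambda>\<tau> (F, G, x, Xs). degree_part (4 * k - 1) (CS_Phi_W A F G x D0 D1 D\<xi> \<tau>) Xs)"
    \<comment> \<open>(1, 0) times g is the upper row (a, b): b is even, so a is odd.\<close>
    by (rule mf [where p = 1 and r = 0 and K = "1 / (8 * of_real pi ^ 2)"])
      (use odd_det in \<open>auto simp: degree_part_def CS_Phi_W_eq Gamma_upper_2_def\<close>)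
  show "modular_form (2 * int k) Gamma_theta (form_coeffs A \<xi>)
       (\<lambda>\<tau> (F, G, x, Xs). degree_part (4 * k - 1) (CS_Phi_W' A F G x D0 D1 D\<xi> \<tau>) Xs)"
    \<comment> \<open>(1, 1) times g is (a + c, b + d), both entries odd in either congruence
      class.\<close>
    by (rule mf [where p = 1 and r = 1 and K = "1 / (8 * of_real pi ^ 2)"])
      (auto simp: degree_part_def CS_Phi_W'_eq Gamma_theta_def)
next
  fix \<tau> :: complex and i :: "('m, 'm tvec, 'n) frame \<times> ('m, 'v, 2) frame \<times> 'm \<times> 'm vfield list"
  assume \<tau>: "Im \<tau> > 0"
  have S: "moebius_act S_mat \<tau> = - 1 / \<tau>" "aut_factor S_mat \<tau> = \<tau>"
    by (simp_all add: moebius_act_def aut_factor_def)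
  \<comment> \<open>The inversion sends (0, 1) to (1, 0) and has automorphy factor \<tau>; the
    constant 2^(2k) of \<open>CS_Phi_L_eq\<close> completes (2 \<tau>)^(2k).\<close>
  have "CS_char A F G x D0 D1 D\<xi> 0 1 (- 1 / \<tau>) Xs = \<tau> ^ (2 * k) * CS_char A F G x D0 D1 D\<xi> 1 0 \<tau> Xs"
    if "length Xs = 4 * k - 1" for F and G :: "('m, 'v, 2) frame" and x Xs
    using CS_char_moebius [OF S_mat_SL2Z \<tau>, of 1 0 1 0 A F G x D0 D1 D\<xi> Xs] Suc_half_degree [OF assms(1) that]
    unfolding S by (simp del: power_Suc)
  moreover have "Im (- 1 / \<tau>) > 0"
    using Im_moebius_act [OF S_mat_SL2Z \<tau>] unfolding S .
  ultimately show "case i of (F, G, x, Xs) \<Rightarrow>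
      degree_part (4 * k - 1) (CS_Phi_L A F G x k D0 D1 D\<xi> (- 1 / \<tau>)) Xs
        = (2 * \<tau>) ^ (2 * k) * degree_part (4 * k - 1) (CS_Phi_W A F G x D0 D1 D\<xi> \<tau>) Xs"
    using \<tau> assms(1) by (auto simp: degree_part_def CS_Phi_L_eq [OF _ assms(1)] CS_Phi_W_eq power_mult_distrib split: prod.split)
  have T: "moebius_act T_mat \<tau> = \<tau> + 1" "aut_factor T_mat \<tau> = 1"
    by (simp_all add: moebius_act_def aut_factor_def)
  \<comment> \<open>The translation sends (1, 0) to (1, 1). Its automorphy factor is 1, so the
    equality holds in every degree.\<close>
  have "CS_char A F G x D0 D1 D\<xi> 1 0 (\<tau> + 1) Xs = CS_char A F G x D0 D1 D\<xi> 1 1 \<tau> Xs"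
    for F and G :: "('m, 'v, 2) frame" and x Xs
    using CS_char_moebius [OF T_mat_SL2Z \<tau>, of 1 1 0 1] unfolding T by simp
  then show "case i of (F, G, x, Xs) \<Rightarrow> CS_Phi_W A F G x D0 D1 D\<xi> (\<tau> + 1) Xs = CS_Phi_W' A F G x D0 D1 D\<xi> \<tau> Xs"
    using \<tau> by (auto simp: CS_Phi_W_eq CS_Phi_W'_eq split: prod.split)
qed

end
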